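(* There exist absolute constants $0<c\le C<\infty$ such that for every finite positive Borel measure $\mu$ on $\mathbb{T}$, every $\zeta\in\mathbb{T}$ and every $\rho\in[0,1)$, if $I\subset\mathbb{T}$ is the arc of length $|I|=1-\rho$ with midpoint $\zeta$, then $$\frac{c}{k^\mu(\rho\zeta,\rho\zeta)}\le c_\mu(I)\le\frac{C}{k^\mu(\rho\zeta,\rho\zeta)}.$$
   Context: $\mathbb{D}$ is the open unit disc, $\mathbb{T}=\partial\mathbb{D}$; $L^2(\mathbb{T})$ is taken with respect to $dt/2\pi$, and $H^2$ is the Hardy space of the disc, with norm $\|f\|_{H^2}^2=\sum|a_n|^2$ for $f=\sum a_nz^n$. For a finite positive Borel measure $\mu$ on $\mathbb{T}$ and $f\in L^2(\mathbb{T})$ put $$\mathcal{D}_\mu(f)=\int_{\mathbb{T}}\left(\int_{\mathbb{T}}\frac{|f(e^{it})-f(\xi)|^2}{|e^{it}-\xi|^2}\frac{dt}{2\pi}\right)d\mu(\xi),$$ where $f(\xi)$ denotes the non-tangential limit at $\xi$ of the Poisson integral of $f$ (the inner integral is taken to be $+\infty$ where this limit does not exist). The harmonic Dirichlet type space is $\mathcal{D}^h(\mu)=\{f\in L^2(\mathbb{T}):\|f\|_\mu^2:=\|f\|_{L^2(\mathbb{T})}^2+\mathcal{D}_\mu(f)<\infty\}$, and $\mathcal{D}(\mu)=\mathcal{D}^h(\mu)\cap H^2$ with the same norm. $k^\mu$ is the reproducing kernel of the Hilbert space $\mathcal{D}(\mu)$, so $k^\mu(z,z)=\sup\{|f(z)|^2: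 f\in\mathcal{D}(\mu),\ \|f\|_\mu\le 1\}$. The $\mu$-capacity of an open set $U\subset\mathbb{T}$ is $$c_\mu(U)=\inf\{\|u\|_\mu^2:\ u\in\mathcal{D}^h(\mu),\ u\ge0\text{ and }u\ge1\text{ a.e. on }U\},$$ and for any $F\subset\mathbb{T}$, $c_\mu(F)=\inf\{c_\mu(U): U\text{ open},\ F\subset U\}$. *)

theory Defs
  imports "HOL-Analysis.Analysis"
begin

section \<open>The circle and its normalised Lebesgue measure\<close>

abbreviation unit_circle :: "complex set" where
  "unit_circle \<equiv> sphere 0 1"

definition circle_borel :: "complex measure" where
  "circle_borel = restrict_space borel unit_circle"

definition circle_measure :: "complex measure" where
  "circle_measure = distr (uniform_measure lborel {0..2 * pi}) circle_borel cis"

definition open_arc :: "complex \<Rightarrow> real \<Rightarrow> complex set" where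
  "open_arc \<zeta> l = (\<lambda>t. \<zeta> * cis t) ` {- l / 2 <..< l / 2}"

text \<open>
  Elements of \<open>L\<^sup>2\<close> are represented by functions \<^typ>\<open>complex \<Rightarrow> complex\<close> of which only the
  restriction to the circle matters; all notions below depend only on the almost everywhere class
  of a representative.
\<close>

definition L2_circle :: "(complex \<Rightarrow> complex) set" where
  "L2_circle = {f \<in> borel_measurable circle_measure.
     (\<integral>\<^sup>+ z. ennreal ((norm (f z))\<^sup>2) \<partial>circle_measure) < \<infinity>}"


section \<open>Poisson integrals and non-tangential limits\<close>

definition poisson_integral :: "(complex \<Rightarrow> complex) \<Rightarrow> complex \<Rightarrow> complex" where
  "poisson_integral f z =
     (LINT w|circle_measure. ((1 - (norm z)\<^sup>2) / (norm (w - z))\<^sup>2) *\<^sub>R f w)"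

definition stolz_region :: "real \<Rightarrow> complex \<Rightarrow> complex set" where
  "stolz_region \<kappa> \<xi> = {z \<in> ball 0 1. norm (z - \<xi>) < \<kappa> * (1 - norm z)}"

definition has_nontangential_limit :: "(complex \<Rightarrow> complex) \<Rightarrow> complex \<Rightarrow> complex \<Rightarrow> bool" where
  "has_nontangential_limit F l \<xi> \<longleftrightarrow>
     (\<forall>\<kappa>>1. (F \<longlongrightarrow> l) (at \<xi> within stolz_region \<kappa> \<xi>))"

text \<open>The value \<open>f(\<xi>)\<close>; it is unspecified where the non-tangential limit does not exist.\<close>

definition boundary_value :: "(complex \<Rightarrow> complex) \<Rightarrow> complex \<Rightarrow> complex" where
  "boundary_value f \<xi> = (THE l. has_nontangential_limit (poisson_integral f) l \<xi>)"


section \<open>Dirichlet type spaces\<close>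

definition finite_borel_measure_on_circle :: "complex measure \<Rightarrow> bool" where
  "finite_borel_measure_on_circle \<mu> \<longleftrightarrow> finite_measure \<mu> \<and> sets \<mu> = sets circle_borel"

definition local_dirichlet_integral :: "(complex \<Rightarrow> complex) \<Rightarrow> complex \<Rightarrow> ennreal" where
  "local_dirichlet_integral f \<xi> =
     (if \<exists>l. has_nontangential_limit (poisson_integral f) l \<xi>
      then (\<integral>\<^sup>+ w. ennreal ((norm (f w - boundary_value f \<xi>))\<^sup>2 / (norm (w - \<xi>))\<^sup>2)
              \<partial>circle_measure)
      else \<infinity>)"

definition dirichlet_integral :: "complex measure \<Rightarrow> (complex \<Rightarrow> complex) \<Rightarrow> ennreal" where
  "dirichlet_integral \<mu> f = (\<integral>\<^sup>+ \<xi>. local_dirichlet_integral f \<xi> \<partial>\<mu>)"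

definition mu_norm_sq :: "complex measure \<Rightarrow> (complex \<Rightarrow> complex) \<Rightarrow> ennreal" where
  "mu_norm_sq \<mu> f =
     (\<integral>\<^sup>+ z. ennreal ((norm (f z))\<^sup>2) \<partial>circle_measure) + dirichlet_integral \<mu> f"

definition harmonic_dirichlet_space :: "complex measure \<Rightarrow> (complex \<Rightarrow> complex) set" where
  "harmonic_dirichlet_space \<mu> = {f \<in> L2_circle. mu_norm_sq \<mu> f < \<infinity>}"

definition fourier_coeff :: "(complex \<Rightarrow> complex) \<Rightarrow> int \<Rightarrow> complex" where
  "fourier_coeff f n = (LINT z|circle_measure. f z * z powi (- n))"

text \<open>
  The Hardy space is identified, as usual, with a subspace of \<open>L\<^sup>2\<close> of the circle: \<open>f\<close> is the
  boundary function of the power series whose coefficients are the Fourier coefficients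
  of \<open>f\<close> of nonnegative index, the remaining ones being zero.
\<close>

definition hardy_space :: "(complex \<Rightarrow> complex) set" where
  "hardy_space = {f \<in> L2_circle. \<forall>n<0. fourier_coeff f n = 0}"

definition disc_value :: "(complex \<Rightarrow> complex) \<Rightarrow> complex \<Rightarrow> complex" where
  "disc_value f z = (\<Sum>n. fourier_coeff f (int n) * z ^ n)"

definition dirichlet_space :: "complex measure \<Rightarrow> (complex \<Rightarrow> complex) set" where
  "dirichlet_space \<mu> = harmonic_dirichlet_space \<mu> \<inter> hardy_space"

text \<open>The inner product inducing the norm given by \<^const>\<open>mu_norm_sq\<close>.\<close>

definition mu_inner ::
    "complex measure \<Rightarrow> (complex \<Rightarrow> complex) \<Rightarrow> (complex \<Rightarrow> complex) \<Rightarrow> complex" where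
  "mu_inner \<mu> f g =
     (LINT z|circle_measure. f z * cnj (g z)) +
     (LINT \<xi>|\<mu>. LINT w|circle_measure.
        (f w - boundary_value f \<xi>) * cnj (g w - boundary_value g \<xi>)
          / of_real ((norm (w - \<xi>))\<^sup>2))"


section \<open>Reproducing kernel and capacity\<close>

definition reproducing_element :: "complex measure \<Rightarrow> complex \<Rightarrow> (complex \<Rightarrow> complex) \<Rightarrow> bool" where
  "reproducing_element \<mu> w g \<longleftrightarrow>
     g \<in> dirichlet_space \<mu> \<and> (\<forall>f\<in>dirichlet_space \<mu>. disc_value f w = mu_inner \<mu> f g)"

text \<open>
  The reproducing element at a point of the disc is unique up to almost everywhere equality,
  so its values in the disc do not depend on the choice made here.
\<close>

definition mu_kernel :: "complex measure \<Rightarrow> complex \<Rightarrow> complex \<Rightarrow> complex" where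
  "mu_kernel \<mu> z w = disc_value (SOME g. reproducing_element \<mu> w g) z"

definition mu_capacity_open :: "complex measure \<Rightarrow> complex set \<Rightarrow> ennreal" where
  "mu_capacity_open \<mu> U =
     (INF u \<in> {u :: complex \<Rightarrow> real.
         (\<lambda>z. complex_of_real (u z)) \<in> harmonic_dirichlet_space \<mu> \<and>
         (AE z in circle_measure. 0 \<le> u z) \<and>
         (AE z in circle_measure. z \<in> U \<longrightarrow> 1 \<le> u z)}.
       mu_norm_sq \<mu> (\<lambda>z. complex_of_real (u z)))"

definition mu_capacity :: "complex measure \<Rightarrow> complex set \<Rightarrow> ennreal" where
  "mu_capacity \<mu> F =
     (INF U \<in> {U. openin (top_of_set unit_circle) U \<and> F \<subseteq> U}. mu_capacity_open \<mu> U)"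

end

(*
The value f(\<xi>) can be replaced by an infimum: D_\<xi>(f) = inf_a \<integral>|f - a|^2 / |w - \<xi>|^2, because a finite
integral forces the Poisson integral to tend non-tangentially to a (Cauchy-Schwarz). From this one
gets lower semicontinuity, hence a minimiser of the norm on {f(z) = 1}, whose squared norm is 1/k(z,z),
and the bound D_\<xi>(f_r) \<le> 616 D_\<xi>(f) for the dilations f_r of the Poisson integral.

Upper bound: if f is extremal, f(\<rho>\<zeta>) = 1 and |f|^2_\<mu> = 1/k, then by Harnack's inequality the
dilation by \<rho> of (9/4)|f| is at least 1 on the arc, and its norm is controlled by that of f.
Lower bound: if u is admissible for the capacity, its dilation by \<rho> is twice the real part of a
function p analytic across the circle; D_\<xi>(p) is half of D_\<xi>(2 Re p) by an orthogonality argument,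
and 2 Re p(\<rho>\<zeta>) = Pu(\<rho>^2\<zeta>) is bounded below since u \<ge> 1 on the arc.
*)
theory Submission
  imports Defs
begin

section \<open>Normalised Lebesgue measure on the circle\<close>

text \<open>The obstacle is that \<mu> may be singular to Lebesgue measure, while elements of
  \<open>L2_circle\<close> are only determined up to Lebesgue null sets: the value f(\<xi>), needed
  for \<mu>-almost every \<xi>, cannot be handled by almost everywhere arguments on f. In upper
  estimates it can be traded for any constant a, since at most one constant gives a finite energy at
  \<xi>. All comparisons of Dirichlet integrals are made at a fixed \<xi> and integrated against
  \<mu> only at the end, which is why the constants do not depend on \<mu>.

  Dilation by \<rho> does two jobs. It smooths at the scale 1 - \<rho> of the arc, so that one large
  value at \<rho>\<zeta> becomes a lower bound on the whole arc. It also multiplies the Fourier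
  coefficient of index n by \<rho>^|n|, so that the analytic half of a dilated function and its
  difference quotients are absolutely convergent series on the circle; the orthogonality argument is
  then a termwise integration.\<close>

lemma sets_circle_measure [simp, measurable_cong]: "sets circle_measure = sets circle_borel"
  by (simp add: circle_measure_def)

lemma space_circle_borel [simp]: "space circle_borel = unit_circle"
  by (simp add: circle_borel_def space_restrict_space)

lemma space_circle_measure [simp]: "space circle_measure = unit_circle"
  by (simp add: circle_measure_def)

lemma measurable_cis_circle [measurable]: "cis \<in> measurable borel circle_borel"
proof -
  have "cis \<in> borel_measurable borel"
    by (intro borel_measurable_continuous_onI continuous_intros)
  then show ?thesis
    unfolding circle_borel_def by (intro measurable_restrict_space2) auto
qed

lemma measurable_circle_id [measurable]: "(\<lambda>x. x) \<in> borel_measurable circle_borel"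
  unfolding circle_borel_def by (intro measurable_restrict_space1) simp

lemma measurable_circle_fst [measurable]: "fst \<in> borel_measurable (circle_borel \<Otimes>\<^sub>M N)"
  using measurable_compose[OF measurable_fst measurable_circle_id] by simp

lemma measurable_circle_snd [measurable]: "snd \<in> borel_measurable (N \<Otimes>\<^sub>M circle_borel)"
  using measurable_compose[OF measurable_snd measurable_circle_id] by simp

lemma emeasure_circle_measure:
  assumes "A \<in> sets circle_borel"
  shows "emeasure circle_measure A = emeasure lborel (cis -` A \<inter> {0..2*pi}) / ennreal (2 * pi)"
proof -
  have "cis -` A \<in> sets borel"
    using measurable_sets[OF measurable_cis_circle assms] by simp
  with assms show ?thesis
    unfolding circle_measure_def
    by (subst emeasure_distr) (simp_all add: Int_commute)
qed

lemma emeasure_circle_measure_space [simp]: "emeasure circle_measure unit_circle = 1"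
proof -
  have u: "unit_circle \<in> sets circle_borel"
    using sets.top[of circle_borel] by (simp only: space_circle_borel)
  have c: "cis -` unit_circle \<inter> {0..2*pi} = {0..2*pi}"
    by auto
  have "emeasure circle_measure unit_circle = ennreal (2*pi) / ennreal (2*pi)"
    unfolding emeasure_circle_measure[OF u] c by (subst emeasure_lborel_Icc) auto
  also have "\<dots> = 1"
    by (subst divide_ennreal) auto
  finally show ?thesis .
qed

interpretation circle: finite_measure circle_measure
  by standard (simp add: emeasure_circle_measure_space)

lemma nn_integral_circle_const [simp]: "(\<integral>\<^sup>+ w. c \<partial>circle_measure) = c"
  by (simp add: emeasure_circle_measure_space)

lemma measure_circle_measure_space [simp]: "measure circle_measure unit_circle = 1"
  by (simp add: measure_def emeasure_circle_measure_space)

lemma borel_measurable_circle_continuous: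
  "continuous_on unit_circle f \<Longrightarrow> f \<in> borel_measurable circle_measure"
  using borel_measurable_continuous_on_restrict[of unit_circle f]
  by (simp only: circle_borel_def measurable_cong_sets[OF sets_circle_measure refl])

lemma integrable_circle_bounded:
  fixes f :: "complex \<Rightarrow> 'b::{banach, second_countable_topology}"
  assumes "f \<in> borel_measurable circle_measure" "\<And>w. norm w = 1 \<Longrightarrow> norm (f w) \<le> B"
  shows "integrable circle_measure f"
  by (rule circle.integrable_const_bound[where B=B]) (use assms in \<open>auto intro!: AE_I2\<close>)

lemma integral_circle_measure:
  fixes f :: "complex \<Rightarrow> complex"
  assumes "f \<in> borel_measurable circle_measure"
  shows "(LINT w|circle_measure. f w) = (1 / (2 * pi)) *\<^sub>R (LINT t:{0..2*pi}|lborel. f (cis t))"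
proof -
  have f[measurable]: "f \<in> borel_measurable circle_borel"
    using assms by simp
  have "(\<lambda>t. indicator {0..2*pi} t / (2*pi) :: real) \<in> borel_measurable lborel"
    by measurable
  have "(LINT w|circle_measure. f w) = (LINT t|uniform_measure lborel {0..2*pi}. f (cis t))"
    unfolding circle_measure_def by (rule integral_distr) (auto cong: measurable_cong_sets)
  also have "uniform_measure lborel {0..2*pi} =
      density lborel (\<lambda>t. ennreal (indicator {0..2*pi} t / (2*pi)))"
    unfolding uniform_measure_def
    by (intro arg_cong[where f="density lborel"] ext)
       (auto simp: indicator_def divide_ennreal simp flip: ennreal_1)
  also have "(LINT t|\<dots>. f (cis t)) = (LINT t|lborel. (indicator {0..2*pi} t / (2*pi)) *\<^sub>R f (cis t))"
    by (rule integral_density) (auto intro!: AE_I2)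
  also have "\<dots> = (LINT t|lborel. (1/(2*pi)) *\<^sub>R (indicator {0..2*pi} t *\<^sub>R f (cis t)))"
    by (intro Bochner_Integration.integral_cong) auto
  also have "\<dots> = (1 / (2 * pi)) *\<^sub>R (LINT t:{0..2*pi}|lborel. f (cis t))"
    unfolding set_lebesgue_integral_def by (rule integral_scaleR_right)
  finally show ?thesis .
qed

lemma integral_circle_powi:
  "(LINT w|circle_measure. w powi n) = (if n = 0 then 1 else 0)"
proof (cases "n = 0")
  case False
  have c: "continuous_on unit_circle (\<lambda>w::complex. w powi n)"
    by (intro continuous_intros) auto
  let ?F = "\<lambda>t. cis (of_int n * t) / (\<i> * of_int n)"
  have "((\<lambda>t. cis t powi n) has_integral (?F (2*pi) - ?F 0)) {0..2*pi}"
  proof (rule fundamental_theorem_of_calculus)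
    fix t :: real
    have "((\<lambda>t. exp (\<i> * of_int n * of_real t) / (\<i> * of_int n)) has_vector_derivative
        exp (\<i> * of_int n * of_real t) * (\<i> * of_int n) / (\<i> * of_int n)) (at t within {0..2*pi})"
      by (rule derivative_intros has_vector_derivative_real_field derivative_eq_intros refl | simp)+
    then show "(?F has_vector_derivative cis t powi n) (at t within {0..2*pi})"
      using False by (simp add: cis_power_int) (simp add: cis_conv_exp mult.assoc)
  qed simp
  moreover have "?F (2*pi) = ?F 0"
    using cis_multiple_2pi[of "of_int n"] by (simp add: mult.commute)
  ultimately have hi: "((\<lambda>t. cis t powi n) has_integral 0) {0..2*pi}"
    by simp
  have "set_integrable lborel {0..2*pi} (\<lambda>t. cis t powi n)"
    by (intro borel_integrable_atLeastAtMost' continuous_intros) auto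
  then have "(LINT t:{0..2*pi}|lborel. cis t powi n) = 0"
    using set_borel_integral_eq_integral(2)[of "{0..2*pi}"] hi by (metis integral_unique)
  with c False show ?thesis
    by (subst integral_circle_measure) (auto intro: borel_measurable_circle_continuous)
qed simp

text \<open>Cosine is strictly decreasing on [0, pi], so |t| < l/2 becomes a strict inequality for
  the continuous function Re (w / \<zeta>). Openness and measurability of the arc are read off from
  this form.\<close>

lemma open_arc_eq:
  assumes "norm \<zeta> = 1" "0 \<le> l" "l \<le> 1"
  shows "open_arc \<zeta> l = {w \<in> unit_circle. cos (l / 2) < Re (w / \<zeta>)}"
proof (intro set_eqI iffI)
  fix w assume "w \<in> open_arc \<zeta> l"
  then obtain t where t: "w = \<zeta> * cis t" "- l / 2 < t" "t < l / 2"
    unfolding open_arc_def by fastforce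
  have "cos (l/2) < cos \<bar>t\<bar>"
    using t assms pi_gt3 by (intro cos_monotone_0_pi) auto
  with t assms show "w \<in> {w \<in> unit_circle. cos (l / 2) < Re (w / \<zeta>)}"
    by (auto simp: norm_mult)
next
  fix w assume "w \<in> {w \<in> unit_circle. cos (l / 2) < Re (w / \<zeta>)}"
  then have w: "norm w = 1" "cos (l/2) < Re (w/\<zeta>)" by auto
  define t where "t = Arg (w/\<zeta>)"
  have n: "norm (w/\<zeta>) = 1" using w assms by (simp add: norm_divide)
  then have z: "w / \<zeta> = cis t"
    by (metis Arg_eq cis_conv_exp mult_1 of_real_1 t_def mult.commute norm_zero zero_neq_one)
  have "\<bar>t\<bar> \<le> pi" using Arg_bounded[of "w/\<zeta>"] unfolding t_def by auto
  moreover have "cos (l/2) < cos \<bar>t\<bar>" using w z by simp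
  ultimately have "\<bar>t\<bar> < l/2"
    using cos_mono_less_eq[of "l/2" "\<bar>t\<bar>"] assms pi_gt3 by auto
  moreover have "w = \<zeta> * cis t" using z assms by (metis nonzero_eq_divide_eq norm_zero zero_neq_one mult.commute)
  ultimately show "w \<in> open_arc \<zeta> l"
    unfolding open_arc_def by (intro image_eqI[of _ _ t]) auto
qed

lemma openin_open_arc:
  assumes "norm \<zeta> = 1" "0 \<le> l" "l \<le> 1"
  shows "openin (top_of_set unit_circle) (open_arc \<zeta> l)"
proof -
  have "continuous_on UNIV (\<lambda>w. Re (w / \<zeta>))"
    using assms by (intro continuous_on_Re continuous_on_divide continuous_on_id continuous_on_const) auto
  then have o: "open {w. cos (l / 2) < Re (w / \<zeta>)}"
    by (intro open_Collect_less continuous_on_const)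
  have e: "open_arc \<zeta> l = unit_circle \<inter> {w. cos (l / 2) < Re (w / \<zeta>)}"
    unfolding open_arc_eq[OF assms] by blast
  show ?thesis unfolding e by (rule openin_open_Int[OF o])
qed

lemma open_arc_sets [measurable]:
  assumes "norm \<zeta> = 1" "0 \<le> l" "l \<le> 1"
  shows "open_arc \<zeta> l \<in> sets circle_borel"
proof -
  have "{w \<in> space circle_borel. cos (l / 2) < Re (w / \<zeta>)} \<in> sets circle_borel"
    by measurable
  then show ?thesis using open_arc_eq[OF assms] by simp
qed

lemma norm_open_arc_diff:
  assumes "norm \<zeta> = 1" "w \<in> open_arc \<zeta> l"
  shows "norm (w - \<zeta>) \<le> l / 2"
proof -
  obtain t where t: "w = \<zeta> * cis t" "- l / 2 < t" "t < l / 2"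
    using assms unfolding open_arc_def by fastforce
  have "norm (w - \<zeta>) = norm (\<zeta> * (cis t - 1))" by (simp add: t algebra_simps)
  also have "\<dots> = norm (cis t - 1)" using assms by (simp add: norm_mult)
  also have "\<dots> \<le> \<bar>t\<bar>"
    using dist_exp_i_1[of t] abs_sin_x_le_abs_x[of "t/2"] by (simp add: cis_conv_exp)
  finally show ?thesis using t by auto
qed

lemma emeasure_open_arc_ge:
  assumes "norm \<zeta> = 1" "0 \<le> l" "l \<le> 1"
  shows "ennreal (l / (4 * pi)) \<le> emeasure circle_measure (open_arc \<zeta> l)"
proof -
  define s where "s = Arg2pi \<zeta>"
  have s: "0 \<le> s" "s < 2*pi" "\<zeta> = cis s"
    using Arg2pi[of \<zeta>] assms by (auto simp: s_def cis_conv_exp is_Arg_def)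
  \<comment> \<open>One half of the arc, taken on the side that does not cross the cut of the
    parametrisation by [0, 2 pi]. This costs a factor 2, hence 4 pi instead of 2 pi in the
    bound.\<close>
  define J where "J = (if s \<le> pi then {s<..<s+l/2} else {s-l/2<..<s})"
  have J: "J \<subseteq> cis -` open_arc \<zeta> l \<inter> {0..2*pi}"
  proof
    fix t assume t: "t \<in> J"
    then have "t - s \<in> {-l/2<..<l/2}" by (auto simp: J_def split: if_splits)
    then have "cis t \<in> open_arc \<zeta> l"
      unfolding open_arc_def by (intro image_eqI[of _ _ "t - s"]) (auto simp: s cis_mult)
    moreover have "0 \<le> t" "t \<le> 2*pi"
      using t s assms pi_gt3 by (auto simp: J_def split: if_splits)
    ultimately show "t \<in> cis -` open_arc \<zeta> l \<inter> {0..2*pi}" by auto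
  qed
  have m[measurable]: "cis -` open_arc \<zeta> l \<in> sets borel"
    using measurable_sets[OF measurable_cis_circle open_arc_sets[OF assms]] by simp
  have "ennreal (l/2) = emeasure lborel J"
    using assms by (auto simp: J_def)
  also have "\<dots> \<le> emeasure lborel (cis -` open_arc \<zeta> l \<inter> {0..2*pi})"
    using J by (intro emeasure_mono) auto
  finally have "ennreal (l/2) / ennreal (2*pi) \<le> emeasure circle_measure (open_arc \<zeta> l)"
    unfolding emeasure_circle_measure[OF open_arc_sets[OF assms]] by (rule divide_right_mono_ennreal)
  then show ?thesis using assms by (simp add: divide_ennreal)
qed

section \<open>The Poisson kernel\<close>

definition poisson_kernel :: "complex \<Rightarrow> complex \<Rightarrow> real" where
  "poisson_kernel z w = (1 - (norm z)\<^sup>2) / (norm (w - z))\<^sup>2"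

lemma poisson_integral_eq:
  "poisson_integral f z = (LINT w|circle_measure. poisson_kernel z w *\<^sub>R f w)"
  by (simp add: poisson_integral_def poisson_kernel_def)

lemma poisson_kernel_nonneg: "norm z \<le> 1 \<Longrightarrow> 0 \<le> poisson_kernel z w"
  by (simp add: poisson_kernel_def power_le_one)

lemma measurable_poisson_kernel [measurable (raw)]:
  assumes [measurable]: "f \<in> borel_measurable N" "g \<in> borel_measurable N"
  shows "(\<lambda>x. poisson_kernel (f x) (g x)) \<in> borel_measurable N"
  unfolding poisson_kernel_def by measurable

lemma norm_circle_diff_ge: "norm w = 1 \<Longrightarrow> 1 - norm z \<le> norm (w - z)"
  using norm_triangle_ineq2[of w z] by simp

lemma poisson_kernel_le:
  assumes "norm z < 1" "norm w = 1"
  shows "poisson_kernel z w \<le> 2 / (1 - norm z)"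
proof -
  have "poisson_kernel z w \<le> (1 - (norm z)\<^sup>2) / (1 - norm z)\<^sup>2"
    unfolding poisson_kernel_def using assms norm_circle_diff_ge[of w z]
    by (intro divide_left_mono power_mono mult_pos_pos zero_less_power) (auto simp: power_le_one)
  also have "\<dots> = (1 + norm z) / (1 - norm z)"
  proof -
    have "1 - (norm z)\<^sup>2 = (1 + norm z) * (1 - norm z)" by (simp add: power2_eq_square algebra_simps)
    then show ?thesis using assms by (simp add: power2_eq_square)
  qed
  also have "\<dots> \<le> 2 / (1 - norm z)"
    using assms by (intro divide_right_mono) auto
  finally show ?thesis .
qed

lemma integrable_poisson_kernel_times:
  fixes f :: "complex \<Rightarrow> 'b::{banach, second_countable_topology}"
  assumes "integrable circle_measure f" "norm z < 1"
  shows "integrable circle_measure (\<lambda>w. poisson_kernel z w *\<^sub>R f w)"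
proof (rule Bochner_Integration.integrable_bound)
  show "integrable circle_measure (\<lambda>w. (2 / (1 - norm z)) *\<^sub>R f w)"
    using assms by simp
  have [measurable]: "f \<in> borel_measurable circle_borel"
    using borel_measurable_integrable[OF assms(1)] by simp
  show "(\<lambda>w. poisson_kernel z w *\<^sub>R f w) \<in> borel_measurable circle_measure"
    by measurable
  show "AE w in circle_measure. norm (poisson_kernel z w *\<^sub>R f w) \<le> norm ((2 / (1 - norm z)) *\<^sub>R f w)"
  proof (rule AE_I2)
    fix w assume "w \<in> space circle_measure"
    then have "\<bar>poisson_kernel z w\<bar> \<le> \<bar>2 / (1 - norm z)\<bar>"
      using assms poisson_kernel_le[of z w] poisson_kernel_nonneg[of z w] by simp
    then show "norm (poisson_kernel z w *\<^sub>R f w) \<le> norm ((2 / (1 - norm z)) *\<^sub>R f w)"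
      unfolding norm_scaleR by (rule mult_right_mono) simp
  qed
qed

text \<open>Weierstrass test: the terms are bounded on the circle by a summable sequence, so sum and
  integral against f may be exchanged. Both the expansion of the Poisson kernel and the series of
  \<open>analytic_series\<close> go through this.\<close>

lemma integral_circle_suminf:
  fixes f :: "complex \<Rightarrow> complex" and \<phi> :: "nat \<Rightarrow> complex \<Rightarrow> complex"
  assumes f: "integrable circle_measure f"
    and \<phi>: "\<And>n. \<phi> n \<in> borel_measurable circle_measure"
    and b: "\<And>n w. norm w = 1 \<Longrightarrow> norm (\<phi> n w) \<le> b n" "summable b"
  shows "(LINT w|circle_measure. (\<Sum>n. \<phi> n w) * f w) = (\<Sum>n. LINT w|circle_measure. \<phi> n w * f w)"
    and "integrable circle_measure (\<lambda>w. (\<Sum>n. \<phi> n w) * f w)"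
    and "summable (\<lambda>n. LINT w|circle_measure. \<phi> n w * f w)"
proof -
  have [measurable]: "f \<in> borel_measurable circle_borel" "\<And>n. \<phi> n \<in> borel_measurable circle_borel"
    using borel_measurable_integrable[OF f] \<phi> by simp_all
  have b0: "0 \<le> b n" for n
    using b(1)[of 1 n] norm_ge_zero[of "\<phi> n 1"] by (simp del: norm_ge_zero)
  have i: "integrable circle_measure (\<lambda>w. \<phi> n w * f w)" for n
  proof (rule Bochner_Integration.integrable_bound)
    show "integrable circle_measure (\<lambda>w. of_real (b n) * f w)"
      using f by simp
    show "AE w in circle_measure. norm (\<phi> n w * f w) \<le> norm (of_real (b n) * f w)"
      using b(1) b0 by (intro AE_I2) (auto simp: norm_mult intro!: mult_right_mono)
  qed measurable
  have nsum: "summable (\<lambda>n. norm (\<phi> n w))" if "norm w = 1" for w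
    using b that by (intro summable_comparison_test'[OF b(2)]) auto
  have ae: "AE w in circle_measure. summable (\<lambda>n. norm (\<phi> n w * f w))"
    using nsum by (intro AE_I2) (auto simp: norm_mult intro!: summable_mult2)
  have sn: "summable (\<lambda>n. LINT w|circle_measure. norm (\<phi> n w * f w))"
  proof (rule summable_comparison_test')
    show "summable (\<lambda>n. b n * (LINT w|circle_measure. norm (f w)))"
      using b(2) by (rule summable_mult2)
    fix n :: nat assume "0 \<le> n"
    have "(LINT w|circle_measure. norm (\<phi> n w * f w)) \<le> (LINT w|circle_measure. b n * norm (f w))"
    proof (rule integral_mono)
      show "integrable circle_measure (\<lambda>w. norm (\<phi> n w * f w))"
        using i by (rule integrable_norm)
      show "integrable circle_measure (\<lambda>w. b n * norm (f w))"
        using f by simp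
    qed (auto simp: norm_mult intro!: mult_right_mono b(1))
    then show "norm (LINT w|circle_measure. norm (\<phi> n w * f w)) \<le> b n * (LINT w|circle_measure. norm (f w))"
      by (simp add: integral_nonneg_AE)
  qed
  have e: "(\<Sum>n. \<phi> n w * f w) = (\<Sum>n. \<phi> n w) * f w" if "norm w = 1" for w
    by (rule suminf_mult2[OF summable_norm_cancel, OF nsum[OF that], symmetric])
  show "(LINT w|circle_measure. (\<Sum>n. \<phi> n w) * f w) = (\<Sum>n. LINT w|circle_measure. \<phi> n w * f w)"
  proof -
    have "(LINT w|circle_measure. (\<Sum>n. \<phi> n w) * f w) = (LINT w|circle_measure. (\<Sum>n. \<phi> n w * f w))"
      by (rule Bochner_Integration.integral_cong[OF refl], rule e[symmetric]) simp
    then show ?thesis using integral_suminf[OF i ae sn] by (rule trans)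
  qed
  show "integrable circle_measure (\<lambda>w. (\<Sum>n. \<phi> n w) * f w)"
    by (rule Bochner_Integration.integrable_cong[THEN iffD1, OF refl _ integrable_suminf[OF i ae sn]])
       (auto simp: e)
  show "summable (\<lambda>n. LINT w|circle_measure. \<phi> n w * f w)"
    using summable_integral[OF i ae sn] .
qed

section \<open>Fourier expansion of Poisson integrals\<close>

lemma cnj_circle: "norm w = 1 \<Longrightarrow> cnj w = inverse w"
  by (metis complex_cnj_inverse complex_cnj_cnj divide_conv_cnj div_by_1 inverse_eq_divide mult_1)

text \<open>With q = z / w the kernel is (1 - |q|^2) / |1 - q|^2, which splits into 1 / (1 - q) and
  cnj q / (1 - cnj q). The second geometric series starts at exponent 1, so that the constant term
  is counted once.\<close>

lemma poisson_kernel_series: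
  assumes z: "norm z < 1" and w: "norm w = 1"
  shows "of_real (poisson_kernel z w) =
      (\<Sum>n. z ^ n * w powi (- int n)) + (\<Sum>n. cnj z ^ Suc n * w powi (int (Suc n)))"
proof -
  have cw: "w \<noteq> 0" "w * cnj w = 1" using w by (auto simp: complex_norm_square[symmetric])
  define q where "q = z * inverse w"
  have q: "norm q < 1" using z w by (simp add: q_def norm_mult norm_inverse)
  have cq: "cnj q = cnj z * w" using w by (simp add: q_def cnj_circle flip: cnj_circle)
  have s1: "(\<Sum>n. z ^ n * w powi (- int n)) = 1 / (1 - q)"
    using suminf_geometric[OF q] by (simp add: q_def power_int_minus power_mult_distrib power_inverse)
  have "(\<Sum>n. cnj z ^ Suc n * w powi (int (Suc n))) = (\<Sum>n. cnj q * cnj q ^ n)"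
    by (simp only: cq power_int_of_nat power_Suc power_mult_distrib mult_ac)
  also have "\<dots> = cnj q * (1 / (1 - cnj q))"
    using suminf_geometric[of "cnj q"] summable_geometric[of "cnj q"] q by (subst suminf_mult) auto
  finally have s2: "(\<Sum>n. cnj z ^ Suc n * w powi (int (Suc n))) = cnj q / (1 - cnj q)" by simp
  have ne: "1 - q \<noteq> 0" "1 - cnj q \<noteq> 0" using q by auto
  have "w - z = w * (1 - q)" using cw by (simp add: q_def field_simps)
  then have "norm (w - z) = norm (1 - q)" using w by (simp add: norm_mult)
  moreover have "norm z = norm q" using w by (simp add: q_def norm_mult norm_inverse)
  ultimately have "of_real (poisson_kernel z w) = (1 - q * cnj q) / ((1 - q) * cnj (1 - q))"
    unfolding poisson_kernel_def by (simp only: of_real_divide of_real_diff of_real_1 complex_norm_square)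
  also have "\<dots> = 1 / (1 - q) + cnj q / (1 - cnj q)"
    using ne by (simp add: field_simps)
  finally show ?thesis using s1 s2 by simp
qed

lemma measurable_powi_circle [measurable]:
  "(\<lambda>w::complex. w powi n) \<in> borel_measurable circle_borel"
proof -
  have "continuous_on unit_circle (\<lambda>w::complex. w powi n)"
    by (intro continuous_intros) auto
  then show ?thesis using borel_measurable_circle_continuous[of "\<lambda>w. w powi n"] by simp
qed

lemma norm_powi_circle: "norm w = 1 \<Longrightarrow> norm (w powi n) = (1::real)" for w :: complex
  by (simp add: norm_power_int)

lemma poisson_integral_series:
  assumes f: "integrable circle_measure f" and z: "norm z < 1"
  shows "poisson_integral f z =
      disc_value f z + (\<Sum>n. fourier_coeff f (- int (Suc n)) * cnj z ^ Suc n)"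
proof -
  let ?A = "\<lambda>n w. z ^ n * w powi (- int n)" and ?B = "\<lambda>n w. cnj z ^ Suc n * w powi (int (Suc n))"
  have sA: "summable (\<lambda>n. norm z ^ n)" and sB: "summable (\<lambda>n. norm z ^ Suc n)"
    using z by (auto intro: summable_geometric summable_mult)
  have mA: "?A n \<in> borel_measurable circle_measure" and mB: "?B n \<in> borel_measurable circle_measure" for n
    by measurable
  have bA: "norm (?A n w) \<le> norm z ^ n" and bB: "norm (?B n w) \<le> norm z ^ Suc n" if "norm w = 1" for n w
    using that by (simp_all add: norm_mult norm_power norm_power_int del: power_Suc of_nat_Suc)
  note A = integral_circle_suminf[OF f mA bA sA]
  note B = integral_circle_suminf[OF f mB bB sB]
  have "poisson_integral f z = (LINT w|circle_measure. (\<Sum>n. ?A n w) * f w + (\<Sum>n. ?B n w) * f w)"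
    unfolding poisson_integral_eq
    by (intro Bochner_Integration.integral_cong refl)
       (simp add: scaleR_conv_of_real poisson_kernel_series[OF z] distrib_right)
  also have "\<dots> = (\<Sum>n. LINT w|circle_measure. ?A n w * f w) + (\<Sum>n. LINT w|circle_measure. ?B n w * f w)"
    by (simp only: Bochner_Integration.integral_add[OF A(2) B(2)] A(1) B(1))
  also have "(\<lambda>n. LINT w|circle_measure. ?A n w * f w) = (\<lambda>n. fourier_coeff f (int n) * z ^ n)"
    by (simp add: fourier_coeff_def mult_ac flip: integral_mult_right_zero)
  also have "(\<lambda>n. LINT w|circle_measure. ?B n w * f w) = (\<lambda>n. fourier_coeff f (- int (Suc n)) * cnj z ^ Suc n)"
    by (simp add: fourier_coeff_def mult_ac del: power_Suc of_nat_Suc flip: integral_mult_right_zero)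
  finally show ?thesis by (simp add: disc_value_def)
qed

lemma fourier_coeff_const: "fourier_coeff (\<lambda>_. c) n = (if n = 0 then c else 0)"
  by (simp add: fourier_coeff_def integral_circle_powi)

lemma poisson_integral_const:
  assumes "norm z < 1"
  shows "poisson_integral (\<lambda>_. c) z = c"
proof -
  have "disc_value (\<lambda>_. c) z = (\<Sum>n. if n = 0 then c else 0)"
    unfolding disc_value_def by (intro suminf_cong) (auto simp: fourier_coeff_const)
  also have "\<dots> = c" using suminf_finite[of "{0::nat}" "\<lambda>n. if n = 0 then c else 0"] by simp
  finally show ?thesis
    using assms by (simp add: poisson_integral_series fourier_coeff_const)
qed

lemma integral_poisson_kernel:
  assumes "norm z < 1"
  shows "(LINT w|circle_measure. poisson_kernel z w) = 1"
proof -
  have "of_real (LINT w|circle_measure. poisson_kernel z w) = poisson_integral (\<lambda>_. 1) z"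
    unfolding poisson_integral_eq by (simp add: scaleR_conv_of_real)
  then show ?thesis using poisson_integral_const[OF assms] by (metis of_real_eq_1_iff)
qed

lemma nn_integral_poisson_kernel:
  assumes "norm z < 1"
  shows "(\<integral>\<^sup>+ w. ennreal (poisson_kernel z w) \<partial>circle_measure) = 1"
proof -
  have "integrable circle_measure (\<lambda>w. poisson_kernel z w)"
    using integrable_poisson_kernel_times[of "\<lambda>_. 1::real" z] assms by simp
  then show ?thesis
    using assms by (subst nn_integral_eq_integral) (auto simp: poisson_kernel_nonneg integral_poisson_kernel)
qed

text \<open>The integrand is the Poisson kernel without its numerator. Used at points z = (1 -
  \<delta>) \<xi>, this value yields the measure and tail estimates around \<xi> without
  parametrising arcs.\<close>

lemma nn_integral_inverse_square_dist:
  assumes "norm z < 1"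
  shows "(\<integral>\<^sup>+ w. ennreal (1 / (norm (w - z))\<^sup>2) \<partial>circle_measure) = ennreal (1 / (1 - (norm z)\<^sup>2))"
proof -
  have z: "(norm z)\<^sup>2 < 1" using assms by (simp add: abs_square_less_1)
  have "(\<integral>\<^sup>+ w. ennreal (1 / (norm (w - z))\<^sup>2) \<partial>circle_measure) =
      (\<integral>\<^sup>+ w. ennreal (1 / (1 - (norm z)\<^sup>2)) * ennreal (poisson_kernel z w) \<partial>circle_measure)"
    using z by (intro nn_integral_cong) (simp add: poisson_kernel_def flip: ennreal_mult')
  also have "\<dots> = ennreal (1 / (1 - (norm z)\<^sup>2))"
    by (subst nn_integral_cmult) (simp_all add: nn_integral_poisson_kernel assms)
  finally show ?thesis .
qed

lemma fourier_coeff_cnj: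
  assumes "\<And>w. norm w = 1 \<Longrightarrow> cnj (f w) = f w"
  shows "fourier_coeff f (- n) = cnj (fourier_coeff f n)"
proof -
  have "cnj (w powi (- n)) = w powi n" if "norm w = 1" for w
    using that by (simp add: cnj_circle power_int_minus power_int_inverse)
  then show ?thesis
    unfolding fourier_coeff_def Bochner_Integration.integral_cnj[symmetric]
    by (intro Bochner_Integration.integral_cong) (auto simp: assms)
qed

lemma norm_fourier_coeff_le:
  "norm (fourier_coeff f n) \<le> (LINT w|circle_measure. norm (f w))"
  unfolding fourier_coeff_def
  by (rule order_trans[OF integral_norm_bound], rule eq_refl)
     (auto simp: norm_mult norm_powi_circle intro: Bochner_Integration.integral_cong)

lemma summable_disc_value:
  assumes "norm z < 1"
  shows "summable (\<lambda>n. fourier_coeff f (int n) * z ^ n)"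
proof (rule summable_comparison_test')
  show "summable (\<lambda>n. (LINT w|circle_measure. norm (f w)) * norm z ^ n)"
    using assms by (intro summable_mult summable_geometric) auto
qed (auto simp: norm_mult norm_power intro!: mult_right_mono norm_fourier_coeff_le)

text \<open>For f real on the circle the coefficients of index n and -n are conjugate, so the
  expansion is a power series plus its conjugate; the subtraction corrects the doubled constant
  term.\<close>

lemma poisson_integral_real:
  assumes f: "integrable circle_measure f" "\<And>w. norm w = 1 \<Longrightarrow> cnj (f w) = f w" and z: "norm z < 1"
  shows "poisson_integral f z = of_real (2 * Re (disc_value f z)) - fourier_coeff f 0"
proof -
  have "disc_value f z = fourier_coeff f 0 + (\<Sum>n. fourier_coeff f (int (Suc n)) * z ^ Suc n)"
    using suminf_split_head[OF summable_disc_value[OF z, of f]]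
    by (simp add: disc_value_def del: power_Suc of_nat_Suc)
  moreover have "(\<Sum>n. fourier_coeff f (- int (Suc n)) * cnj z ^ Suc n) =
      cnj (\<Sum>n. fourier_coeff f (int (Suc n)) * z ^ Suc n)"
  proof -
    have "summable (\<lambda>n. fourier_coeff f (int (Suc n)) * z ^ Suc n)"
      using summable_Suc_iff[of "\<lambda>n. fourier_coeff f (int n) * z ^ n"] summable_disc_value[OF z] by blast
    then have "(\<lambda>n. cnj (fourier_coeff f (int (Suc n)) * z ^ Suc n)) sums
        cnj (\<Sum>n. fourier_coeff f (int (Suc n)) * z ^ Suc n)"
      by (simp only: sums_cnj summable_sums)
    from sums_unique[OF this] show ?thesis
      by (simp only: fourier_coeff_cnj[OF f(2)] complex_cnj_mult complex_cnj_power)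
  qed
  moreover have "cnj (fourier_coeff f 0) = fourier_coeff f 0"
    using fourier_coeff_cnj[of f 0, OF f(2)] by simp
  ultimately show ?thesis
    using poisson_integral_series[OF f(1) z] complex_add_cnj[of "disc_value f z"] by (simp add: algebra_simps)
qed

lemma poisson_integral_hardy:
  assumes "f \<in> hardy_space" "integrable circle_measure f" "norm z < 1"
  shows "poisson_integral f z = disc_value f z"
  using assms by (subst poisson_integral_series) (auto simp: hardy_space_def)

section \<open>Local Dirichlet integrals as weighted distances\<close>

abbreviation circle_norm_sq :: "(complex \<Rightarrow> complex) \<Rightarrow> ennreal" where
  "circle_norm_sq f \<equiv> (\<integral>\<^sup>+ z. ennreal ((norm (f z))\<^sup>2) \<partial>circle_measure)"

text \<open>The integral defining the local Dirichlet integral, with the boundary value replaced by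
  a free constant a. For f in \<open>L2_circle\<close> and \<xi> on the circle it is finite for at
  most one a.\<close>

definition local_energy :: "(complex \<Rightarrow> complex) \<Rightarrow> complex \<Rightarrow> complex \<Rightarrow> ennreal" where
  "local_energy f a \<xi> = (\<integral>\<^sup>+ w. ennreal ((norm (f w - a))\<^sup>2 / (norm (w - \<xi>))\<^sup>2) \<partial>circle_measure)"

lemma L2_circleD:
  assumes "f \<in> L2_circle"
  shows L2_circle_measurable: "f \<in> borel_measurable circle_borel"
    and L2_circle_integrable: "integrable circle_measure f"
    and L2_circle_finite: "circle_norm_sq f < \<infinity>"
proof -
  show m[measurable]: "f \<in> borel_measurable circle_borel" and fin: "circle_norm_sq f < \<infinity>"
    using assms by (auto simp: L2_circle_def)
  show "integrable circle_measure f"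
  proof (rule integrableI_bounded)
    have "(\<integral>\<^sup>+ z. ennreal (norm (f z)) \<partial>circle_measure) \<le> (\<integral>\<^sup>+ z. 1 + ennreal ((norm (f z))\<^sup>2) \<partial>circle_measure)"
    proof (rule nn_integral_mono)
      fix z
      have "norm (f z) \<le> 1 + (norm (f z))\<^sup>2"
        using zero_le_power2[of "norm (f z) - 1"] by (simp add: power2_eq_square algebra_simps)
          (smt (verit) norm_ge_zero mult_nonneg_nonneg)
      then show "ennreal (norm (f z)) \<le> 1 + ennreal ((norm (f z))\<^sup>2)"
        by (simp flip: ennreal_1 ennreal_plus)
    qed
    also have "\<dots> = 1 + circle_norm_sq f"
      by (subst nn_integral_add) auto
    finally show "(\<integral>\<^sup>+ z. ennreal (norm (f z)) \<partial>circle_measure) < \<infinity>"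
      using fin by (auto simp: less_top[symmetric] top_unique)
  qed simp
qed

text \<open>Cauchy-Schwarz with \<open>ennreal\<close> factors, either of which may be infinite. If
  the product is not integrable, its Bochner integral is 0 by convention and the bound is
  trivial.\<close>

lemma norm_integral_square_le:
  fixes h :: "'a \<Rightarrow> complex" and \<phi> :: "'a \<Rightarrow> real"
  assumes [measurable]: "h \<in> borel_measurable M" "\<phi> \<in> borel_measurable M"
  shows "ennreal ((norm (LINT w|M. \<phi> w *\<^sub>R h w))\<^sup>2) \<le>
    (\<integral>\<^sup>+ w. ennreal ((\<phi> w)\<^sup>2) \<partial>M) * (\<integral>\<^sup>+ w. ennreal ((norm (h w))\<^sup>2) \<partial>M)"
proof (cases "integrable M (\<lambda>w. \<phi> w *\<^sub>R h w)")
  case True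
  have "ennreal (norm (LINT w|M. \<phi> w *\<^sub>R h w)) \<le> (\<integral>\<^sup>+ w. ennreal (norm (\<phi> w *\<^sub>R h w)) \<partial>M)"
    using integral_norm_bound_ennreal[OF True] by simp
  also have "\<dots> = (\<integral>\<^sup>+ w. ennreal \<bar>\<phi> w\<bar> * ennreal (norm (h w)) \<partial>M)"
    by (simp add: ennreal_mult)
  finally have "(ennreal (norm (LINT w|M. \<phi> w *\<^sub>R h w)))\<^sup>2 \<le> (\<integral>\<^sup>+ w. ennreal \<bar>\<phi> w\<bar> * ennreal (norm (h w)) \<partial>M)\<^sup>2"
    by (rule power_mono) simp
  also have "\<dots> \<le> (\<integral>\<^sup>+ w. (ennreal \<bar>\<phi> w\<bar>)\<^sup>2 \<partial>M) * (\<integral>\<^sup>+ w. (ennreal (norm (h w)))\<^sup>2 \<partial>M)"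
    by (rule Cauchy_Schwarz_nn_integral) auto
  finally show ?thesis by (simp add: ennreal_power)
qed (simp add: not_integrable_integral_eq)

section \<open>Integral estimates around a boundary point\<close>

lemma norm_dilation_diff:
  fixes w :: complex
  assumes "norm w = 1" "0 \<le> r" "r \<le> 1"
  shows "norm (of_real r * w - w) = 1 - r"
proof -
  have "of_real r * w - w = - of_real (1 - r) * w" by (simp add: algebra_simps)
  then show ?thesis using assms by (simp add: norm_mult del: of_real_diff)
qed

text \<open>For z = (1 - \<delta>) \<xi> and |w - \<xi>| \<le> \<delta> one has |w - z| \<le> 2
  \<delta>, so the indicator is at most 4 \<delta>^2 / |w - z|^2. The integral of this majorant is 4
  \<delta> / (2 - \<delta>).\<close>

lemma emeasure_circle_near:
  assumes "norm \<xi> = 1" "0 < \<delta>" "\<delta> \<le> 1"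
  shows "emeasure circle_measure {w \<in> unit_circle. norm (w - \<xi>) \<le> \<delta>} \<le> ennreal (4 * \<delta>)"
proof -
  define z where "z = of_real (1 - \<delta>) * \<xi>"
  have nz: "norm z = 1 - \<delta>" using assms by (simp add: z_def norm_mult del: of_real_diff)
  have dz: "norm (\<xi> - z) = \<delta>"
    using norm_dilation_diff[of \<xi> "1 - \<delta>"] assms by (simp add: z_def norm_minus_commute)
  have "{w \<in> space circle_borel. norm (w - \<xi>) \<le> \<delta>} \<in> sets circle_borel" by measurable
  then have "emeasure circle_measure {w \<in> unit_circle. norm (w - \<xi>) \<le> \<delta>} =
      (\<integral>\<^sup>+ w. indicator {w \<in> unit_circle. norm (w - \<xi>) \<le> \<delta>} w \<partial>circle_measure)"
    by (subst nn_integral_indicator) auto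
  also have "\<dots> \<le> (\<integral>\<^sup>+ w. ennreal (4 * \<delta>\<^sup>2) * ennreal (1 / (norm (w - z))\<^sup>2) \<partial>circle_measure)"
  proof (rule nn_integral_mono)
    fix w assume "w \<in> space circle_measure"
    then have w: "norm w = 1" by simp
    show "indicator {w \<in> unit_circle. norm (w - \<xi>) \<le> \<delta>} w \<le> ennreal (4 * \<delta>\<^sup>2) * ennreal (1 / (norm (w - z))\<^sup>2)"
    proof (cases "norm (w - \<xi>) \<le> \<delta>")
      case True
      have "norm (w - z) \<le> 2 * \<delta>"
        using norm_triangle_ineq[of "w - \<xi>" "\<xi> - z"] True dz by simp
      then have "(norm (w - z))\<^sup>2 \<le> 4 * \<delta>\<^sup>2"
        using power_mono[of "norm (w - z)" "2 * \<delta>" 2] by (simp add: power_mult_distrib)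
      moreover have "0 < norm (w - z)"
        using norm_circle_diff_ge[OF w, of z] nz assms by linarith
      ultimately have "1 \<le> 4 * \<delta>\<^sup>2 * (1 / (norm (w - z))\<^sup>2)"
        by (simp add: field_simps)
      then show ?thesis
        using True w by (simp flip: ennreal_mult' ennreal_1)
    qed simp
  qed
  also have "\<dots> = ennreal (4 * \<delta>\<^sup>2) * ennreal (1 / (1 - (norm z)\<^sup>2))"
    using nz assms by (subst nn_integral_cmult) (auto simp: nn_integral_inverse_square_dist)
  also have "\<dots> = ennreal (4 * \<delta>\<^sup>2 / (1 - (norm z)\<^sup>2))"
    by (simp flip: ennreal_mult')
  also have "\<dots> \<le> ennreal (4 * \<delta>)"
  proof (rule ennreal_leI)
    have "1 - (norm z)\<^sup>2 = \<delta> * (2 - \<delta>)" by (simp add: nz power2_eq_square algebra_simps)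
    then show "4 * \<delta>\<^sup>2 / (1 - (norm z)\<^sup>2) \<le> 4 * \<delta>"
      using assms by (simp add: divide_simps power2_eq_square)
  qed
  finally show ?thesis .
qed

text \<open>The same auxiliary point z: from |\<xi> - z| = \<delta> \<le> |w - \<xi>| follows |w -
  z| \<le> 2 |w - \<xi>|, so the singular weight is dominated by 4 / |w - z|^2.\<close>

lemma nn_integral_circle_far:
  assumes "norm \<xi> = 1" "0 < \<delta>" "\<delta> \<le> 1"
  shows "(\<integral>\<^sup>+ w. indicator {w. \<delta> \<le> norm (w - \<xi>)} w * ennreal (1 / (norm (w - \<xi>))\<^sup>2) \<partial>circle_measure) \<le> ennreal (4 / \<delta>)"
proof -
  define z where "z = of_real (1 - \<delta>) * \<xi>"
  have nz: "norm z = 1 - \<delta>" using assms by (simp add: z_def norm_mult del: of_real_diff)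
  have dz: "norm (\<xi> - z) = \<delta>"
    using norm_dilation_diff[of \<xi> "1 - \<delta>"] assms by (simp add: z_def norm_minus_commute)
  have "(\<integral>\<^sup>+ w. indicator {w. \<delta> \<le> norm (w - \<xi>)} w * ennreal (1 / (norm (w - \<xi>))\<^sup>2) \<partial>circle_measure) \<le>
     (\<integral>\<^sup>+ w. ennreal 4 * ennreal (1 / (norm (w - z))\<^sup>2) \<partial>circle_measure)"
  proof (rule nn_integral_mono)
    fix w assume "w \<in> space circle_measure"
    then have w: "norm w = 1" by simp
    show "indicator {w. \<delta> \<le> norm (w - \<xi>)} w * ennreal (1 / (norm (w - \<xi>))\<^sup>2) \<le> ennreal 4 * ennreal (1 / (norm (w - z))\<^sup>2)"
    proof (cases "\<delta> \<le> norm (w - \<xi>)")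
      case True
      have "norm (w - z) \<le> 2 * norm (w - \<xi>)"
        using norm_triangle_ineq[of "w - \<xi>" "\<xi> - z"] True dz by simp
      then have "(norm (w - z))\<^sup>2 \<le> 4 * (norm (w - \<xi>))\<^sup>2"
        using power_mono[of "norm (w - z)" "2 * norm (w - \<xi>)" 2] by (simp add: power_mult_distrib)
      moreover have "0 < norm (w - z)"
        using norm_circle_diff_ge[OF w, of z] nz assms by linarith
      moreover have "0 < norm (w - \<xi>)" using True assms by linarith
      ultimately have "1 / (norm (w - \<xi>))\<^sup>2 \<le> 4 * (1 / (norm (w - z))\<^sup>2)"
        by (simp add: field_simps)
      then have "ennreal (1 / (norm (w - \<xi>))\<^sup>2) \<le> ennreal 4 * ennreal (1 / (norm (w - z))\<^sup>2)"
        by (subst ennreal_mult'[symmetric]) (auto intro: ennreal_leI)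
      then show ?thesis
        using True by simp
    qed simp
  qed
  also have "\<dots> = ennreal 4 * ennreal (1 / (1 - (norm z)\<^sup>2))"
    using nz assms by (subst nn_integral_cmult) (auto simp: nn_integral_inverse_square_dist)
  also have "\<dots> = ennreal (4 / (1 - (norm z)\<^sup>2))"
    by (subst ennreal_mult'[symmetric]) auto
  also have "\<dots> \<le> ennreal (4 / \<delta>)"
  proof (rule ennreal_leI)
    have "1 - (norm z)\<^sup>2 = \<delta> * (2 - \<delta>)" by (simp add: nz power2_eq_square algebra_simps)
    then show "4 / (1 - (norm z)\<^sup>2) \<le> 4 / \<delta>"
      using assms by (simp add: divide_simps)
  qed
  finally show ?thesis .
qed

text \<open>Let \<delta> tend to 0 in \<open>emeasure_circle_near\<close>. Hence the value 0 that
  division by zero produces at w = \<xi> does not affect any integral.\<close>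

lemma AE_circle_neq:
  assumes "norm \<xi> = 1"
  shows "AE w in circle_measure. w \<noteq> \<xi>"
proof -
  have "{w \<in> space circle_borel. norm (w - \<xi>) \<le> \<delta>} \<in> sets circle_borel" for \<delta> by measurable
  then have m: "{w \<in> unit_circle. norm (w - \<xi>) \<le> \<delta>} \<in> sets circle_borel" for \<delta> by simp
  have "{w \<in> unit_circle. norm (w - \<xi>) \<le> 0} = {\<xi>}" using assms by auto
  then have ms: "{\<xi>} \<in> sets circle_borel" using m[of 0] by simp
  have "emeasure circle_measure {\<xi>} \<le> 0"
  proof (rule ennreal_le_epsilon)
    fix e :: real assume e: "0 < e"
    define \<delta> where "\<delta> = min 1 (e / 4)"
    have \<delta>: "0 < \<delta>" "\<delta> \<le> 1" "4 * \<delta> \<le> e" using e by (auto simp: \<delta>_def)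
    have "emeasure circle_measure {\<xi>} \<le> emeasure circle_measure {w \<in> unit_circle. norm (w - \<xi>) \<le> \<delta>}"
      using assms \<delta> m by (intro emeasure_mono) auto
    also have "\<dots> \<le> ennreal (4 * \<delta>)" using emeasure_circle_near[OF assms \<delta>(1,2)] .
    also have "\<dots> \<le> 0 + ennreal e" using \<delta> by (simp add: ennreal_leI)
    finally show "emeasure circle_measure {\<xi>} \<le> 0 + ennreal e" .
  qed
  then show ?thesis
    using ms by (intro AE_I[of _ _ "{\<xi>}"]) auto
qed

section \<open>Poisson integrals near a boundary point\<close>

lemma poisson_integral_minus_const:
  assumes "integrable circle_measure f" "norm z < 1"
  shows "poisson_integral f z - a = (LINT w|circle_measure. poisson_kernel z w *\<^sub>R (f w - a))"
proof -
  have "poisson_integral f z - a = poisson_integral f z - poisson_integral (\<lambda>_. a) z"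
    using poisson_integral_const[OF assms(2)] by simp
  also have "\<dots> = (LINT w|circle_measure. poisson_kernel z w *\<^sub>R f w - poisson_kernel z w *\<^sub>R a)"
    unfolding poisson_integral_eq
    by (rule Bochner_Integration.integral_diff[symmetric];
        intro integrable_poisson_kernel_times assms) simp
  finally show ?thesis by (simp add: scaleR_diff_right)
qed

text \<open>The weight |w - \<xi>| goes to \<phi>, where it compensates the growth of a kernel
  concentrated near \<xi>, and its inverse goes to f - a, where it produces the local energy. Both
  the non-tangential limit and the near part of the dilation estimate rest on this.\<close>

lemma norm_integral_square_le_local_energy:
  fixes \<phi> :: "complex \<Rightarrow> real"
  assumes \<xi>: "norm \<xi> = 1"
    and [measurable]: "f \<in> borel_measurable circle_borel" "\<phi> \<in> borel_measurable circle_borel"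
  shows "ennreal ((norm (LINT w|circle_measure. \<phi> w *\<^sub>R (f w - a)))\<^sup>2) \<le>
    (\<integral>\<^sup>+ w. ennreal ((\<phi> w * norm (w - \<xi>))\<^sup>2) \<partial>circle_measure) * local_energy f a \<xi>"
proof -
  have "(LINT w|circle_measure. \<phi> w *\<^sub>R (f w - a)) =
      (LINT w|circle_measure. (\<phi> w * norm (w - \<xi>)) *\<^sub>R ((f w - a) /\<^sub>R norm (w - \<xi>)))"
  proof (rule integral_cong_AE)
    show "AE w in circle_measure. \<phi> w *\<^sub>R (f w - a) =
        (\<phi> w * norm (w - \<xi>)) *\<^sub>R ((f w - a) /\<^sub>R norm (w - \<xi>))"
      using AE_circle_neq[OF \<xi>] by eventually_elim simp
  qed measurable
  also have "ennreal ((norm \<dots>)\<^sup>2) \<le> (\<integral>\<^sup>+ w. ennreal ((\<phi> w * norm (w - \<xi>))\<^sup>2) \<partial>circle_measure) *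
      (\<integral>\<^sup>+ w. ennreal ((norm ((f w - a) /\<^sub>R norm (w - \<xi>)))\<^sup>2) \<partial>circle_measure)"
    by (rule norm_integral_square_le) measurable
  also have "(\<integral>\<^sup>+ w. ennreal ((norm ((f w - a) /\<^sub>R norm (w - \<xi>)))\<^sup>2) \<partial>circle_measure) = local_energy f a \<xi>"
    unfolding local_energy_def
    by (intro nn_integral_cong) (simp add: power_mult_distrib power_inverse divide_inverse mult.commute)
  finally show ?thesis .
qed

text \<open>In the cone |w - \<xi>| \<le> (1 + \<kappa>) |w - z|, so the square of kernel times |w -
  \<xi>| is at most (1 + \<kappa>)^2 (1 - |z|^2) times the kernel, which has mass 1. The factor 1 -
  |z|^2 gives convergence. The weak inequality admits \<kappa> = 1, the case of a radius.\<close>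

lemma poisson_integral_stolz_bound:
  assumes f: "f \<in> L2_circle" and \<xi>: "norm \<xi> = 1" and z: "norm z < 1"
    and k: "norm (z - \<xi>) \<le> \<kappa> * (1 - norm z)" "0 \<le> \<kappa>"
  shows "ennreal ((norm (poisson_integral f z - a))\<^sup>2) \<le>
    ennreal ((1 + \<kappa>)\<^sup>2 * (1 - (norm z)\<^sup>2)) * local_energy f a \<xi>"
proof -
  note [measurable] = L2_circle_measurable[OF f]
  have z1: "(norm z)\<^sup>2 < 1" using z by (simp add: abs_square_less_1)
  have "ennreal ((norm (poisson_integral f z - a))\<^sup>2) \<le>
     (\<integral>\<^sup>+ w. ennreal ((poisson_kernel z w * norm (w - \<xi>))\<^sup>2) \<partial>circle_measure) * local_energy f a \<xi>"
    unfolding poisson_integral_minus_const[OF L2_circle_integrable[OF f] z]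
    by (rule norm_integral_square_le_local_energy[OF \<xi>]) measurable
  also have "\<dots> \<le> ennreal ((1 + \<kappa>)\<^sup>2 * (1 - (norm z)\<^sup>2)) * local_energy f a \<xi>"
  proof (rule mult_right_mono)
    have "(\<integral>\<^sup>+ w. ennreal ((poisson_kernel z w * norm (w - \<xi>))\<^sup>2) \<partial>circle_measure) \<le>
      (\<integral>\<^sup>+ w. ennreal ((1 + \<kappa>)\<^sup>2 * (1 - (norm z)\<^sup>2)) * ennreal (poisson_kernel z w) \<partial>circle_measure)"
    proof (rule nn_integral_mono)
      fix w assume "w \<in> space circle_measure"
      then have w: "norm w = 1" by simp
      have d: "1 - norm z \<le> norm (w - z)" by (rule norm_circle_diff_ge[OF w])
      have "norm (w - \<xi>) \<le> norm (w - z) + norm (z - \<xi>)"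
        using norm_triangle_ineq[of "w - z" "z - \<xi>"] by simp
      also have "\<dots> \<le> norm (w - z) + \<kappa> * norm (w - z)"
        using k mult_left_mono[OF d k(2)] by linarith
      finally have "norm (w - \<xi>) \<le> (1 + \<kappa>) * norm (w - z)" by (simp add: algebra_simps)
      then have le: "(norm (w - \<xi>))\<^sup>2 \<le> (1 + \<kappa>)\<^sup>2 * (norm (w - z))\<^sup>2"
        by (simp add: power_mono flip: power_mult_distrib)
      have p: "0 < norm (w - z)" using d z by linarith
      have "(poisson_kernel z w * norm (w - \<xi>))\<^sup>2 \<le> (poisson_kernel z w)\<^sup>2 * ((1 + \<kappa>)\<^sup>2 * (norm (w - z))\<^sup>2)"
        unfolding power_mult_distrib by (rule mult_left_mono) (use le in \<open>auto simp: power_mult_distrib\<close>)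
      also have "\<dots> = (1 + \<kappa>)\<^sup>2 * (1 - (norm z)\<^sup>2) * poisson_kernel z w"
        using p by (simp add: poisson_kernel_def power2_eq_square)
      finally show "ennreal ((poisson_kernel z w * norm (w - \<xi>))\<^sup>2) \<le>
          ennreal ((1 + \<kappa>)\<^sup>2 * (1 - (norm z)\<^sup>2)) * ennreal (poisson_kernel z w)"
        using poisson_kernel_nonneg[of z w] z by (simp add: ennreal_leI flip: ennreal_mult'')
    qed
    also have "\<dots> = ennreal ((1 + \<kappa>)\<^sup>2 * (1 - (norm z)\<^sup>2))"
      by (subst nn_integral_cmult) (simp_all add: nn_integral_poisson_kernel z)
    finally show "(\<integral>\<^sup>+ w. ennreal ((poisson_kernel z w * norm (w - \<xi>))\<^sup>2) \<partial>circle_measure) \<le>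
        ennreal ((1 + \<kappa>)\<^sup>2 * (1 - (norm z)\<^sup>2))" .
  qed simp
  finally show ?thesis .
qed

text \<open>This makes the local Dirichlet integral at \<open>\<xi>\<close> the infimum of the local energies over all constants \<open>a\<close>.\<close>

lemma local_energy_finite_imp_nontangential_limit:
  assumes f: "f \<in> L2_circle" and \<xi>: "norm \<xi> = 1" and fin: "local_energy f a \<xi> < \<infinity>"
  shows "has_nontangential_limit (poisson_integral f) a \<xi>"
  unfolding has_nontangential_limit_def
proof (intro allI impI)
  fix \<kappa> :: real assume \<kappa>: "1 < \<kappa>"
  obtain E where E: "local_energy f a \<xi> = ennreal E" "0 \<le> E"
    using fin by (auto simp: less_top_ennreal)
  have b: "norm (poisson_integral f z - a) \<le> sqrt ((1 + \<kappa>)\<^sup>2 * (1 - (norm z)\<^sup>2) * E)"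
    if "z \<in> stolz_region \<kappa> \<xi>" for z
  proof -
    from that have z: "norm z < 1" "norm (z - \<xi>) \<le> \<kappa> * (1 - norm z)"
      by (auto simp: stolz_region_def)
    have z1: "(norm z)\<^sup>2 < 1" using z by (simp add: abs_square_less_1)
    have "ennreal ((norm (poisson_integral f z - a))\<^sup>2) \<le> ennreal ((1 + \<kappa>)\<^sup>2 * (1 - (norm z)\<^sup>2) * E)"
      using poisson_integral_stolz_bound[OF f \<xi> z, of a] \<kappa> E by (simp flip: ennreal_mult'')
    then have "(norm (poisson_integral f z - a))\<^sup>2 \<le> (1 + \<kappa>)\<^sup>2 * (1 - (norm z)\<^sup>2) * E"
      using E z1 by (subst (asm) ennreal_le_iff) auto
    then show ?thesis by (rule real_le_rsqrt)
  qed
  have "((\<lambda>z. sqrt ((1 + \<kappa>)\<^sup>2 * (1 - (norm z)\<^sup>2) * E)) \<longlongrightarrow> sqrt ((1 + \<kappa>)\<^sup>2 * (1 - (norm \<xi>)\<^sup>2) * E))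
      (at \<xi> within stolz_region \<kappa> \<xi>)"
    by (intro tendsto_intros)
  then have "((\<lambda>z. sqrt ((1 + \<kappa>)\<^sup>2 * (1 - (norm z)\<^sup>2) * E)) \<longlongrightarrow> 0) (at \<xi> within stolz_region \<kappa> \<xi>)"
    using \<xi> by simp
  then have "((\<lambda>z. poisson_integral f z - a) \<longlongrightarrow> 0) (at \<xi> within stolz_region \<kappa> \<xi>)"
    by (rule Lim_null_comparison[rotated]) (auto simp: eventually_at_filter intro!: always_eventually b)
  then show "(poisson_integral f \<longlongrightarrow> a) (at \<xi> within stolz_region \<kappa> \<xi>)"
    by (simp add: LIM_zero_iff)
qed

text \<open>A substitute for \<open>boundary_value\<close> as the limit of one fixed sequence of
  measurable functions of \<xi>, so that its measurability is immediate. The two agree wherever the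
  non-tangential limit exists.\<close>

definition radial_value :: "(complex \<Rightarrow> complex) \<Rightarrow> complex \<Rightarrow> complex" where
  "radial_value f \<xi> = lim (\<lambda>n. poisson_integral f (of_real (1 - inverse (real (Suc n))) * \<xi>))"

lemma radial_point_in_stolz_region:
  assumes \<xi>: "norm \<xi> = 1"
  shows "of_real (1 - inverse (real (Suc n))) * \<xi> \<in> stolz_region 2 \<xi>"
    and "norm (of_real (1 - inverse (real (Suc n))) * \<xi> - \<xi>) = inverse (real (Suc n))"
proof -
  let ?z = "of_real (1 - inverse (real (Suc n))) * \<xi>"
  have d: "?z - \<xi> = - of_real (inverse (real (Suc n))) * \<xi>"
    by (simp add: algebra_simps)
  show n: "norm (?z - \<xi>) = inverse (real (Suc n))"
    unfolding d using \<xi> by (simp add: norm_mult norm_inverse del: of_nat_Suc)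
  have "norm ?z = 1 - inverse (real (Suc n))"
    using \<xi> by (simp add: norm_mult del: of_real_diff of_nat_Suc) (simp add: field_simps)
  with n show "?z \<in> stolz_region 2 \<xi>"
    by (auto simp: stolz_region_def simp del: of_real_diff of_nat_Suc)
qed

lemma nontangential_limit_radial:
  assumes "has_nontangential_limit F l \<xi>" and \<xi>: "norm \<xi> = 1"
  shows "(\<lambda>n. F (of_real (1 - inverse (real (Suc n))) * \<xi>)) \<longlonglongrightarrow> l"
proof -
  let ?z = "\<lambda>n. of_real (1 - inverse (real (Suc n))) * \<xi>"
  have t: "(F \<longlongrightarrow> l) (at \<xi> within stolz_region 2 \<xi>)"
    using assms by (simp add: has_nontangential_limit_def)
  have "\<xi> \<notin> stolz_region 2 \<xi>" using \<xi> by (simp add: stolz_region_def)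
  then have z: "?z n \<in> stolz_region 2 \<xi> - {\<xi>}" for n
    using radial_point_in_stolz_region(1)[OF \<xi>, of n] by auto
  have "(\<lambda>n. 1 - inverse (real (Suc n))) \<longlonglongrightarrow> 1 - 0"
    by (intro tendsto_diff tendsto_const LIMSEQ_inverse_real_of_nat)
  then have "?z \<longlonglongrightarrow> of_real (1 - 0) * \<xi>"
    by (intro tendsto_mult tendsto_of_real tendsto_const)
  then have "filterlim ?z (at \<xi> within stolz_region 2 \<xi>) sequentially"
    using z unfolding filterlim_at by (auto simp del: of_real_diff of_nat_Suc)
  from filterlim_compose[OF t this] show ?thesis .
qed

lemma radial_value_eqI:
  "has_nontangential_limit (poisson_integral f) l \<xi> \<Longrightarrow> norm \<xi> = 1 \<Longrightarrow> radial_value f \<xi> = l"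
  unfolding radial_value_def by (rule limI, rule nontangential_limit_radial)

lemma boundary_value_eqI:
  assumes "has_nontangential_limit (poisson_integral f) l \<xi>" "norm \<xi> = 1"
  shows "boundary_value f \<xi> = l"
  unfolding boundary_value_def
  using assms radial_value_eqI[OF _ assms(2)] by (intro the_equality) metis+

lemma radial_value_unique:
  assumes "f \<in> L2_circle" "norm \<xi> = 1" "local_energy f a \<xi> < \<infinity>"
  shows "radial_value f \<xi> = a"
  using radial_value_eqI local_energy_finite_imp_nontangential_limit assms by blast

text \<open>Where the limit does not exist, no constant has finite energy, so the infinity
  prescribed by the definition agrees with the energy at whatever value \<open>radial_value\<close>
  happens to take.\<close>

lemma local_dirichlet_integral_eq:
  assumes f: "f \<in> L2_circle" and \<xi>: "norm \<xi> = 1"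
  shows "local_dirichlet_integral f \<xi> = local_energy f (radial_value f \<xi>) \<xi>"
proof (cases "\<exists>l. has_nontangential_limit (poisson_integral f) l \<xi>")
  case True
  then obtain l where l: "has_nontangential_limit (poisson_integral f) l \<xi>" by blast
  then show ?thesis
    using boundary_value_eqI[OF l \<xi>] radial_value_eqI[OF l \<xi>]
    by (auto simp: local_dirichlet_integral_def local_energy_def)
next
  case False
  then have "\<not> local_energy f (radial_value f \<xi>) \<xi> < \<infinity>"
    using local_energy_finite_imp_nontangential_limit[OF f \<xi>] by blast
  then show ?thesis
    using False by (simp add: local_dirichlet_integral_def less_top[symmetric])
qed

text \<open>Either the energy at a is infinite or a is the boundary value. Every later upper bound
  of a local Dirichlet integral uses this with a convenient a, without identifying a boundary
  value.\<close>

lemma local_dirichlet_integral_le: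
  assumes "f \<in> L2_circle" "norm \<xi> = 1"
  shows "local_dirichlet_integral f \<xi> \<le> local_energy f a \<xi>"
proof (cases "local_energy f a \<xi> < \<infinity>")
  case True
  then show ?thesis
    using radial_value_unique[OF assms True] local_dirichlet_integral_eq[OF assms] by simp
qed (simp add: less_top[symmetric])

lemma boundary_value_eq_radial_value:
  assumes "f \<in> L2_circle" "norm \<xi> = 1" "local_dirichlet_integral f \<xi> < \<infinity>"
  shows "boundary_value f \<xi> = radial_value f \<xi>"
proof -
  from assms(3) obtain l where "has_nontangential_limit (poisson_integral f) l \<xi>"
    by (auto simp: local_dirichlet_integral_def split: if_splits)
  then show ?thesis using boundary_value_eqI radial_value_eqI assms(2) by metis
qed

section \<open>Measurability of radial limits and local integrals\<close>

lemma measurable_poisson_integral_dilation: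
  assumes [measurable]: "f \<in> borel_measurable circle_borel"
  shows "(\<lambda>\<xi>. poisson_integral f (of_real r * \<xi>)) \<in> borel_measurable circle_borel"
  unfolding poisson_integral_eq
  by (rule circle.borel_measurable_lebesgue_integral) measurable

lemma measurable_radial_value:
  assumes [measurable]: "f \<in> borel_measurable circle_borel"
  shows "radial_value f \<in> borel_measurable circle_borel"
  using measurable_poisson_integral_dilation[OF assms]
  unfolding radial_value_def by (intro borel_measurable_lim_metric)

lemma measurable_local_energy:
  assumes [measurable]: "f \<in> borel_measurable circle_borel" "g \<in> borel_measurable circle_borel"
  shows "(\<lambda>\<xi>. local_energy f (g \<xi>) \<xi>) \<in> borel_measurable circle_borel"
  unfolding local_energy_def
  by (rule circle.borel_measurable_nn_integral) measurable

lemma measurable_local_dirichlet_integral: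
  assumes f: "f \<in> L2_circle"
  shows "local_dirichlet_integral f \<in> borel_measurable circle_borel"
proof -
  have "(\<lambda>\<xi>. local_energy f (radial_value f \<xi>) \<xi>) \<in> borel_measurable circle_borel"
    by (intro measurable_local_energy measurable_radial_value L2_circle_measurable f)
  then show ?thesis
    by (rule measurable_cong[THEN iffD2, rotated]) (simp add: local_dirichlet_integral_eq f)
qed

section \<open>Dilations\<close>

interpretation circle2: pair_sigma_finite circle_measure circle_measure ..

lemma norm_diff_dilation_commute:
  fixes w v :: complex
  assumes "norm w = 1" "norm v = 1"
  shows "norm (v - of_real r * w) = norm (w - of_real r * v)"
proof -
  have "norm (v - of_real r * w) = norm (cnj (v - of_real r * w) * v * w)"
    using assms by (simp add: norm_mult del: complex_cnj_diff) 
  also have "cnj (v - of_real r * w) * v * w = w - of_real r * v"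
    using assms by (auto simp: cnj_circle field_simps)
  finally show ?thesis .
qed

lemma poisson_kernel_dilation_commute:
  "norm w = 1 \<Longrightarrow> norm v = 1 \<Longrightarrow>
    poisson_kernel (of_real r * w) v = poisson_kernel (of_real r * v) w"
  unfolding poisson_kernel_def using norm_diff_dilation_commute[of w v r] by (simp add: norm_mult)

text \<open>Jensen's inequality for the probability density given by the Poisson kernel, obtained
  from Cauchy-Schwarz by splitting the kernel into two square roots.\<close>

lemma norm_poisson_integral_square_le:
  assumes f: "f \<in> L2_circle" and z: "norm z < 1"
  shows "ennreal ((norm (poisson_integral f z - a))\<^sup>2) \<le>
    (\<integral>\<^sup>+ w. ennreal (poisson_kernel z w * (norm (f w - a))\<^sup>2) \<partial>circle_measure)"
proof -
  note [measurable] = L2_circle_measurable[OF f]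
  let ?s = "\<lambda>w. sqrt (poisson_kernel z w)"
  have "poisson_integral f z - a = (LINT w|circle_measure. ?s w *\<^sub>R (?s w *\<^sub>R (f w - a)))"
    unfolding poisson_integral_minus_const[OF L2_circle_integrable[OF f] z]
    using poisson_kernel_nonneg[of z] z by simp
  also have "ennreal ((norm \<dots>)\<^sup>2) \<le> (\<integral>\<^sup>+ w. ennreal ((?s w)\<^sup>2) \<partial>circle_measure) *
      (\<integral>\<^sup>+ w. ennreal ((norm (?s w *\<^sub>R (f w - a)))\<^sup>2) \<partial>circle_measure)"
    by (rule norm_integral_square_le) measurable
  also have "\<dots> = (\<integral>\<^sup>+ w. ennreal (poisson_kernel z w * (norm (f w - a))\<^sup>2) \<partial>circle_measure)"
    using poisson_kernel_nonneg[of z] z by (simp add: nn_integral_poisson_kernel power_mult_distrib)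
  finally show ?thesis .
qed

definition dilation :: "real \<Rightarrow> (complex \<Rightarrow> complex) \<Rightarrow> complex \<Rightarrow> complex" where
  "dilation r f w = poisson_integral f (of_real r * w)"

lemma measurable_dilation:
  "f \<in> borel_measurable circle_borel \<Longrightarrow> dilation r f \<in> borel_measurable circle_borel"
  using measurable_poisson_integral_dilation[of f r] unfolding dilation_def .

text \<open>Jensen at each point, then Fubini: by the symmetry
  \<open>poisson_kernel_dilation_commute\<close> the inner integral over w is again the mass of a
  Poisson kernel.\<close>

lemma circle_norm_sq_dilation_le:
  assumes f: "f \<in> L2_circle" and r: "0 \<le> r" "r < 1"
  shows "circle_norm_sq (dilation r f) \<le> circle_norm_sq f"
proof -
  note [measurable] = L2_circle_measurable[OF f]
  have n: "norm (of_real r * w) < 1" if "norm w = 1" for w :: complex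
    using that r by (simp add: norm_mult)
  have "circle_norm_sq (dilation r f) \<le>
    (\<integral>\<^sup>+ w. \<integral>\<^sup>+ v. ennreal (poisson_kernel (of_real r * w) v * (norm (f v))\<^sup>2) \<partial>circle_measure \<partial>circle_measure)"
    using norm_poisson_integral_square_le[OF f n, of _ 0]
    by (intro nn_integral_mono) (simp add: dilation_def)
  also have "\<dots> = (\<integral>\<^sup>+ v. \<integral>\<^sup>+ w. ennreal (poisson_kernel (of_real r * w) v * (norm (f v))\<^sup>2) \<partial>circle_measure \<partial>circle_measure)"
    by (rule circle2.Fubini') measurable
  also have "\<dots> = (\<integral>\<^sup>+ v. \<integral>\<^sup>+ w. ennreal ((norm (f v))\<^sup>2) * ennreal (poisson_kernel (of_real r * v) w) \<partial>circle_measure \<partial>circle_measure)"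
    using n by (intro nn_integral_cong)
      (simp add: poisson_kernel_dilation_commute[of _ "_ :: complex"] mult.commute[of "poisson_kernel _ _"] ennreal_mult')
  also have "\<dots> = circle_norm_sq f"
    using n by (intro nn_integral_cong) (auto simp: nn_integral_cmult nn_integral_poisson_kernel)
  finally show ?thesis .
qed

lemma dilation_L2:
  assumes f: "f \<in> L2_circle" and r: "0 \<le> r" "r < 1"
  shows "dilation r f \<in> L2_circle"
  using measurable_dilation[OF L2_circle_measurable[OF f]]
    order.strict_trans1[OF circle_norm_sq_dilation_le[OF f r] L2_circle_finite[OF f]]
  by (simp add: L2_circle_def)

section \<open>The local energy of a dilation\<close>

lemma one_minus_square_le: "0 \<le> r \<Longrightarrow> r < 1 \<Longrightarrow> 1 - r\<^sup>2 \<le> 2 * (1 - r)" for r :: real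
  using mult_nonneg_nonneg[of "1 - r" "1 - r"] by (simp add: power2_eq_square algebra_simps)

text \<open>Within distance 1 - r of \<xi> the dilation is Lipschitz, with a constant controlled by
  the energy. The increment is the integral of f - a against the difference of the kernels at r w
  and r \<xi>, and this difference is proportional to h = |w - \<xi>|.\<close>

lemma dilation_near_bound:
  assumes f: "f \<in> L2_circle" and r: "0 \<le> r" "r < 1" and \<xi>: "norm \<xi> = 1" and w: "norm w = 1"
    and near: "norm (w - \<xi>) \<le> 1 - r"
  shows "ennreal ((norm (dilation r f w - dilation r f \<xi>))\<^sup>2 / (norm (w - \<xi>))\<^sup>2) \<le>
    ennreal (72 / (1 - r)) * local_energy f a \<xi>"
proof (cases "w = \<xi>")
  case False
  note [measurable] = L2_circle_measurable[OF f]
  let ?z = "of_real r * w" and ?y = "of_real r * \<xi>"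
  have nz: "norm ?z < 1" "norm ?z = r" and ny: "norm ?y < 1" "norm ?y = r"
    using w \<xi> r by (auto simp: norm_mult)
  define h where "h = norm (w - \<xi>)"
  have h: "0 < h" "h \<le> 1 - r" using False near by (auto simp: h_def)
  define \<phi> where "\<phi> v = poisson_kernel ?z v - poisson_kernel ?y v" for v
  have i: "integrable circle_measure (\<lambda>v. poisson_kernel z v *\<^sub>R (f v - a))" if "norm z < 1" for z
    using that by (intro integrable_poisson_kernel_times Bochner_Integration.integrable_diff L2_circle_integrable[OF f]) auto
  have "dilation r f w - dilation r f \<xi> = (poisson_integral f ?z - a) - (poisson_integral f ?y - a)"
    by (simp add: dilation_def)
  also have "\<dots> = (LINT v|circle_measure. \<phi> v *\<^sub>R (f v - a))"
    unfolding poisson_integral_minus_const[OF L2_circle_integrable[OF f] nz(1)]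
      poisson_integral_minus_const[OF L2_circle_integrable[OF f] ny(1)] \<phi>_def scaleR_diff_left
    by (rule Bochner_Integration.integral_diff[symmetric]) (intro i nz ny)+
  finally have e: "dilation r f w - dilation r f \<xi> = (LINT v|circle_measure. \<phi> v *\<^sub>R (f v - a))" .
  have [measurable]: "\<phi> \<in> borel_measurable circle_borel" unfolding \<phi>_def by measurable
  have "ennreal ((norm (dilation r f w - dilation r f \<xi>))\<^sup>2) \<le>
      (\<integral>\<^sup>+ v. ennreal ((\<phi> v * norm (v - \<xi>))\<^sup>2) \<partial>circle_measure) * local_energy f a \<xi>"
    unfolding e by (rule norm_integral_square_le_local_energy[OF \<xi>]) measurable
  also have "\<dots> \<le> ennreal (h\<^sup>2 * (72 / (1 - r))) * local_energy f a \<xi>"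
  proof (rule mult_right_mono)
    have "(\<integral>\<^sup>+ v. ennreal ((\<phi> v * norm (v - \<xi>))\<^sup>2) \<partial>circle_measure) \<le>
        (\<integral>\<^sup>+ v. ennreal (h\<^sup>2 * (72 / (1 - r))) * ennreal (poisson_kernel ?z v) \<partial>circle_measure)"
    proof (rule nn_integral_mono)
      fix v assume "v \<in> space circle_measure"
      then have v: "norm v = 1" by simp
      define A where "A = norm (v - ?z)"
      define B where "B = norm (v - ?y)"
      have A: "1 - r \<le> A" and B: "1 - r \<le> B"
        using norm_circle_diff_ge[OF v, of ?z] norm_circle_diff_ge[OF v, of ?y] nz ny by (auto simp: A_def B_def)
      have zy: "norm (?z - ?y) \<le> h"
      proof -
        have "norm (?z - ?y) = r * h" using r by (simp add: h_def norm_mult flip: right_diff_distrib)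
        also have "\<dots> \<le> 1 * h" using r h by (intro mult_right_mono) auto
        finally show ?thesis by simp
      qed
      have AB: "\<bar>B - A\<bar> \<le> h"
        using norm_triangle_ineq3[of "v - ?y" "v - ?z"] zy by (simp add: A_def B_def)
      have pos: "0 < A" "0 < B" using A B r by auto
      \<comment> \<open>Here the assumption \<open>near\<close> enters: |B - A| \<le> h \<le> 1 - r
        \<le> B, so A + B is at most 3 B.\<close>
      have AB2: "A \<le> 2 * B" using AB h B by linarith
      have "norm (v - \<xi>) \<le> B + norm (?y - \<xi>)"
        using norm_triangle_ineq[of "v - ?y" "?y - \<xi>"] by (simp add: B_def)
      moreover have "norm (?y - \<xi>) = 1 - r"
        using \<xi> r by (intro norm_dilation_diff) auto
      ultimately have vx: "norm (v - \<xi>) \<le> 2 * B" using B by linarith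
      have r2: "r\<^sup>2 < 1" using r by (simp add: abs_square_less_1)
      \<comment> \<open>The factor B - A supplies h. The bounds 3 B for A + B and 2 B for |v -
        \<xi>| then cancel the B^2 of the denominator and leave 6 h times the kernel at r w.\<close>
      have "\<phi> v = (1 - r\<^sup>2) * ((B - A) * (A + B)) / (A\<^sup>2 * B\<^sup>2)"
        unfolding \<phi>_def poisson_kernel_def nz(2) ny(2) A_def[symmetric] B_def[symmetric]
        using pos by (simp add: field_simps power2_eq_square)
      then have "\<bar>\<phi> v\<bar> = (1 - r\<^sup>2) * (\<bar>B - A\<bar> * (A + B)) / (A\<^sup>2 * B\<^sup>2)"
        using r2 pos by (simp add: abs_mult)
      also have "\<dots> \<le> (1 - r\<^sup>2) * (h * (3 * B)) / (A\<^sup>2 * B\<^sup>2)"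
        using r2 pos AB AB2 h by (intro divide_right_mono mult_left_mono mult_mono) auto
      finally have "\<bar>\<phi> v\<bar> * norm (v - \<xi>) \<le> (1 - r\<^sup>2) * (h * (3 * B)) / (A\<^sup>2 * B\<^sup>2) * (2 * B)"
        using vx r2 h pos by (intro mult_mono) auto
      also have "\<dots> = 6 * h * poisson_kernel ?z v"
        unfolding poisson_kernel_def nz(2) A_def[symmetric] using pos by (simp add: field_simps power2_eq_square)
      finally have "\<bar>\<phi> v * norm (v - \<xi>)\<bar> \<le> 6 * h * poisson_kernel ?z v" by (simp add: abs_mult)
      then have "(\<phi> v * norm (v - \<xi>))\<^sup>2 \<le> (6 * h * poisson_kernel ?z v)\<^sup>2"
        by (rule power2_le_iff_abs_le[THEN iffD2, rotated]) (use h poisson_kernel_nonneg[of ?z v] nz in auto)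
      also have "\<dots> = 36 * h\<^sup>2 * poisson_kernel ?z v * poisson_kernel ?z v"
        by (simp add: power2_eq_square)
      \<comment> \<open>One of the two kernel factors is estimated by its maximum 2 / (1 - r),
        giving 72; the other one is kept because its integral is 1.\<close>
      also have "\<dots> \<le> 36 * h\<^sup>2 * (2 / (1 - r)) * poisson_kernel ?z v"
        using poisson_kernel_le[OF nz(1) v] nz poisson_kernel_nonneg[of ?z v]
        by (intro mult_right_mono mult_left_mono) auto
      finally have "(\<phi> v * norm (v - \<xi>))\<^sup>2 \<le> h\<^sup>2 * (72 / (1 - r)) * poisson_kernel ?z v"
        by (simp add: mult.commute)
      then show "ennreal ((\<phi> v * norm (v - \<xi>))\<^sup>2) \<le> ennreal (h\<^sup>2 * (72 / (1 - r))) * ennreal (poisson_kernel ?z v)"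
        using r by (subst ennreal_mult'[symmetric]) (auto intro: ennreal_leI)
    qed
    also have "\<dots> = ennreal (h\<^sup>2 * (72 / (1 - r)))"
      by (subst nn_integral_cmult) (simp_all add: nn_integral_poisson_kernel[OF nz(1)])
    finally show "(\<integral>\<^sup>+ v. ennreal ((\<phi> v * norm (v - \<xi>))\<^sup>2) \<partial>circle_measure) \<le> ennreal (h\<^sup>2 * (72 / (1 - r)))" .
  qed simp
  finally have "ennreal (1 / h\<^sup>2) * ennreal ((norm (dilation r f w - dilation r f \<xi>))\<^sup>2) \<le>
      ennreal (1 / h\<^sup>2) * (ennreal (h\<^sup>2 * (72 / (1 - r))) * local_energy f a \<xi>)"
    by (rule mult_left_mono) simp
  also have "\<dots> = ennreal (72 / (1 - r)) * local_energy f a \<xi>"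
    using h r by (simp add: mult.assoc[symmetric] flip: ennreal_mult)
  finally show ?thesis
    by (simp add: h_def flip: ennreal_mult')
qed simp

text \<open>Moves the weight from w to v, so that after Fubini the energy of f itself appears. If |v
  - \<xi>| \<le> 2 |w - \<xi>| the weights are comparable; otherwise v is far from w and the kernel
  is of size (1 - r^2) / |v - \<xi>|^2. The right-hand side uses the kernel at r v because that has
  mass 1 as a function of w.\<close>

lemma poisson_kernel_far_le:
  assumes "0 \<le> r" "r < 1" "norm w = 1" "norm v = 1" "w \<noteq> \<xi>" "v \<noteq> \<xi>"
  shows "poisson_kernel (of_real r * w) v / (norm (w - \<xi>))\<^sup>2 \<le>
    (4 * poisson_kernel (of_real r * v) w + 16 * (1 - r\<^sup>2) / (norm (w - \<xi>))\<^sup>2) / (norm (v - \<xi>))\<^sup>2"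
proof -
  let ?p = "poisson_kernel (of_real r * w) v"
  have p: "?p = poisson_kernel (of_real r * v) w" "0 \<le> ?p"
    using assms by (auto intro!: poisson_kernel_dilation_commute poisson_kernel_nonneg simp: norm_mult)
  have r2: "r\<^sup>2 < 1" using assms by (simp add: abs_square_less_1)
  have pos: "0 < norm (w - \<xi>)" "0 < norm (v - \<xi>)" using assms by auto
  show ?thesis
  proof (cases "norm (v - \<xi>) \<le> 2 * norm (w - \<xi>)")
    case True
    then have "(norm (v - \<xi>))\<^sup>2 \<le> 4 * (norm (w - \<xi>))\<^sup>2"
      using power_mono[of "norm (v - \<xi>)" "2 * norm (w - \<xi>)" 2] by (simp add: power_mult_distrib)
    then have "1 / (norm (w - \<xi>))\<^sup>2 \<le> 4 / (norm (v - \<xi>))\<^sup>2" using pos by (simp add: field_simps)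
    then have "?p * (1 / (norm (w - \<xi>))\<^sup>2) \<le> ?p * (4 / (norm (v - \<xi>))\<^sup>2)"
      using p by (intro mult_left_mono)
    also have "\<dots> \<le> (4 * ?p + 16 * (1 - r\<^sup>2) / (norm (w - \<xi>))\<^sup>2) / (norm (v - \<xi>))\<^sup>2"
    proof -
      have "?p * (4 / (norm (v - \<xi>))\<^sup>2) = (4 * ?p) / (norm (v - \<xi>))\<^sup>2" by simp
      also have "\<dots> \<le> (4 * ?p + 16 * (1 - r\<^sup>2) / (norm (w - \<xi>))\<^sup>2) / (norm (v - \<xi>))\<^sup>2"
        using r2 by (intro divide_right_mono) auto
      finally show ?thesis .
    qed
    finally show ?thesis using p by simp
  next
    case False
    define A where "A = norm (v - of_real r * w)"
    have "norm (v - w) \<le> A + norm (of_real r * w - w)"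
      using norm_triangle_ineq[of "v - of_real r * w" "of_real r * w - w"] by (simp add: A_def)
    moreover have "norm (of_real r * w - w) = 1 - r"
      using assms by (intro norm_dilation_diff) auto
    moreover have Ar: "1 - r \<le> A"
      using norm_circle_diff_ge[of v "of_real r * w"] assms by (simp add: A_def norm_mult)
    moreover have "norm (v - \<xi>) \<le> norm (v - w) + norm (w - \<xi>)"
      using norm_triangle_ineq[of "v - w" "w - \<xi>"] by simp
    \<comment> \<open>Indeed |v - \<xi>| \<le> A + (1 - r) + |w - \<xi>| \<le> 2 A + |v - \<xi>| /
      2.\<close>
    ultimately have "norm (v - \<xi>) \<le> 4 * A" using False by linarith
    then have "(norm (v - \<xi>))\<^sup>2 \<le> 16 * A\<^sup>2"
      using power_mono[of "norm (v - \<xi>)" "4 * A" 2] by (simp add: power_mult_distrib)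
    moreover have "0 < A" using Ar assms by linarith
    ultimately have "1 / A\<^sup>2 \<le> 16 / (norm (v - \<xi>))\<^sup>2" using pos by (simp add: field_simps)
    then have "(1 - r\<^sup>2) * (1 / A\<^sup>2) \<le> (1 - r\<^sup>2) * (16 / (norm (v - \<xi>))\<^sup>2)"
      using r2 by (intro mult_left_mono) auto
    then have "?p \<le> 16 * (1 - r\<^sup>2) / (norm (v - \<xi>))\<^sup>2"
      using assms by (simp add: poisson_kernel_def A_def norm_mult mult.commute)
    then have "?p / (norm (w - \<xi>))\<^sup>2 \<le> 16 * (1 - r\<^sup>2) / (norm (v - \<xi>))\<^sup>2 / (norm (w - \<xi>))\<^sup>2"
      by (rule divide_right_mono) simp
    also have "\<dots> \<le> (4 * ?p + 16 * (1 - r\<^sup>2) / (norm (w - \<xi>))\<^sup>2) / (norm (v - \<xi>))\<^sup>2"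
    proof -
      have "16 * (1 - r\<^sup>2) / (norm (v - \<xi>))\<^sup>2 / (norm (w - \<xi>))\<^sup>2 = 16 * (1 - r\<^sup>2) / (norm (w - \<xi>))\<^sup>2 / (norm (v - \<xi>))\<^sup>2"
        by (simp add: mult.commute)
      also have "\<dots> \<le> (4 * ?p + 16 * (1 - r\<^sup>2) / (norm (w - \<xi>))\<^sup>2) / (norm (v - \<xi>))\<^sup>2"
        using p by (intro divide_right_mono) auto
      finally show ?thesis .
    qed
    finally show ?thesis using p by simp
  qed
qed

lemma measurable_indicator_far [measurable]:
  "(indicator {w. \<delta> \<le> norm (w - \<xi>)} :: complex \<Rightarrow> ennreal) \<in> borel_measurable circle_borel"
proof -
  have "{w \<in> space circle_borel. \<delta> \<le> norm (w - \<xi>)} \<in> sets circle_borel" by measurable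
  then show ?thesis by (simp add: borel_measurable_indicator' Int_def)
qed

text \<open>The constant a is that of the energy of f, not the value of the dilation at \<xi>;
  passing to the latter is left to \<open>local_energy_dilation_le\<close>.\<close>

lemma dilation_far_bound:
  assumes f: "f \<in> L2_circle" and r: "0 \<le> r" "r < 1" and \<xi>: "norm \<xi> = 1"
  shows "(\<integral>\<^sup>+ w. indicator {w. 1 - r \<le> norm (w - \<xi>)} w *
      ennreal ((norm (dilation r f w - a))\<^sup>2 / (norm (w - \<xi>))\<^sup>2) \<partial>circle_measure) \<le> 132 * local_energy f a \<xi>"
proof -
  note [measurable] = L2_circle_measurable[OF f]
  have n: "norm (of_real r * w) < 1" if "norm w = 1" for w :: complex
    using that r by (simp add: norm_mult)
  let ?far = "indicator {w. 1 - r \<le> norm (w - \<xi>)} :: complex \<Rightarrow> ennreal"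
  let ?k = "\<lambda>w v. ?far w * (ennreal (1 / (norm (w - \<xi>))\<^sup>2) * ennreal (poisson_kernel (of_real r * w) v * (norm (f v - a))\<^sup>2))"
  let ?m = "\<lambda>v w. ennreal 4 * ennreal (poisson_kernel (of_real r * v) w) + ennreal (16 * (1 - r\<^sup>2)) * (?far w * ennreal (1 / (norm (w - \<xi>))\<^sup>2))"
  have r2: "r\<^sup>2 < 1" using r by (simp add: abs_square_less_1)
  have "(\<integral>\<^sup>+ w. ?far w * ennreal ((norm (dilation r f w - a))\<^sup>2 / (norm (w - \<xi>))\<^sup>2) \<partial>circle_measure) \<le>
    (\<integral>\<^sup>+ w. \<integral>\<^sup>+ v. ?k w v \<partial>circle_measure \<partial>circle_measure)"
  proof (rule nn_integral_mono)
    fix w assume "w \<in> space circle_measure"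
    then have w: "norm w = 1" by simp
    have "ennreal ((norm (dilation r f w - a))\<^sup>2 / (norm (w - \<xi>))\<^sup>2) =
        ennreal (1 / (norm (w - \<xi>))\<^sup>2) * ennreal ((norm (dilation r f w - a))\<^sup>2)"
      by (simp flip: ennreal_mult')
    also have "\<dots> \<le> ennreal (1 / (norm (w - \<xi>))\<^sup>2) *
        (\<integral>\<^sup>+ v. ennreal (poisson_kernel (of_real r * w) v * (norm (f v - a))\<^sup>2) \<partial>circle_measure)"
      unfolding dilation_def by (intro mult_left_mono norm_poisson_integral_square_le f n w) simp
    finally show "?far w * ennreal ((norm (dilation r f w - a))\<^sup>2 / (norm (w - \<xi>))\<^sup>2) \<le>
      (\<integral>\<^sup>+ v. ?k w v \<partial>circle_measure)"
      by (simp add: nn_integral_cmult mult_left_mono)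
  qed
  also have "\<dots> = (\<integral>\<^sup>+ v. \<integral>\<^sup>+ w. ?k w v \<partial>circle_measure \<partial>circle_measure)"
    by (rule circle2.Fubini') measurable
  also have "\<dots> \<le> (\<integral>\<^sup>+ v. 132 * ennreal ((norm (f v - a))\<^sup>2 / (norm (v - \<xi>))\<^sup>2) \<partial>circle_measure)"
  proof (rule nn_integral_mono_AE)
    show "AE v in circle_measure.
      (\<integral>\<^sup>+ w. ?k w v \<partial>circle_measure)
      \<le> 132 * ennreal ((norm (f v - a))\<^sup>2 / (norm (v - \<xi>))\<^sup>2)"
      using AE_circle_neq[OF \<xi>] AE_space
    proof eventually_elim
      fix v assume vx: "v \<noteq> \<xi>" and "v \<in> space circle_measure"
      then have v: "norm v = 1" by simp
      let ?q = "ennreal ((norm (f v - a))\<^sup>2 / (norm (v - \<xi>))\<^sup>2)"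
      have "(\<integral>\<^sup>+ w. ?k w v \<partial>circle_measure) \<le>
        (\<integral>\<^sup>+ w. ?q * ?m v w \<partial>circle_measure)"
      proof (rule nn_integral_mono)
        fix w assume "w \<in> space circle_measure"
        then have w: "norm w = 1" by simp
        show "?k w v \<le>
          ?q * ?m v w"
        proof (cases "1 - r \<le> norm (w - \<xi>)")
          case True
          then have wx: "w \<noteq> \<xi>" using r by auto
          have pp: "0 \<le> poisson_kernel (of_real r * v) w"
            using n[OF v] by (intro poisson_kernel_nonneg) auto
          have "(norm (f v - a))\<^sup>2 * (poisson_kernel (of_real r * w) v / (norm (w - \<xi>))\<^sup>2) \<le>
            (norm (f v - a))\<^sup>2 * ((4 * poisson_kernel (of_real r * v) w + 16 * (1 - r\<^sup>2) / (norm (w - \<xi>))\<^sup>2) / (norm (v - \<xi>))\<^sup>2)"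
            by (intro mult_left_mono poisson_kernel_far_le r w v vx wx) simp
          then have "1 / (norm (w - \<xi>))\<^sup>2 * (poisson_kernel (of_real r * w) v * (norm (f v - a))\<^sup>2) \<le>
            ((norm (f v - a))\<^sup>2 / (norm (v - \<xi>))\<^sup>2) * (4 * poisson_kernel (of_real r * v) w + 16 * (1 - r\<^sup>2) * (1 / (norm (w - \<xi>))\<^sup>2))"
            by (simp add: mult_ac)
          then have "ennreal (1 / (norm (w - \<xi>))\<^sup>2 * (poisson_kernel (of_real r * w) v * (norm (f v - a))\<^sup>2)) \<le>
            ennreal (((norm (f v - a))\<^sup>2 / (norm (v - \<xi>))\<^sup>2) * (4 * poisson_kernel (of_real r * v) w + 16 * (1 - r\<^sup>2) * (1 / (norm (w - \<xi>))\<^sup>2)))"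
            by (rule ennreal_leI)
          then show ?thesis
            using True pp r2 by (simp add: ennreal_mult' ennreal_mult'' del: times_divide_eq_right times_divide_eq_left)
        qed simp
      qed
      also have "\<dots> = ?q * (ennreal 4 + ennreal (16 * (1 - r\<^sup>2)) * (\<integral>\<^sup>+ w. ?far w * ennreal (1 / (norm (w - \<xi>))\<^sup>2) \<partial>circle_measure))"
        by (simp add: nn_integral_cmult nn_integral_add nn_integral_poisson_kernel[OF n[OF v]])
      also have "\<dots> \<le> ?q * (ennreal 4 + ennreal (16 * (1 - r\<^sup>2)) * ennreal (4 / (1 - r)))"
        using nn_integral_circle_far[OF \<xi>, of "1 - r"] r by (intro mult_left_mono add_left_mono) auto
      also have "\<dots> = ?q * ennreal (4 + 16 * (1 - r\<^sup>2) * (4 / (1 - r)))"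
        using r r2 by (subst ennreal_mult[symmetric], simp, simp, subst ennreal_plus) auto
      also have "\<dots> \<le> ?q * ennreal 132"
      \<comment> \<open>132 = 4 + 128: the kernel term contributes 4 times mass 1, the other one at
        most 16 * 2 (1 - r) * 4 / (1 - r).\<close>
      proof (intro mult_left_mono ennreal_leI)
        have "16 * (1 - r\<^sup>2) * (4 / (1 - r)) \<le> 16 * (2 * (1 - r)) * (4 / (1 - r))"
          using one_minus_square_le[OF r] r by (intro mult_right_mono mult_left_mono) auto
        also have "\<dots> = 128" using r by (simp add: field_simps)
        finally show "4 + 16 * (1 - r\<^sup>2) * (4 / (1 - r)) \<le> 132" by simp
      qed simp
      finally show "(\<integral>\<^sup>+ w. ?k w v \<partial>circle_measure)
        \<le> 132 * ?q" by (simp add: mult.commute)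
    qed
  qed
  also have "\<dots> = 132 * local_energy f a \<xi>"
    unfolding local_energy_def by (rule nn_integral_cmult) measurable
  finally show ?thesis .
qed

text \<open>616 = 288 + 264 + 64. The near part gives 72 / (1 - r) times the arc measure 4 (1 - r);
  the far part gives 2 * 132; replacing a by the value of the dilation at \<xi> on the far part
  costs 2 * 8 (1 - r) * 4 / (1 - r).\<close>

lemma local_energy_dilation_le:
  assumes f: "f \<in> L2_circle" and r: "0 \<le> r" "r < 1" and \<xi>: "norm \<xi> = 1"
  shows "local_energy (dilation r f) (dilation r f \<xi>) \<xi> \<le> 616 * local_energy f a \<xi>"
proof -
  note [measurable] = L2_circle_measurable[OF f] measurable_dilation[OF L2_circle_measurable[OF f]]
  let ?N = "local_energy f a \<xi>" and ?g = "dilation r f"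
  define Near where "Near = {w \<in> unit_circle. norm (w - \<xi>) \<le> 1 - r}"
  let ?far = "indicator {w. 1 - r \<le> norm (w - \<xi>)} :: complex \<Rightarrow> ennreal"
  let ?near = "indicator Near :: complex \<Rightarrow> ennreal"
  have "{w \<in> space circle_borel. norm (w - \<xi>) \<le> 1 - r} \<in> sets circle_borel" by measurable
  then have ns[measurable]: "Near \<in> sets circle_borel" by (simp add: Near_def)
  let ?J = "\<lambda>w. ?far w * ennreal ((norm (?g w - a))\<^sup>2 / (norm (w - \<xi>))\<^sup>2)"
  let ?d = "ennreal ((norm (?g \<xi> - a))\<^sup>2)"
  \<comment> \<open>The point r \<xi> satisfies the cone condition with \<kappa> = 1, whence (1 +
    1)^2 (1 - r^2) \<le> 8 (1 - r).\<close>
  have d: "?d \<le> ennreal (8 * (1 - r)) * ?N"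
  proof -
    have "norm (of_real r * \<xi> - \<xi>) = 1 - r"
      using \<xi> r by (intro norm_dilation_diff) auto
    then have "?d \<le> ennreal ((1 + 1)\<^sup>2 * (1 - (norm (of_real r * \<xi>))\<^sup>2)) * ?N"
      unfolding dilation_def using r \<xi>
      by (intro poisson_integral_stolz_bound f \<xi>) (auto simp: norm_mult)
    also have "\<dots> \<le> ennreal (8 * (1 - r)) * ?N"
      using one_minus_square_le[OF r] r \<xi> by (intro mult_right_mono ennreal_leI) (auto simp: norm_mult)
    finally show ?thesis .
  qed
  have "local_energy ?g (?g \<xi>) \<xi> \<le> (\<integral>\<^sup>+ w. (ennreal (72 / (1 - r)) * ?N) * ?near w +
      (2 * ?J w + (2 * ?d) * (?far w * ennreal (1 / (norm (w - \<xi>))\<^sup>2))) \<partial>circle_measure)"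
    unfolding local_energy_def[of ?g]
  proof (rule nn_integral_mono)
    fix w assume "w \<in> space circle_measure"
    then have w: "norm w = 1" by simp
    show "ennreal ((norm (?g w - ?g \<xi>))\<^sup>2 / (norm (w - \<xi>))\<^sup>2) \<le> (ennreal (72 / (1 - r)) * ?N) * ?near w +
      (2 * ?J w + (2 * ?d) * (?far w * ennreal (1 / (norm (w - \<xi>))\<^sup>2)))"
    proof (cases "norm (w - \<xi>) \<le> 1 - r")
      case True
      then have "ennreal ((norm (?g w - ?g \<xi>))\<^sup>2 / (norm (w - \<xi>))\<^sup>2) \<le> (ennreal (72 / (1 - r)) * ?N) * ?near w"
        using dilation_near_bound[OF f r \<xi> w True, of a] w by (simp add: Near_def)
      then show ?thesis by (rule order_trans) simp
    next
      case False
      have "(norm (?g w - ?g \<xi>))\<^sup>2 \<le> (norm (?g w - a) + norm (?g \<xi> - a))\<^sup>2"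
        using norm_triangle_ineq4[of "?g w - a" "?g \<xi> - a"] by (intro power_mono) auto
      also have "\<dots> \<le> 2 * (norm (?g w - a))\<^sup>2 + 2 * (norm (?g \<xi> - a))\<^sup>2"
        using sum_squares_bound[of "norm (?g w - a)" "norm (?g \<xi> - a)"] by (simp add: power2_sum)
      finally have "(norm (?g w - ?g \<xi>))\<^sup>2 / (norm (w - \<xi>))\<^sup>2 \<le>
          (2 * (norm (?g w - a))\<^sup>2 + 2 * (norm (?g \<xi> - a))\<^sup>2) / (norm (w - \<xi>))\<^sup>2"
        by (rule divide_right_mono) simp
      also have "\<dots> = 2 * ((norm (?g w - a))\<^sup>2 / (norm (w - \<xi>))\<^sup>2) + 2 * (norm (?g \<xi> - a))\<^sup>2 * (1 / (norm (w - \<xi>))\<^sup>2)"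
        by (simp add: add_divide_distrib)
      finally have "ennreal ((norm (?g w - ?g \<xi>))\<^sup>2 / (norm (w - \<xi>))\<^sup>2) \<le>
          ennreal (2 * ((norm (?g w - a))\<^sup>2 / (norm (w - \<xi>))\<^sup>2) + 2 * (norm (?g \<xi> - a))\<^sup>2 * (1 / (norm (w - \<xi>))\<^sup>2))"
        by (rule ennreal_leI)
      also have "\<dots> = 2 * ennreal ((norm (?g w - a))\<^sup>2 / (norm (w - \<xi>))\<^sup>2) + (2 * ?d) * ennreal (1 / (norm (w - \<xi>))\<^sup>2)"
        by (simp add: ennreal_mult ennreal_plus del: times_divide_eq_right times_divide_eq_left)
      also have "\<dots> = 2 * ?J w + (2 * ?d) * (?far w * ennreal (1 / (norm (w - \<xi>))\<^sup>2))"
        using False by simp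
      finally show ?thesis by (rule order_trans) simp
    qed
  qed
  also have "\<dots> = (ennreal (72 / (1 - r)) * ?N) * emeasure circle_measure Near +
      (2 * integral\<^sup>N circle_measure ?J +
       (2 * ?d) * (\<integral>\<^sup>+ w. ?far w * ennreal (1 / (norm (w - \<xi>))\<^sup>2) \<partial>circle_measure))"
    by (simp add: nn_integral_add nn_integral_cmult nn_integral_cmult_indicator ns)
  also have "\<dots> \<le> (ennreal (72 / (1 - r)) * ?N) * ennreal (4 * (1 - r)) +
      (2 * (132 * ?N) + (2 * (ennreal (8 * (1 - r)) * ?N)) * ennreal (4 / (1 - r)))"
    using emeasure_circle_near[OF \<xi>, of "1 - r", folded Near_def] dilation_far_bound[OF f r \<xi>, of a]
      nn_integral_circle_far[OF \<xi>, of "1 - r"] d r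
    by (intro add_mono mult_mono) auto
  also have "(ennreal (72 / (1 - r)) * ?N) * ennreal (4 * (1 - r)) = ennreal (72 / (1 - r) * (4 * (1 - r))) * ?N"
    using r by (subst ennreal_mult') (auto simp: mult_ac)
  also have "(2 * (ennreal (8 * (1 - r)) * ?N)) * ennreal (4 / (1 - r)) = 2 * (ennreal (8 * (1 - r) * (4 / (1 - r))) * ?N)"
    using r by (subst ennreal_mult') (auto simp: mult_ac)
  also have "72 / (1 - r) * (4 * (1 - r)) = 288" using r by (simp add: field_simps)
  also have "8 * (1 - r) * (4 / (1 - r)) = 32" using r by (simp add: field_simps)
  also have "ennreal 288 * ?N + (2 * (132 * ?N) + 2 * (ennreal 32 * ?N)) = 616 * ?N"
    by (simp flip: distrib_right mult.assoc)
  finally show ?thesis .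
qed

lemma local_dirichlet_integral_dilation_le:
  assumes "f \<in> L2_circle" "0 \<le> r" "r < 1" "norm \<xi> = 1"
  shows "local_dirichlet_integral (dilation r f) \<xi> \<le> 616 * local_dirichlet_integral f \<xi>"
  using local_energy_dilation_le[OF assms] local_dirichlet_integral_le[OF dilation_L2[OF assms(1-3)] assms(4)]
    local_dirichlet_integral_eq[OF assms(1,4)] by (metis order_trans)

section \<open>The Hilbert space structure\<close>

text \<open>Kept for an arbitrary measure because it serves both the circle and the product of \<mu>
  with the circle measure, where difference quotients live.\<close>

definition square_integrable :: "'a measure \<Rightarrow> ('a \<Rightarrow> complex) \<Rightarrow> bool" where
  "square_integrable M f \<longleftrightarrow> f \<in> borel_measurable M \<and> (\<integral>\<^sup>+ x. ennreal ((norm (f x))\<^sup>2) \<partial>M) < \<infinity>"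

definition l2_inner :: "'a measure \<Rightarrow> ('a \<Rightarrow> complex) \<Rightarrow> ('a \<Rightarrow> complex) \<Rightarrow> complex" where
  "l2_inner M f g = (LINT x|M. f x * cnj (g x))"

lemma L2_circle_iff: "f \<in> L2_circle \<longleftrightarrow> square_integrable circle_measure f"
  by (simp add: L2_circle_def square_integrable_def)

lemma borel_measurable_cnj [measurable (raw)]:
  "f \<in> borel_measurable M \<Longrightarrow> (\<lambda>x. cnj (f x)) \<in> borel_measurable M"
  by (rule borel_measurable_continuous_on[OF continuous_on_cnj[OF continuous_on_id]])

lemma norm_square_add_le: "(norm (x + y))\<^sup>2 \<le> 2 * (norm x)\<^sup>2 + 2 * (norm y)\<^sup>2"
  for x y :: "'a::real_normed_vector"
proof -
  have "(norm (x + y))\<^sup>2 \<le> (norm x + norm y)\<^sup>2"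
    by (intro power_mono norm_triangle_ineq norm_ge_zero)
  also have "\<dots> \<le> 2 * (norm x)\<^sup>2 + 2 * (norm y)\<^sup>2"
    using sum_squares_bound[of "norm x" "norm y"] by (simp add: power2_sum)
  finally show ?thesis .
qed

lemma nn_integral_norm_square_add_le:
  assumes [measurable]: "f \<in> borel_measurable M" "g \<in> borel_measurable M"
  shows "(\<integral>\<^sup>+ x. ennreal ((norm (f x + g x :: complex))\<^sup>2) \<partial>M) \<le>
    2 * (\<integral>\<^sup>+ x. ennreal ((norm (f x))\<^sup>2) \<partial>M) + 2 * (\<integral>\<^sup>+ x. ennreal ((norm (g x))\<^sup>2) \<partial>M)"
proof -
  have "(\<integral>\<^sup>+ x. ennreal ((norm (f x + g x))\<^sup>2) \<partial>M) \<le>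
      (\<integral>\<^sup>+ x. 2 * ennreal ((norm (f x))\<^sup>2) + 2 * ennreal ((norm (g x))\<^sup>2) \<partial>M)"
  proof (rule nn_integral_mono)
    fix x
    have "ennreal ((norm (f x + g x))\<^sup>2) \<le> ennreal (2 * (norm (f x))\<^sup>2 + 2 * (norm (g x))\<^sup>2)"
      by (intro ennreal_leI norm_square_add_le)
    then show "ennreal ((norm (f x + g x))\<^sup>2) \<le> 2 * ennreal ((norm (f x))\<^sup>2) + 2 * ennreal ((norm (g x))\<^sup>2)"
      by (simp add: ennreal_plus ennreal_mult)
  qed
  then show ?thesis by (simp add: nn_integral_add nn_integral_cmult)
qed

lemma nn_integral_norm_square_scale:
  assumes [measurable]: "f \<in> borel_measurable M"
  shows "(\<integral>\<^sup>+ x. ennreal ((norm (c * f x :: complex))\<^sup>2) \<partial>M) =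
    ennreal ((norm c)\<^sup>2) * (\<integral>\<^sup>+ x. ennreal ((norm (f x))\<^sup>2) \<partial>M)"
  by (simp add: norm_mult power_mult_distrib ennreal_mult nn_integral_cmult)

lemma square_integrable_add:
  assumes "square_integrable M f" "square_integrable M g"
  shows "square_integrable M (\<lambda>x. f x + g x)"
proof -
  have [measurable]: "f \<in> borel_measurable M" "g \<in> borel_measurable M"
    using assms by (auto simp: square_integrable_def)
  have "2 * (\<integral>\<^sup>+ x. ennreal ((norm (f x))\<^sup>2) \<partial>M) + 2 * (\<integral>\<^sup>+ x. ennreal ((norm (g x))\<^sup>2) \<partial>M) < \<infinity>"
    using assms by (auto simp: square_integrable_def ennreal_mult_less_top)
  with nn_integral_norm_square_add_le[of f M g] show ?thesis
    by (auto simp: square_integrable_def intro: order.strict_trans1)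
qed

lemma square_integrable_scale:
  assumes "square_integrable M f"
  shows "square_integrable M (\<lambda>x. c * f x)"
  using assms by (auto simp: square_integrable_def nn_integral_norm_square_scale ennreal_mult_less_top)

lemma square_integrable_cong_AE:
  assumes "square_integrable M f" "AE x in M. g x = f x" and [measurable]: "g \<in> borel_measurable M"
  shows "square_integrable M g"
proof -
  have "(\<integral>\<^sup>+ x. ennreal ((norm (g x))\<^sup>2) \<partial>M) = (\<integral>\<^sup>+ x. ennreal ((norm (f x))\<^sup>2) \<partial>M)"
    using assms(2) by (intro nn_integral_cong_AE) auto
  then show ?thesis using assms by (simp add: square_integrable_def)
qed

lemma integrable_l2_inner:
  assumes "square_integrable M f" "square_integrable M g"
  shows "integrable M (\<lambda>x. f x * cnj (g x))"
proof (rule integrableI_bounded)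
  have [measurable]: "f \<in> borel_measurable M" "g \<in> borel_measurable M"
    using assms by (auto simp: square_integrable_def)
  show "(\<lambda>x. f x * cnj (g x)) \<in> borel_measurable M" by measurable
  have "(\<integral>\<^sup>+ x. ennreal (norm (f x * cnj (g x))) \<partial>M) \<le>
      (\<integral>\<^sup>+ x. ennreal ((norm (f x))\<^sup>2) + ennreal ((norm (g x))\<^sup>2) \<partial>M)"
  proof (rule nn_integral_mono)
    fix x
    have "norm (f x) * norm (g x) \<le> (norm (f x))\<^sup>2 + (norm (g x))\<^sup>2"
      using sum_squares_bound[of "norm (f x)" "norm (g x)"]
        mult_nonneg_nonneg[OF norm_ge_zero[of "f x"] norm_ge_zero[of "g x"]] by linarith
    then show "ennreal (norm (f x * cnj (g x))) \<le> ennreal ((norm (f x))\<^sup>2) + ennreal ((norm (g x))\<^sup>2)"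
      by (simp add: norm_mult flip: ennreal_plus)
  qed
  also have "\<dots> < \<infinity>"
    using assms by (simp add: nn_integral_add square_integrable_def)
  finally show "(\<integral>\<^sup>+ x. ennreal (norm (f x * cnj (g x))) \<partial>M) < \<infinity>" .
qed

lemma l2_inner_add_left:
  assumes "square_integrable M f" "square_integrable M g" "square_integrable M h"
  shows "l2_inner M (\<lambda>x. f x + g x) h = l2_inner M f h + l2_inner M g h"
  unfolding l2_inner_def distrib_right
  by (intro Bochner_Integration.integral_add integrable_l2_inner assms)

lemma l2_inner_scale_left: "l2_inner M (\<lambda>x. c * f x) h = c * l2_inner M f h"
  by (simp add: l2_inner_def mult.assoc)

lemma l2_inner_commute: "l2_inner M g f = cnj (l2_inner M f g)"
  by (simp add: l2_inner_def mult.commute flip: Bochner_Integration.integral_cnj)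

lemma l2_inner_self:
  assumes "square_integrable M f"
  shows "l2_inner M f f = of_real (enn2real (\<integral>\<^sup>+ x. ennreal ((norm (f x))\<^sup>2) \<partial>M))"
proof -
  have [measurable]: "f \<in> borel_measurable M" using assms by (simp add: square_integrable_def)
  have "l2_inner M f f = of_real (LINT x|M. (norm (f x))\<^sup>2)"
    unfolding l2_inner_def by (simp flip: complex_norm_square integral_complex_of_real)
  also have "(LINT x|M. (norm (f x))\<^sup>2) = enn2real (\<integral>\<^sup>+ x. ennreal ((norm (f x))\<^sup>2) \<partial>M)"
    by (rule integral_eq_nn_integral) auto
  finally show ?thesis .
qed

lemma l2_inner_cong_AE:
  assumes "AE x in M. f x = f' x" "AE x in M. g x = g' x"
    and "f \<in> borel_measurable M" "f' \<in> borel_measurable M" "g \<in> borel_measurable M" "g' \<in> borel_measurable M"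
  shows "l2_inner M f g = l2_inner M f' g'"
proof -
  note [measurable] = assms(3-)
  show ?thesis unfolding l2_inner_def
  proof (rule integral_cong_AE)
    show "AE x in M. f x * cnj (g x) = f' x * cnj (g' x)"
      using assms(1,2) by eventually_elim simp
  qed measurable
qed

text \<open>
  The set of points with a non-tangential limit is a countable Boolean combination of sets that are
  closed in the circle; measurability of \<^const>\<open>boundary_value\<close> matters because the Bochner
  integral of a function that is only almost everywhere equal to a Borel function is \<open>0\<close>.
\<close>

definition stolz_oscillation_le :: "(complex \<Rightarrow> complex) \<Rightarrow> real \<Rightarrow> real \<Rightarrow> real \<Rightarrow> complex \<Rightarrow> bool" where
  "stolz_oscillation_le F \<kappa> \<delta> \<epsilon> \<xi> \<longleftrightarrow>
    (\<forall>z\<in>stolz_region \<kappa> \<xi>. \<forall>z'\<in>stolz_region \<kappa> \<xi>. dist z \<xi> < \<delta> \<longrightarrow> dist z' \<xi> < \<delta> \<longrightarrow> dist (F z) (F z') \<le> \<epsilon>)"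

text \<open>For fixed z and z' all conditions on \<xi> are strict inequalities between continuous
  functions. The set where the oscillation bound fails is therefore open, even as an uncountable
  union.\<close>

lemma sets_stolz_oscillation_le:
  "{\<xi> \<in> space circle_borel. stolz_oscillation_le F \<kappa> \<delta> \<epsilon> \<xi>} \<in> sets circle_borel"
proof -
  let ?U = "\<lambda>z z'. {\<xi>. norm (z - \<xi>) < \<kappa> * (1 - norm z)} \<inter> {\<xi>. norm (z' - \<xi>) < \<kappa> * (1 - norm z')} \<inter>
      {\<xi>. dist z \<xi> < \<delta>} \<inter> {\<xi>. dist z' \<xi> < \<delta>}"
  define V where "V = (\<Union>z\<in>ball 0 1. \<Union>z'\<in>ball 0 1 \<inter> {z'. \<epsilon> < dist (F z) (F z')}. ?U z z')"
  have "open V"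
    unfolding V_def by (intro open_UN ballI open_Int open_Collect_less continuous_intros)
  then have "(\<lambda>x. x) -` (- V) \<inter> space circle_borel \<in> sets circle_borel"
    by (intro measurable_sets[OF measurable_circle_id]) auto
  moreover have "{\<xi> \<in> space circle_borel. stolz_oscillation_le F \<kappa> \<delta> \<epsilon> \<xi>} = (\<lambda>x. x) -` (- V) \<inter> space circle_borel"
  proof -
    have "\<xi> \<in> V \<longleftrightarrow> \<not> stolz_oscillation_le F \<kappa> \<delta> \<epsilon> \<xi>" for \<xi>
      unfolding V_def stolz_oscillation_le_def stolz_region_def by (simp add: not_le Bex_def) blast
    then show ?thesis by blast
  qed
  ultimately show ?thesis by simp
qed

text \<open>Cauchy criterion over countably many apertures, distances and tolerances. The apertures
  k + 2 are cofinal, and all of their cones contain the radial sequence that produces the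
  limit.\<close>

lemma has_nontangential_limit_iff_oscillation:
  assumes \<xi>: "norm \<xi> = 1"
  shows "(\<exists>l. has_nontangential_limit F l \<xi>) \<longleftrightarrow>
    (\<forall>k n. \<exists>m. stolz_oscillation_le F (real k + 2) (inverse (real (Suc m))) (inverse (real (Suc n))) \<xi>)"
    (is "?L \<longleftrightarrow> ?R")
proof
  assume ?L
  then obtain l where l: "has_nontangential_limit F l \<xi>" by blast
  show ?R
  proof (intro allI)
    fix k n
    let ?\<epsilon> = "inverse (real (Suc n))"
    have "(F \<longlongrightarrow> l) (at \<xi> within stolz_region (real k + 2) \<xi>)"
      using l by (simp add: has_nontangential_limit_def)
    then have "eventually (\<lambda>z. dist (F z) l < ?\<epsilon> / 2) (at \<xi> within stolz_region (real k + 2) \<xi>)"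
      by (rule tendstoD) simp
    then obtain d where d: "0 < d" "\<And>z. z \<in> stolz_region (real k + 2) \<xi> \<Longrightarrow> z \<noteq> \<xi> \<Longrightarrow> dist z \<xi> < d \<Longrightarrow> dist (F z) l < ?\<epsilon> / 2"
      unfolding eventually_at by blast
    obtain m where m: "inverse (real (Suc m)) < d" using reals_Archimedean[OF d(1)] by blast
    have ne: "z \<noteq> \<xi>" if "z \<in> stolz_region (real k + 2) \<xi>" for z
      using that \<xi> by (auto simp: stolz_region_def)
    have "stolz_oscillation_le F (real k + 2) (inverse (real (Suc m))) ?\<epsilon> \<xi>"
      unfolding stolz_oscillation_le_def
    proof (intro ballI impI)
      fix z z' assume z: "z \<in> stolz_region (real k + 2) \<xi>" "z' \<in> stolz_region (real k + 2) \<xi>"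
        "dist z \<xi> < inverse (real (Suc m))" "dist z' \<xi> < inverse (real (Suc m))"
      have "dist (F z) l < ?\<epsilon> / 2" "dist (F z') l < ?\<epsilon> / 2"
        using d(2)[OF z(1) ne[OF z(1)]] d(2)[OF z(2) ne[OF z(2)]] z m by auto
      then show "dist (F z) (F z') \<le> ?\<epsilon>"
        using dist_triangle2[of "F z" "F z'" l] by linarith
    qed
    then show "\<exists>m. stolz_oscillation_le F (real k + 2) (inverse (real (Suc m))) ?\<epsilon> \<xi>" by blast
  qed
next
  assume R: ?R
  let ?z = "\<lambda>n. of_real (1 - inverse (real (Suc n))) * \<xi>"
  have zs: "?z n \<in> stolz_region 2 \<xi>" and zd: "dist (?z n) \<xi> = inverse (real (Suc n))" for n
    using radial_point_in_stolz_region[OF \<xi>, of n] by (auto simp: dist_norm)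
  have mono: "stolz_region \<kappa> \<xi> \<subseteq> stolz_region \<kappa>' \<xi>" if "\<kappa> \<le> \<kappa>'" for \<kappa> \<kappa>'
    using that by (auto simp: stolz_region_def intro: order.strict_trans2 mult_right_mono)
  have zs': "?z n \<in> stolz_region (real k + 2) \<xi>" for n k
    using zs mono[of 2 "real k + 2"] by auto
  have invm: "eventually (\<lambda>j. inverse (real (Suc j)) < d) sequentially" if "0 < d" for d
    using order_tendstoD(2)[OF LIMSEQ_inverse_real_of_nat that] .
  have "Cauchy (\<lambda>j. F (?z j))"
  proof (rule metric_CauchyI)
    fix e :: real assume "0 < e"
    then obtain n where n: "inverse (real (Suc n)) < e" using reals_Archimedean by blast
    obtain m where m: "stolz_oscillation_le F (real 0 + 2) (inverse (real (Suc m))) (inverse (real (Suc n))) \<xi>"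
      using R by blast
    obtain J where J: "\<And>j. J \<le> j \<Longrightarrow> inverse (real (Suc j)) < inverse (real (Suc m))"
      using invm[of "inverse (real (Suc m))"] by (auto simp: eventually_sequentially)
    have "dist (F (?z i)) (F (?z j)) < e" if "J \<le> i" "J \<le> j" for i j
    proof -
      have "dist (F (?z i)) (F (?z j)) \<le> inverse (real (Suc n))"
        using m[unfolded stolz_oscillation_le_def] zs'[of i 0] zs'[of j 0] J[OF that(1)] J[OF that(2)] zd by metis
      with n show ?thesis by linarith
    qed
    then show "\<exists>M. \<forall>i\<ge>M. \<forall>j\<ge>M. dist (F (?z i)) (F (?z j)) < e" by blast
  qed
  then obtain l where l: "(\<lambda>j. F (?z j)) \<longlonglongrightarrow> l"
    by (auto simp: Cauchy_convergent_iff convergent_def)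
  \<comment> \<open>The radial points lie in every cone of aperture k + 2, so the limit l found with
    k = 0 is the limit in all of them.\<close>
  have "(F \<longlongrightarrow> l) (at \<xi> within stolz_region \<kappa> \<xi>)" for \<kappa>
  proof (rule tendstoI)
    fix e :: real assume "0 < e"
    then obtain n where n: "inverse (real (Suc n)) < e" using reals_Archimedean by blast
    obtain k where k: "\<kappa> \<le> real k + 2" using real_arch_simple[of "\<kappa> - 2"] by (auto simp: algebra_simps)
    obtain m where m: "stolz_oscillation_le F (real k + 2) (inverse (real (Suc m))) (inverse (real (Suc n))) \<xi>"
      using R by blast
    have "dist (F z) l < e" if z: "z \<in> stolz_region \<kappa> \<xi>" "dist z \<xi> < inverse (real (Suc m))" for z
    proof -
      have z': "z \<in> stolz_region (real k + 2) \<xi>" using z mono[OF k] by auto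
      have "eventually (\<lambda>j. dist (F z) (F (?z j)) \<le> inverse (real (Suc n))) sequentially"
      proof (rule eventually_mono)
        show "eventually (\<lambda>j. inverse (real (Suc j)) < inverse (real (Suc m))) sequentially"
          by (rule invm) simp
        fix j assume "inverse (real (Suc j)) < inverse (real (Suc m))"
        then show "dist (F z) (F (?z j)) \<le> inverse (real (Suc n))"
          using m[unfolded stolz_oscillation_le_def] z' zs'[of j k] z(2) zd[of j] by metis
      qed
      moreover have "(\<lambda>j. dist (F z) (F (?z j))) \<longlonglongrightarrow> dist (F z) l"
        by (intro tendsto_intros l)
      ultimately have "dist (F z) l \<le> inverse (real (Suc n))"
        by (intro tendsto_upperbound[of "\<lambda>j. dist (F z) (F (?z j))"]) auto
      with n show ?thesis by linarith
    qed
    then show "eventually (\<lambda>z. dist (F z) l < e) (at \<xi> within stolz_region \<kappa> \<xi>)"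
      unfolding eventually_at by (intro exI[of _ "inverse (real (Suc m))"]) auto
  qed
  then show ?L by (auto simp: has_nontangential_limit_def)
qed

lemma measurable_boundary_value:
  assumes [measurable]: "f \<in> borel_measurable circle_borel"
  shows "boundary_value f \<in> borel_measurable circle_borel"
proof -
  let ?F = "poisson_integral f"
  let ?C = "\<lambda>\<xi>. \<forall>k n. \<exists>m. stolz_oscillation_le ?F (real k + 2) (inverse (real (Suc m))) (inverse (real (Suc n))) \<xi>"
  note [measurable] = measurable_radial_value[OF assms]
  have [measurable]: "Measurable.pred circle_borel (\<lambda>\<xi>. stolz_oscillation_le ?F \<kappa> \<delta> \<epsilon> \<xi>)" for \<kappa> \<delta> \<epsilon>
    using sets_stolz_oscillation_le by (simp only: pred_def)
  \<comment> \<open>Without a limit the predicate under \<open>THE\<close> is false for every l, so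
    the default is the same constant \<open>THE l. False\<close> at all such points.\<close>
  have "boundary_value f \<xi> = (if ?C \<xi>
      then radial_value f \<xi> else (THE l. False))" if "\<xi> \<in> space circle_borel" for \<xi>
  proof (cases "\<exists>l. has_nontangential_limit ?F l \<xi>")
    case True
    then obtain l where "has_nontangential_limit ?F l \<xi>" by blast
    with True that show ?thesis
      using boundary_value_eqI radial_value_eqI has_nontangential_limit_iff_oscillation[of \<xi> ?F] by auto
  next
    case False
    then have "boundary_value f \<xi> = (THE l. False)" by (simp add: boundary_value_def)
    moreover have "\<not> (?C \<xi>)"
      using False that by (subst has_nontangential_limit_iff_oscillation[symmetric]) auto
    ultimately show ?thesis by (simp only: if_False)
  qed
  moreover have "(\<lambda>\<xi>. if ?C \<xi>
      then radial_value f \<xi> else (THE l. False)) \<in> borel_measurable circle_borel"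
    by measurable
  ultimately show ?thesis by (rule measurable_cong[THEN iffD2])
qed

text \<open>Makes the Dirichlet integral the squared L2 norm of one function of (\<xi>, w). With
  \<open>radial_value\<close> it is jointly measurable for every measurable f, but it is linear in f
  only up to null sets.\<close>

definition difference_quotient :: "(complex \<Rightarrow> complex) \<Rightarrow> complex \<times> complex \<Rightarrow> complex" where
  "difference_quotient f = (\<lambda>(\<xi>, w). (f w - radial_value f \<xi>) / of_real (norm (w - \<xi>)))"

lemma measurable_difference_quotient:
  assumes [measurable]: "f \<in> borel_measurable circle_borel"
  shows "difference_quotient f \<in> borel_measurable (circle_borel \<Otimes>\<^sub>M circle_borel)"
proof -
  note [measurable] = measurable_radial_value[OF assms]
  show ?thesis unfolding difference_quotient_def by measurable
qed

section \<open>Linear operations and local energies\<close>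

lemma local_energy_add_finite:
  assumes [measurable]: "f \<in> borel_measurable circle_borel" "g \<in> borel_measurable circle_borel"
    and "local_energy f a \<xi> < \<infinity>" "local_energy g b \<xi> < \<infinity>"
  shows "local_energy (\<lambda>w. f w + g w) (a + b) \<xi> < \<infinity>"
proof -
  let ?F = "\<lambda>w. (f w - a) / of_real (norm (w - \<xi>))" and ?G = "\<lambda>w. (g w - b) / of_real (norm (w - \<xi>))"
  have e: "local_energy h c \<xi> = circle_norm_sq (\<lambda>w. (h w - c) / of_real (norm (w - \<xi>)))" for h c
    unfolding local_energy_def by (simp add: norm_divide power_divide)
  have "local_energy (\<lambda>w. f w + g w) (a + b) \<xi> = circle_norm_sq (\<lambda>w. ?F w + ?G w)"
    unfolding e by (simp add: algebra_simps add_divide_distrib diff_divide_distrib)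
  also have "\<dots> \<le> 2 * circle_norm_sq ?F + 2 * circle_norm_sq ?G"
    by (rule nn_integral_norm_square_add_le) measurable
  also have "\<dots> < \<infinity>" using assms(3,4) unfolding e by (simp add: ennreal_mult_less_top)
  finally show ?thesis .
qed

lemma local_energy_scale:
  assumes [measurable]: "f \<in> borel_measurable circle_borel"
  shows "local_energy (\<lambda>w. c * f w) (c * a) \<xi> = ennreal ((norm c)\<^sup>2) * local_energy f a \<xi>"
proof -
  have "local_energy (\<lambda>w. c * f w) (c * a) \<xi> =
      (\<integral>\<^sup>+ w. ennreal ((norm c)\<^sup>2) * ennreal ((norm (f w - a))\<^sup>2 / (norm (w - \<xi>))\<^sup>2) \<partial>circle_measure)"
    unfolding local_energy_def
    by (simp add: norm_mult power_mult_distrib flip: right_diff_distrib ennreal_mult')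
  then show ?thesis by (simp add: local_energy_def nn_integral_cmult)
qed

lemma L2_circle_add: "f \<in> L2_circle \<Longrightarrow> g \<in> L2_circle \<Longrightarrow> (\<lambda>w. f w + g w) \<in> L2_circle"
  unfolding L2_circle_iff by (rule square_integrable_add)

lemma L2_circle_scale: "f \<in> L2_circle \<Longrightarrow> (\<lambda>w. c * f w) \<in> L2_circle"
  unfolding L2_circle_iff by (rule square_integrable_scale)

section \<open>The norm and inner product on the product with \<mu>\<close>

locale finite_circle_measure = finite_measure \<mu> for \<mu> :: "complex measure" +
  assumes sets_mu [simp, measurable_cong]: "sets \<mu> = sets circle_borel"
begin

sublocale prod: pair_sigma_finite \<mu> circle_measure ..

lemma space_mu [simp]: "space \<mu> = unit_circle"
  using sets_eq_imp_space_eq[OF sets_mu] by simp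

abbreviation "P \<equiv> \<mu> \<Otimes>\<^sub>M circle_measure"

lemma sets_P: "sets P = sets (circle_borel \<Otimes>\<^sub>M circle_borel)"
  by (rule sets_pair_measure_cong) auto

lemma measurable_dq:
  "f \<in> L2_circle \<Longrightarrow> difference_quotient f \<in> borel_measurable P"
  using measurable_difference_quotient[OF L2_circle_measurable] measurable_cong_sets[OF sets_P refl] by blast

lemma dirichlet_integral_eq:
  assumes f: "f \<in> L2_circle"
  shows "dirichlet_integral \<mu> f = (\<integral>\<^sup>+ p. ennreal ((norm (difference_quotient f p))\<^sup>2) \<partial>P)"
proof -
  note [measurable] = measurable_dq[OF f]
  have "(\<integral>\<^sup>+ p. ennreal ((norm (difference_quotient f p))\<^sup>2) \<partial>P) =
      (\<integral>\<^sup>+ \<xi>. \<integral>\<^sup>+ w. ennreal ((norm (difference_quotient f (\<xi>, w)))\<^sup>2) \<partial>circle_measure \<partial>\<mu>)"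
    by (rule circle.nn_integral_fst[symmetric]) measurable
  also have "\<dots> = dirichlet_integral \<mu> f"
    unfolding dirichlet_integral_def
    by (intro nn_integral_cong)
       (simp add: local_dirichlet_integral_eq[OF f] local_energy_def difference_quotient_def norm_divide power_divide)
  finally show ?thesis by simp
qed

lemma harmonic_dirichlet_iff:
  "f \<in> harmonic_dirichlet_space \<mu> \<longleftrightarrow> f \<in> L2_circle \<and> square_integrable P (difference_quotient f)"
  using L2_circle_finite[of f]
  by (auto simp: harmonic_dirichlet_space_def mu_norm_sq_def dirichlet_integral_eq square_integrable_def
      measurable_dq)

lemma harmonicD:
  assumes "f \<in> harmonic_dirichlet_space \<mu>"
  shows "f \<in> L2_circle" "square_integrable P (difference_quotient f)"
    "square_integrable circle_measure f" "mu_norm_sq \<mu> f < \<infinity>"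
  using assms harmonic_dirichlet_iff by (auto simp: harmonic_dirichlet_space_def L2_circle_iff)

lemma AE_local_dirichlet_finite:
  assumes f: "f \<in> harmonic_dirichlet_space \<mu>"
  shows "AE \<xi> in \<mu>. norm \<xi> = 1 \<and> local_dirichlet_integral f \<xi> < \<infinity>"
proof -
  note [measurable] = measurable_local_dirichlet_integral[OF harmonicD(1)[OF f]]
  have "dirichlet_integral \<mu> f < \<infinity>"
    using harmonicD(4)[OF f] by (simp add: mu_norm_sq_def)
  then have "AE \<xi> in \<mu>. local_dirichlet_integral f \<xi> \<noteq> \<infinity>"
    unfolding dirichlet_integral_def by (intro nn_integral_PInf_AE) auto
  with AE_space show ?thesis
    by eventually_elim (auto simp: less_top)
qed

lemma AE_prodI:
  assumes "AE \<xi> in \<mu>. \<forall>w. R (\<xi>, w)" and "{p \<in> space P. R p} \<in> sets P"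
  shows "AE p in P. R p"
  using assms by (intro prod.AE_pair_measure) auto

text \<open>Radial limits of f and g need not both exist everywhere. Where both local integrals are
  finite, f + g has finite energy at the sum of the two values, and uniqueness of such a constant
  identifies it as the radial value of f + g.\<close>

lemma difference_quotient_add:
  assumes f: "f \<in> harmonic_dirichlet_space \<mu>" and g: "g \<in> harmonic_dirichlet_space \<mu>"
  shows "AE p in P. difference_quotient (\<lambda>w. f w + g w) p = difference_quotient f p + difference_quotient g p"
proof (rule AE_prodI)
  note fL = harmonicD(1)[OF f] and gL = harmonicD(1)[OF g]
  note [measurable] = measurable_dq[OF fL] measurable_dq[OF gL] measurable_dq[OF L2_circle_add[OF fL gL]]
  show "{p \<in> space P. difference_quotient (\<lambda>w. f w + g w) p = difference_quotient f p + difference_quotient g p} \<in> sets P"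
    by measurable
  show "AE \<xi> in \<mu>. \<forall>w. difference_quotient (\<lambda>w. f w + g w) (\<xi>, w) = difference_quotient f (\<xi>, w) + difference_quotient g (\<xi>, w)"
    using AE_local_dirichlet_finite[OF f] AE_local_dirichlet_finite[OF g]
  proof eventually_elim
    fix \<xi> assume fx: "norm \<xi> = 1 \<and> local_dirichlet_integral f \<xi> < \<infinity>"
      and gx: "norm \<xi> = 1 \<and> local_dirichlet_integral g \<xi> < \<infinity>"
    have "local_energy (\<lambda>w. f w + g w) (radial_value f \<xi> + radial_value g \<xi>) \<xi> < \<infinity>"
      using fx gx local_dirichlet_integral_eq[OF fL, of \<xi>] local_dirichlet_integral_eq[OF gL, of \<xi>]
      by (intro local_energy_add_finite L2_circle_measurable fL gL) auto
    then have "radial_value (\<lambda>w. f w + g w) \<xi> = radial_value f \<xi> + radial_value g \<xi>"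
      using fx by (intro radial_value_unique L2_circle_add fL gL) auto
    then show "\<forall>w. difference_quotient (\<lambda>w. f w + g w) (\<xi>, w) = difference_quotient f (\<xi>, w) + difference_quotient g (\<xi>, w)"
      by (simp add: difference_quotient_def algebra_simps flip: add_divide_distrib)
  qed
qed

lemma difference_quotient_scale:
  assumes f: "f \<in> harmonic_dirichlet_space \<mu>"
  shows "AE p in P. difference_quotient (\<lambda>w. c * f w) p = c * difference_quotient f p"
proof (rule AE_prodI)
  note fL = harmonicD(1)[OF f]
  note [measurable] = measurable_dq[OF fL] measurable_dq[OF L2_circle_scale[OF fL]]
  show "{p \<in> space P. difference_quotient (\<lambda>w. c * f w) p = c * difference_quotient f p} \<in> sets P"
    by measurable
  show "AE \<xi> in \<mu>. \<forall>w. difference_quotient (\<lambda>w. c * f w) (\<xi>, w) = c * difference_quotient f (\<xi>, w)"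
    using AE_local_dirichlet_finite[OF f]
  proof eventually_elim
    fix \<xi> assume fx: "norm \<xi> = 1 \<and> local_dirichlet_integral f \<xi> < \<infinity>"
    have "local_energy (\<lambda>w. c * f w) (c * radial_value f \<xi>) \<xi> < \<infinity>"
      using fx local_dirichlet_integral_eq[OF fL, of \<xi>] local_energy_scale[OF L2_circle_measurable[OF fL]]
      by (simp add: ennreal_mult_less_top)
    then have "radial_value (\<lambda>w. c * f w) \<xi> = c * radial_value f \<xi>"
      using fx by (intro radial_value_unique L2_circle_scale fL) auto
    then show "\<forall>w. difference_quotient (\<lambda>w. c * f w) (\<xi>, w) = c * difference_quotient f (\<xi>, w)"
      by (simp add: difference_quotient_def flip: right_diff_distrib)
  qed
qed

lemma harmonic_add:
  assumes f: "f \<in> harmonic_dirichlet_space \<mu>" and g: "g \<in> harmonic_dirichlet_space \<mu>"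
  shows "(\<lambda>w. f w + g w) \<in> harmonic_dirichlet_space \<mu>"
  unfolding harmonic_dirichlet_iff
  using square_integrable_cong_AE[OF square_integrable_add[OF harmonicD(2)[OF f] harmonicD(2)[OF g]]
      difference_quotient_add[OF f g] measurable_dq]
    L2_circle_add[OF harmonicD(1)[OF f] harmonicD(1)[OF g]] by blast

lemma harmonic_scale:
  assumes f: "f \<in> harmonic_dirichlet_space \<mu>"
  shows "(\<lambda>w. c * f w) \<in> harmonic_dirichlet_space \<mu>"
  unfolding harmonic_dirichlet_iff
  using square_integrable_cong_AE[OF square_integrable_scale[OF harmonicD(2)[OF f]]
      difference_quotient_scale[OF f] measurable_dq] L2_circle_scale[OF harmonicD(1)[OF f]] by blast

text \<open>Two passages: \<open>boundary_value\<close> equals \<open>radial_value\<close> at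
  \<mu>-almost every point, and the iterated integral is a product integral because the two
  quotients are square integrable. The first passage needs both inner integrals to be measurable in
  \<xi>.\<close>

lemma mu_inner_eq:
  assumes f: "f \<in> harmonic_dirichlet_space \<mu>" and g: "g \<in> harmonic_dirichlet_space \<mu>"
  shows "mu_inner \<mu> f g = l2_inner circle_measure f g + l2_inner P (difference_quotient f) (difference_quotient g)"
proof -
  note fL = harmonicD(1)[OF f] and gL = harmonicD(1)[OF g]
  note [measurable] = measurable_difference_quotient[OF L2_circle_measurable[OF fL]]
    measurable_difference_quotient[OF L2_circle_measurable[OF gL]]
    L2_circle_measurable[OF fL] L2_circle_measurable[OF gL]
  note [measurable] = measurable_boundary_value[OF L2_circle_measurable[OF fL]]
    measurable_boundary_value[OF L2_circle_measurable[OF gL]]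
  let ?q = "\<lambda>\<xi> w. difference_quotient f (\<xi>, w) * cnj (difference_quotient g (\<xi>, w))"
  have "(LINT \<xi>|\<mu>. LINT w|circle_measure. (f w - boundary_value f \<xi>) * cnj (g w - boundary_value g \<xi>)
          / of_real ((norm (w - \<xi>))\<^sup>2)) = (LINT \<xi>|\<mu>. LINT w|circle_measure. ?q \<xi> w)"
  proof (rule integral_cong_AE)
    have ae: "AE \<xi> in \<mu>. boundary_value f \<xi> = radial_value f \<xi> \<and> boundary_value g \<xi> = radial_value g \<xi>"
      using AE_local_dirichlet_finite[OF f] AE_local_dirichlet_finite[OF g]
      by eventually_elim (simp add: boundary_value_eq_radial_value fL gL)
    show "AE \<xi> in \<mu>. (LINT w|circle_measure. (f w - boundary_value f \<xi>) * cnj (g w - boundary_value g \<xi>)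
          / of_real ((norm (w - \<xi>))\<^sup>2)) = (LINT w|circle_measure. ?q \<xi> w)"
      using ae by eventually_elim
        (simp add: difference_quotient_def power2_eq_square)
    show "(\<lambda>\<xi>. LINT w|circle_measure. ?q \<xi> w) \<in> borel_measurable \<mu>"
      by (rule circle.borel_measurable_lebesgue_integral) measurable
    show "(\<lambda>\<xi>. LINT w|circle_measure. (f w - boundary_value f \<xi>) * cnj (g w - boundary_value g \<xi>)
          / of_real ((norm (w - \<xi>))\<^sup>2)) \<in> borel_measurable \<mu>"
      by (rule circle.borel_measurable_lebesgue_integral) measurable
  qed
  also have "\<dots> = l2_inner P (difference_quotient f) (difference_quotient g)"
    unfolding l2_inner_def
    using prod.integral_fst'[OF integrable_l2_inner[OF harmonicD(2)[OF f] harmonicD(2)[OF g]]] by simp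
  finally show ?thesis by (simp add: mu_inner_def l2_inner_def)
qed

lemma mu_inner_add_left:
  assumes f: "f \<in> harmonic_dirichlet_space \<mu>" and g: "g \<in> harmonic_dirichlet_space \<mu>"
    and h: "h \<in> harmonic_dirichlet_space \<mu>"
  shows "mu_inner \<mu> (\<lambda>w. f w + g w) h = mu_inner \<mu> f h + mu_inner \<mu> g h"
proof -
  have "l2_inner P (difference_quotient (\<lambda>w. f w + g w)) (difference_quotient h) =
      l2_inner P (\<lambda>p. difference_quotient f p + difference_quotient g p) (difference_quotient h)"
    using harmonicD(1)[OF f] harmonicD(1)[OF g] harmonicD(1)[OF h]
    by (intro l2_inner_cong_AE difference_quotient_add f g borel_measurable_add measurable_dq L2_circle_add) auto
  then show ?thesis
    using harmonic_add[OF f g] f g h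
    by (simp add: mu_inner_eq l2_inner_add_left harmonicD)
qed

lemma mu_inner_scale_left:
  assumes f: "f \<in> harmonic_dirichlet_space \<mu>" and h: "h \<in> harmonic_dirichlet_space \<mu>"
  shows "mu_inner \<mu> (\<lambda>w. c * f w) h = c * mu_inner \<mu> f h"
proof -
  have "l2_inner P (difference_quotient (\<lambda>w. c * f w)) (difference_quotient h) =
      l2_inner P (\<lambda>p. c * difference_quotient f p) (difference_quotient h)"
    using harmonicD(1)[OF f] harmonicD(1)[OF h]
    by (intro l2_inner_cong_AE difference_quotient_scale f borel_measurable_times borel_measurable_const measurable_dq L2_circle_scale) auto
  then show ?thesis
    using harmonic_scale[OF f] f h
    by (simp add: mu_inner_eq l2_inner_scale_left distrib_left)
qed

lemma mu_inner_commute: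
  assumes "f \<in> harmonic_dirichlet_space \<mu>" "g \<in> harmonic_dirichlet_space \<mu>"
  shows "mu_inner \<mu> g f = cnj (mu_inner \<mu> f g)"
  using assms by (simp add: mu_inner_eq l2_inner_commute[of _ g] l2_inner_commute[of _ "difference_quotient g"])

definition energy :: "(complex \<Rightarrow> complex) \<Rightarrow> real" where
  "energy f = enn2real (mu_norm_sq \<mu> f)"

lemma mu_norm_sq_energy:
  "f \<in> harmonic_dirichlet_space \<mu> \<Longrightarrow> mu_norm_sq \<mu> f = ennreal (energy f)"
  using harmonicD(4) by (simp add: energy_def)

lemma energy_nonneg [simp]: "0 \<le> energy f"
  by (simp add: energy_def)

lemma mu_inner_self:
  assumes "f \<in> harmonic_dirichlet_space \<mu>"
  shows "mu_inner \<mu> f f = of_real (energy f)"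
  using harmonicD[OF assms]
  by (simp add: mu_inner_eq assms l2_inner_self energy_def mu_norm_sq_def dirichlet_integral_eq
      square_integrable_def enn2real_plus)

end

section \<open>Completeness\<close>

lemma liminf_add_le_ennreal:
  fixes u v :: "nat \<Rightarrow> ennreal"
  shows "liminf u + liminf v \<le> liminf (\<lambda>n. u n + v n)"
proof -
  have i: "incseq (\<lambda>n. INF i\<in>{n..}. x i)" for x :: "nat \<Rightarrow> ennreal"
    by (intro incseq_SucI INF_superset_mono) auto
  have "liminf u + liminf v = (SUP n. (INF i\<in>{n..}. u i) + (INF i\<in>{n..}. v i))"
    unfolding liminf_SUP_INF by (rule ennreal_SUP_add[OF i i, symmetric])
  also have "\<dots> \<le> (SUP n. INF i\<in>{n..}. u i + v i)"
    by (intro SUP_mono' INF_greatest add_mono INF_lower)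
  finally show ?thesis unfolding liminf_SUP_INF .
qed

lemma L1_square_le_circle_norm_sq:
  assumes [measurable]: "h \<in> borel_measurable circle_borel"
  shows "ennreal ((LINT w|circle_measure. norm (h w))\<^sup>2) \<le> circle_norm_sq h"
proof -
  have "ennreal ((norm (LINT w|circle_measure. 1 *\<^sub>R complex_of_real (norm (h w))))\<^sup>2) \<le>
      (\<integral>\<^sup>+ w. ennreal (1\<^sup>2) \<partial>circle_measure) * circle_norm_sq (\<lambda>w. complex_of_real (norm (h w)))"
    by (rule norm_integral_square_le) measurable
  then show ?thesis by simp
qed

lemma square_integrable_diff:
  assumes "square_integrable M f" "square_integrable M g"
  shows "square_integrable M (\<lambda>x. f x - g x)"
  using square_integrable_add[OF assms(1) square_integrable_scale[OF assms(2), of "-1"]] by simp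

lemma circle_norm_sq_liminf:
  assumes [measurable]: "\<And>n. f n \<in> borel_measurable circle_borel" "g \<in> borel_measurable circle_borel"
    and lim: "AE w in circle_measure. (\<lambda>n. f n w) \<longlonglongrightarrow> g w"
  shows "circle_norm_sq g \<le> liminf (\<lambda>n. circle_norm_sq (f n))"
proof -
  have "circle_norm_sq g = (\<integral>\<^sup>+ w. liminf (\<lambda>n. ennreal ((norm (f n w))\<^sup>2)) \<partial>circle_measure)"
  proof (rule nn_integral_cong_AE)
    show "AE w in circle_measure. ennreal ((norm (g w))\<^sup>2) = liminf (\<lambda>n. ennreal ((norm (f n w))\<^sup>2))"
      using lim
    proof eventually_elim
      fix w assume "(\<lambda>n. f n w) \<longlonglongrightarrow> g w"
      then have "(\<lambda>n. ennreal ((norm (f n w))\<^sup>2)) \<longlonglongrightarrow> ennreal ((norm (g w))\<^sup>2)"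
        by (intro tendsto_ennrealI tendsto_intros)
      from lim_imp_Liminf[OF _ this] show "ennreal ((norm (g w))\<^sup>2) = liminf (\<lambda>n. ennreal ((norm (f n w))\<^sup>2))" by simp
    qed
  qed
  also have "\<dots> \<le> liminf (\<lambda>n. circle_norm_sq (f n))"
    by (rule nn_integral_liminf) measurable
  finally show ?thesis .
qed

text \<open>On a probability space an L2 Cauchy sequence is L1 Cauchy and so has an almost
  everywhere convergent subsequence; Fatou's lemma upgrades this to L2 convergence. The pointwise
  convergence is kept in the conclusion, since lower semicontinuity uses it.\<close>

lemma L2_circle_Cauchy_limit:
  fixes f :: "nat \<Rightarrow> complex \<Rightarrow> complex"
  assumes f: "\<And>n. f n \<in> L2_circle"
    and C: "\<And>e. 0 < e \<Longrightarrow> \<exists>N. \<forall>i\<ge>N. \<forall>j\<ge>N. circle_norm_sq (\<lambda>w. f i w - f j w) < ennreal e"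
  obtains r :: "nat \<Rightarrow> nat" and g where "strict_mono r" "g \<in> L2_circle" "AE w in circle_measure. (\<lambda>n. f (r n) w) \<longlonglongrightarrow> g w"
    "(\<lambda>n. circle_norm_sq (\<lambda>w. f (r n) w - g w)) \<longlonglongrightarrow> 0"
proof -
  note m[measurable] = L2_circle_measurable[OF f]
  have L1: "\<exists>N. \<forall>i\<ge>N. \<forall>j\<ge>N. (LINT w|circle_measure. norm (f i w - f j w)) < e" if e: "0 < e" for e
  proof -
    obtain N where N: "\<And>i j. N \<le> i \<Longrightarrow> N \<le> j \<Longrightarrow> circle_norm_sq (\<lambda>w. f i w - f j w) < ennreal (e\<^sup>2)"
      using C[of "e\<^sup>2"] e by auto
    have "(LINT w|circle_measure. norm (f i w - f j w)) < e" if "N \<le> i" "N \<le> j" for i j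
    proof -
      have "ennreal ((LINT w|circle_measure. norm (f i w - f j w))\<^sup>2) < ennreal (e\<^sup>2)"
        using N[OF that] by (rule order.strict_trans1[rotated]) (rule L1_square_le_circle_norm_sq, measurable)
      then have "(LINT w|circle_measure. norm (f i w - f j w))\<^sup>2 < e\<^sup>2"
        by (subst (asm) ennreal_less_iff) auto
      then show ?thesis by (rule power2_less_imp_less) (use e in simp)
    qed
    then show ?thesis by blast
  qed
  obtain r where r: "strict_mono r" and ae: "AE w in circle_measure. Cauchy (\<lambda>n. f (r n) w)"
    by (rule cauchy_L1_AE_cauchy_subseq[where s=f and M=circle_measure, OF L2_circle_integrable[OF f] L1])
  define g where "g w = lim (\<lambda>n. f (r n) w)" for w
  have [measurable]: "g \<in> borel_measurable circle_borel"
    unfolding g_def by (rule borel_measurable_lim_metric) measurable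
  have lim: "AE w in circle_measure. (\<lambda>n. f (r n) w) \<longlonglongrightarrow> g w"
    using ae by eventually_elim (simp add: g_def Cauchy_convergent_iff convergent_LIMSEQ_iff)
  have ev: "\<exists>N. \<forall>n\<ge>N. circle_norm_sq (\<lambda>w. f (r n) w - g w) \<le> ennreal e" if e: "0 < e" for e
  proof -
    obtain N where N: "\<And>i j. N \<le> i \<Longrightarrow> N \<le> j \<Longrightarrow> circle_norm_sq (\<lambda>w. f i w - f j w) < ennreal e"
      using C[OF e] by auto
    have "circle_norm_sq (\<lambda>w. f (r n) w - g w) \<le> ennreal e" if "N \<le> n" for n
    proof -
      have "circle_norm_sq (\<lambda>w. f (r n) w - g w) \<le> liminf (\<lambda>k. circle_norm_sq (\<lambda>w. f (r n) w - f (r k) w))"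
      proof (rule circle_norm_sq_liminf)
        show "AE w in circle_measure. (\<lambda>k. f (r n) w - f (r k) w) \<longlonglongrightarrow> f (r n) w - g w"
          using lim by eventually_elim (intro tendsto_intros)
      qed measurable
      also have "\<dots> \<le> ennreal e"
      proof (rule Liminf_le)
        show "eventually (\<lambda>k. circle_norm_sq (\<lambda>w. f (r n) w - f (r k) w) \<le> ennreal e) sequentially"
        proof (rule eventually_sequentiallyI)
          fix k assume "N \<le> k"
          then show "circle_norm_sq (\<lambda>w. f (r n) w - f (r k) w) \<le> ennreal e"
            using seq_suble[OF r, of n] seq_suble[OF r, of k] \<open>N \<le> n\<close> by (intro less_imp_le[OF N]) auto
        qed
      qed simp
      finally show ?thesis .
    qed
    then show ?thesis by blast
  qed
  have "g \<in> L2_circle"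
  proof -
    obtain N where "circle_norm_sq (\<lambda>w. f (r N) w - g w) \<le> ennreal 1" using ev[of 1] by auto
    then have "square_integrable circle_measure (\<lambda>w. f (r N) w - g w)"
      by (auto simp: square_integrable_def intro: order.strict_trans1)
    from square_integrable_diff[OF f[of "r N", unfolded L2_circle_iff] this]
    show ?thesis by (simp add: L2_circle_iff)
  qed
  moreover have "(\<lambda>n. circle_norm_sq (\<lambda>w. f (r n) w - g w)) \<longlonglongrightarrow> 0"
  proof (rule order_tendstoI)
    fix e :: ennreal assume "0 < e"
    then obtain e' where e': "0 < e'" "ennreal e' < e"
      by (metis ennreal_less_zero_iff ennreal_rat_dense dense ennreal_cases ennreal_less_top order.strict_trans zero_less_one ennreal_1 less_top_ennreal)
    with ev[OF e'(1)] show "eventually (\<lambda>n. circle_norm_sq (\<lambda>w. f (r n) w - g w) < e) sequentially"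
      by (auto simp: eventually_sequentially intro: order.strict_trans1)
  qed simp
  ultimately show ?thesis using that r lim by blast
qed

text \<open>The factor 4 is the square of the diameter of the circle. This bounds the boundary value
  of f by its energy and its L2 norm.\<close>

lemma circle_norm_sq_diff_le_local_energy:
  assumes \<xi>: "norm \<xi> = 1" and [measurable]: "f \<in> borel_measurable circle_borel"
  shows "circle_norm_sq (\<lambda>w. f w - a) \<le> 4 * local_energy f a \<xi>"
proof -
  have "circle_norm_sq (\<lambda>w. f w - a) \<le>
      (\<integral>\<^sup>+ w. 4 * ennreal ((norm (f w - a))\<^sup>2 / (norm (w - \<xi>))\<^sup>2) \<partial>circle_measure)"
  proof (rule nn_integral_mono_AE)
    show "AE w in circle_measure. ennreal ((norm (f w - a))\<^sup>2) \<le> 4 * ennreal ((norm (f w - a))\<^sup>2 / (norm (w - \<xi>))\<^sup>2)"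
      using AE_circle_neq[OF \<xi>] AE_space
    proof eventually_elim
      fix w assume w: "w \<noteq> \<xi>" "w \<in> space circle_measure"
      have "norm (w - \<xi>) \<le> 2" using norm_triangle_ineq4[of w \<xi>] w \<xi> by simp
      then have "(norm (w - \<xi>))\<^sup>2 \<le> 4" using power_mono[of "norm (w - \<xi>)" 2 2] by simp
      then have "(norm (f w - a))\<^sup>2 * (norm (w - \<xi>))\<^sup>2 \<le> (norm (f w - a))\<^sup>2 * 4"
        by (rule mult_left_mono) simp
      then have "(norm (f w - a))\<^sup>2 \<le> 4 * ((norm (f w - a))\<^sup>2 / (norm (w - \<xi>))\<^sup>2)"
        using w by (simp add: field_simps)
      then have "ennreal ((norm (f w - a))\<^sup>2) \<le> ennreal (4 * ((norm (f w - a))\<^sup>2 / (norm (w - \<xi>))\<^sup>2))"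
        by (rule ennreal_leI)
      then show "ennreal ((norm (f w - a))\<^sup>2) \<le> 4 * ennreal ((norm (f w - a))\<^sup>2 / (norm (w - \<xi>))\<^sup>2)"
        by (simp add: ennreal_mult' del: times_divide_eq_right)
    qed
  qed
  then show ?thesis by (simp add: local_energy_def nn_integral_cmult)
qed

text \<open>The boundary values of the f n need not converge, but energy and L2 bounds keep them
  bounded along a sequence realising the liminf. Fatou's lemma along a subsequence with boundary
  values tending to l bounds the energy of g at l.\<close>

lemma local_dirichlet_integral_liminf:
  assumes f: "\<And>n. f n \<in> L2_circle" and g: "g \<in> L2_circle"
    and lim: "AE w in circle_measure. (\<lambda>n. f n w) \<longlonglongrightarrow> g w"
    and B: "\<And>n. circle_norm_sq (f n) \<le> ennreal B" and \<xi>: "norm \<xi> = 1"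
  shows "local_dirichlet_integral g \<xi> \<le> liminf (\<lambda>n. local_dirichlet_integral (f n) \<xi>)"
proof (cases "liminf (\<lambda>n. local_dirichlet_integral (f n) \<xi>) = \<infinity>")
  case False
  note [measurable] = L2_circle_measurable[OF f] L2_circle_measurable[OF g]
  let ?D = "\<lambda>n. local_dirichlet_integral (f n) \<xi>"
  obtain L where L: "liminf ?D = ennreal L" "0 \<le> L"
    using False by (cases "liminf ?D") auto
  obtain s where s: "strict_mono s" "(?D \<circ> s) \<longlonglongrightarrow> liminf ?D"
    using liminf_subseq_lim[of ?D] by blast
  have "liminf ?D < ennreal (L + 1)" using L by (simp add: ennreal_less_iff)
  from order_tendstoD(2)[OF s(2) this] obtain K where K: "\<And>k. K \<le> k \<Longrightarrow> ?D (s k) < ennreal (L + 1)"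
    by (auto simp: eventually_sequentially)
  \<comment> \<open>The shift by K keeps only indices at which the local integral is below L + 1, so
    that the bound on the boundary values holds for all k.\<close>
  define s' where "s' k = s (k + K)" for k
  have s': "strict_mono s'" "(\<lambda>k. ?D (s' k)) \<longlonglongrightarrow> liminf ?D"
    using s LIMSEQ_ignore_initial_segment[OF s(2), of K] by (auto simp: s'_def strict_mono_def o_def)
  define a where "a k = radial_value (f (s' k)) \<xi>" for k
  have De: "?D (s' k) = local_energy (f (s' k)) (a k) \<xi>" for k
    unfolding a_def by (rule local_dirichlet_integral_eq[OF f \<xi>])
  have ab: "(norm (a k))\<^sup>2 \<le> 8 * (L + 1) + 2 * \<bar>B\<bar>" for k
  proof -
    have "ennreal ((norm (a k))\<^sup>2) = circle_norm_sq (\<lambda>w. (a k - f (s' k) w) + f (s' k) w)"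
      by simp
    also have "\<dots> \<le> 2 * circle_norm_sq (\<lambda>w. a k - f (s' k) w) + 2 * circle_norm_sq (f (s' k))"
      by (rule nn_integral_norm_square_add_le) measurable
    also have "\<dots> \<le> 2 * (4 * ennreal (L + 1)) + 2 * ennreal \<bar>B\<bar>"
    proof (intro add_mono mult_left_mono)
      have "circle_norm_sq (\<lambda>w. a k - f (s' k) w) \<le> 4 * local_energy (f (s' k)) (a k) \<xi>"
        using circle_norm_sq_diff_le_local_energy[OF \<xi>, of "f (s' k)" "a k"]
        by (simp add: norm_minus_commute)
      also have "\<dots> \<le> 4 * ennreal (L + 1)"
        using K[of "k + K"] De[of k] by (intro mult_left_mono) (auto simp: s'_def)
      finally show "circle_norm_sq (\<lambda>w. a k - f (s' k) w) \<le> 4 * ennreal (L + 1)" .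
      show "circle_norm_sq (f (s' k)) \<le> ennreal \<bar>B\<bar>"
        using B by (rule order_trans) (simp add: ennreal_leI)
    qed auto
    also have "\<dots> = ennreal (8 * (L + 1) + 2 * \<bar>B\<bar>)"
      using L by (simp add: ennreal_plus ennreal_mult flip: mult.assoc)
    finally show ?thesis using L by (subst (asm) ennreal_le_iff) auto
  qed
  have "bounded (range a)"
    unfolding bounded_iff using ab by (intro exI[of _ "sqrt (8 * (L + 1) + 2 * \<bar>B\<bar>)"]) (auto intro: real_le_rsqrt)
  then obtain l t where t: "strict_mono t" "(a \<circ> t) \<longlonglongrightarrow> l"
    using bounded_imp_convergent_subsequence by blast
  have st: "strict_mono (s' \<circ> t)" using s'(1) t(1) by (rule strict_mono_o)
  \<comment> \<open>Holds for any constant, so l does not have to be identified as the boundary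
    value of g beforehand.\<close>
  have "local_dirichlet_integral g \<xi> \<le> local_energy g l \<xi>"
    by (rule local_dirichlet_integral_le[OF g \<xi>])
  also have "\<dots> = (\<integral>\<^sup>+ w. liminf (\<lambda>k. ennreal ((norm (f (s' (t k)) w - a (t k)))\<^sup>2 / (norm (w - \<xi>))\<^sup>2)) \<partial>circle_measure)"
    unfolding local_energy_def
  proof (rule nn_integral_cong_AE)
    show "AE w in circle_measure. ennreal ((norm (g w - l))\<^sup>2 / (norm (w - \<xi>))\<^sup>2) =
        liminf (\<lambda>k. ennreal ((norm (f (s' (t k)) w - a (t k)))\<^sup>2 / (norm (w - \<xi>))\<^sup>2))"
      using lim AE_circle_neq[OF \<xi>]
    proof eventually_elim
      fix w assume w: "(\<lambda>n. f n w) \<longlonglongrightarrow> g w" "w \<noteq> \<xi>"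
      have "(\<lambda>k. f (s' (t k)) w) \<longlonglongrightarrow> g w"
        using LIMSEQ_subseq_LIMSEQ[OF w(1) st] by (simp add: o_def)
      moreover have "(\<lambda>k. a (t k)) \<longlonglongrightarrow> l" using t(2) by (simp add: o_def)
      ultimately have "(\<lambda>k. ennreal ((norm (f (s' (t k)) w - a (t k)))\<^sup>2 / (norm (w - \<xi>))\<^sup>2)) \<longlonglongrightarrow>
          ennreal ((norm (g w - l))\<^sup>2 / (norm (w - \<xi>))\<^sup>2)"
        using w(2) by (intro tendsto_ennrealI tendsto_intros) auto
      from lim_imp_Liminf[OF _ this] show "ennreal ((norm (g w - l))\<^sup>2 / (norm (w - \<xi>))\<^sup>2) =
        liminf (\<lambda>k. ennreal ((norm (f (s' (t k)) w - a (t k)))\<^sup>2 / (norm (w - \<xi>))\<^sup>2))" by simp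
    qed
  qed
  also have "\<dots> \<le> liminf (\<lambda>k. local_energy (f (s' (t k))) (a (t k)) \<xi>)"
    unfolding local_energy_def by (rule nn_integral_liminf) measurable
  also have "\<dots> = liminf (\<lambda>k. ?D (s' (t k)))" by (simp add: De)
  also have "\<dots> = liminf ?D"
    using LIMSEQ_subseq_LIMSEQ[OF s'(2) t(1)] by (intro lim_imp_Liminf) (auto simp: o_def)
  finally show ?thesis .
qed simp

section \<open>Fourier coefficients and disc values as linear functionals\<close>

lemma fourier_coeff_add:
  assumes "integrable circle_measure f" "integrable circle_measure g"
  shows "fourier_coeff (\<lambda>w. f w + g w) n = fourier_coeff f n + fourier_coeff g n"
proof -
  have "integrable circle_measure (\<lambda>w. h w * w powi (- n))" if h: "integrable circle_measure h" for h
  proof (rule Bochner_Integration.integrable_bound[OF h])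
    have [measurable]: "h \<in> borel_measurable circle_borel" using borel_measurable_integrable[OF h] by simp
    show "(\<lambda>w. h w * w powi (- n)) \<in> borel_measurable circle_measure" by measurable
    show "AE w in circle_measure. norm (h w * w powi (- n)) \<le> norm (h w)"
      by (intro AE_I2) (auto simp: norm_mult norm_power_int)
  qed
  then show ?thesis
    unfolding fourier_coeff_def distrib_right using assms by (intro Bochner_Integration.integral_add)
qed

lemma fourier_coeff_scale: "fourier_coeff (\<lambda>w. c * f w) n = c * fourier_coeff f n"
  by (simp add: fourier_coeff_def mult.assoc)

lemma disc_value_add:
  assumes "integrable circle_measure f" "integrable circle_measure g" "norm z < 1"
  shows "disc_value (\<lambda>w. f w + g w) z = disc_value f z + disc_value g z"
  unfolding disc_value_def fourier_coeff_add[OF assms(1,2)] distrib_right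
  by (rule suminf_add[symmetric]; rule summable_disc_value[OF assms(3)])

lemma disc_value_scale:
  assumes "norm z < 1"
  shows "disc_value (\<lambda>w. c * f w) z = c * disc_value f z"
  unfolding disc_value_def fourier_coeff_scale mult.assoc
  by (rule suminf_mult[OF summable_disc_value[OF assms]])

lemma hardy_add:
  assumes "f \<in> hardy_space" "g \<in> hardy_space"
  shows "(\<lambda>w. f w + g w) \<in> hardy_space"
  using assms by (auto simp: hardy_space_def L2_circle_add fourier_coeff_add L2_circle_integrable)

lemma hardy_scale: "f \<in> hardy_space \<Longrightarrow> (\<lambda>w. c * f w) \<in> hardy_space"
  by (auto simp: hardy_space_def L2_circle_scale fourier_coeff_scale)

text \<open>Point evaluation is bounded already for the L2 norm. Hence L2 limits keep the constraint
  f(z) = 1, and a function satisfying it has positive energy.\<close>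

lemma norm_disc_value_square_le:
  assumes f: "f \<in> hardy_space" and z: "norm z < 1"
  shows "ennreal ((norm (disc_value f z))\<^sup>2) \<le> ennreal (2 / (1 - norm z)) * circle_norm_sq f"
proof -
  have fL: "f \<in> L2_circle" using f by (simp add: hardy_space_def)
  note [measurable] = L2_circle_measurable[OF fL]
  have "ennreal ((norm (disc_value f z))\<^sup>2) \<le> (\<integral>\<^sup>+ w. ennreal (poisson_kernel z w * (norm (f w))\<^sup>2) \<partial>circle_measure)"
    using norm_poisson_integral_square_le[OF fL z, of 0] poisson_integral_hardy[OF f L2_circle_integrable[OF fL] z] by simp
  also have "\<dots> \<le> (\<integral>\<^sup>+ w. ennreal (2 / (1 - norm z)) * ennreal ((norm (f w))\<^sup>2) \<partial>circle_measure)"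
  proof (rule nn_integral_mono)
    fix w assume "w \<in> space circle_measure"
    then have "poisson_kernel z w * (norm (f w))\<^sup>2 \<le> 2 / (1 - norm z) * (norm (f w))\<^sup>2"
      using poisson_kernel_le[OF z, of w] by (intro mult_right_mono) auto
    then show "ennreal (poisson_kernel z w * (norm (f w))\<^sup>2) \<le> ennreal (2 / (1 - norm z)) * ennreal ((norm (f w))\<^sup>2)"
      using z by (subst ennreal_mult'[symmetric]) (auto intro: ennreal_leI)
  qed
  also have "\<dots> = ennreal (2 / (1 - norm z)) * circle_norm_sq f"
    by (rule nn_integral_cmult) measurable
  finally show ?thesis .
qed

text \<open>Fourier coefficients are controlled by the L1 norm, hence by the L2 norm, so the
  vanishing of those of negative index passes to g. Then f n - g is in the Hardy space and
  evaluation is continuous on it.\<close>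

lemma hardy_space_closed:
  assumes f: "\<And>n. f n \<in> hardy_space" and g: "g \<in> L2_circle"
    and lim: "(\<lambda>n. circle_norm_sq (\<lambda>w. f n w - g w)) \<longlonglongrightarrow> 0"
  shows "g \<in> hardy_space" and "norm z < 1 \<Longrightarrow> (\<lambda>n. disc_value (f n) z) \<longlonglongrightarrow> disc_value g z"
proof -
  have fL: "f n \<in> L2_circle" for n using f by (simp add: hardy_space_def)
  note [measurable] = L2_circle_measurable[OF fL] L2_circle_measurable[OF g]
  have "fourier_coeff g k = 0" if k: "k < 0" for k
  proof -
    have "ennreal ((norm (fourier_coeff g k))\<^sup>2) \<le> circle_norm_sq (\<lambda>w. f n w - g w)" for n
    proof -
      have "fourier_coeff (\<lambda>w. f n w + (-1) * g w) k = - fourier_coeff g k"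
        using f k L2_circle_integrable[OF fL] L2_circle_integrable[OF g]
        by (subst fourier_coeff_add) (auto simp: fourier_coeff_scale hardy_space_def fourier_coeff_scale[of "-1", simplified])
      then have "norm (fourier_coeff g k) \<le> (LINT w|circle_measure. norm (f n w - g w))"
        using norm_fourier_coeff_le[of "\<lambda>w. f n w - g w" k] by simp
      then have "ennreal ((norm (fourier_coeff g k))\<^sup>2) \<le> ennreal ((LINT w|circle_measure. norm (f n w - g w))\<^sup>2)"
        by (intro ennreal_leI power_mono) auto
      also have "\<dots> \<le> circle_norm_sq (\<lambda>w. f n w - g w)"
        by (rule L1_square_le_circle_norm_sq) measurable
      finally show ?thesis .
    qed
    then have "ennreal ((norm (fourier_coeff g k))\<^sup>2) \<le> 0"
      by (intro tendsto_lowerbound[OF lim]) auto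
    then show ?thesis by simp
  qed
  then show gh: "g \<in> hardy_space" using g by (simp add: hardy_space_def)
  show "(\<lambda>n. disc_value (f n) z) \<longlonglongrightarrow> disc_value g z" if z: "norm z < 1"
  proof -
    have le: "ennreal ((norm (disc_value (f n) z - disc_value g z))\<^sup>2) \<le> ennreal (2 / (1 - norm z)) * circle_norm_sq (\<lambda>w. f n w - g w)" for n
    proof -
      have "disc_value (\<lambda>w. f n w + (-1) * g w) z = disc_value (f n) z - disc_value g z"
        using L2_circle_integrable[OF fL] L2_circle_integrable[OF g] z
        by (subst disc_value_add) (auto simp: disc_value_scale[of z "-1", simplified])
      then show ?thesis
        using norm_disc_value_square_le[OF hardy_add[OF f[of n] hardy_scale[OF gh, of "-1"]] z] by simp
    qed
    have "(\<lambda>n. ennreal (2 / (1 - norm z)) * circle_norm_sq (\<lambda>w. f n w - g w)) \<longlonglongrightarrow> ennreal (2 / (1 - norm z)) * 0"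
      by (rule tendsto_mult_ennreal[OF tendsto_const lim]) auto
    then have *: "(\<lambda>n. ennreal (2 / (1 - norm z)) * circle_norm_sq (\<lambda>w. f n w - g w)) \<longlonglongrightarrow> 0"
      by simp
    have "(\<lambda>n. ennreal ((norm (disc_value (f n) z - disc_value g z))\<^sup>2)) \<longlonglongrightarrow> 0"
      by (rule tendsto_sandwich[OF _ _ tendsto_const *]) (rule always_eventually, use le in simp)+
    then have "(\<lambda>n. (norm (disc_value (f n) z - disc_value g z))\<^sup>2) \<longlonglongrightarrow> 0"
      by (subst (asm) ennreal_0[symmetric], subst (asm) tendsto_ennreal_iff) auto
    then have "(\<lambda>n. norm (disc_value (f n) z - disc_value g z)) \<longlonglongrightarrow> 0"
      using tendsto_real_sqrt[of "\<lambda>n. (norm (disc_value (f n) z - disc_value g z))\<^sup>2" 0] by simp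
    then show ?thesis by (simp add: LIM_zero_iff tendsto_norm_zero_iff)
  qed
qed

section \<open>Reproducing elements\<close>

lemma const_in_L2: "(\<lambda>_. c) \<in> L2_circle"
  by (simp add: L2_circle_def)

lemma const_in_hardy: "(\<lambda>_. c) \<in> hardy_space"
  by (simp add: hardy_space_def const_in_L2 fourier_coeff_const)

lemma disc_value_const:
  assumes "norm z < 1"
  shows "disc_value (\<lambda>_. c) z = c"
  using poisson_integral_hardy[OF const_in_hardy _ assms] poisson_integral_const[OF assms] by simp

context finite_circle_measure
begin

lemma dirichletD:
  assumes "f \<in> dirichlet_space \<mu>"
  shows "f \<in> harmonic_dirichlet_space \<mu>" "f \<in> hardy_space" "f \<in> L2_circle" "integrable circle_measure f"
  using assms L2_circle_integrable by (auto simp: dirichlet_space_def hardy_space_def)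

lemma dirichlet_add:
  "f \<in> dirichlet_space \<mu> \<Longrightarrow> g \<in> dirichlet_space \<mu> \<Longrightarrow> (\<lambda>w. f w + g w) \<in> dirichlet_space \<mu>"
  by (auto simp: dirichlet_space_def harmonic_add hardy_add)

lemma dirichlet_scale: "f \<in> dirichlet_space \<mu> \<Longrightarrow> (\<lambda>w. c * f w) \<in> dirichlet_space \<mu>"
  by (auto simp: dirichlet_space_def harmonic_scale hardy_scale)

lemma const_in_dirichlet: "(\<lambda>_. c) \<in> dirichlet_space \<mu>"
proof -
  have "dirichlet_integral \<mu> (\<lambda>_. c) \<le> (\<integral>\<^sup>+ \<xi>. local_energy (\<lambda>_. c) c \<xi> \<partial>\<mu>)"
    unfolding dirichlet_integral_def
    by (intro nn_integral_mono local_dirichlet_integral_le const_in_L2) auto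
  also have "\<dots> = 0" by (simp add: local_energy_def)
  finally show ?thesis
    by (simp add: dirichlet_space_def const_in_hardy harmonic_dirichlet_space_def const_in_L2 mu_norm_sq_def)
qed

lemma energy_add_scale:
  assumes f: "f \<in> harmonic_dirichlet_space \<mu>" and g: "g \<in> harmonic_dirichlet_space \<mu>"
  shows "energy (\<lambda>w. f w + c * g w) = energy f + (norm c)\<^sup>2 * energy g + 2 * Re (c * mu_inner \<mu> g f)"
proof -
  note cg = harmonic_scale[OF g, of c]
  note fg = harmonic_add[OF f cg]
  have r: "mu_inner \<mu> h (\<lambda>w. f w + c * g w) = mu_inner \<mu> h f + cnj c * mu_inner \<mu> h g"
    if h: "h \<in> harmonic_dirichlet_space \<mu>" for h
    using mu_inner_commute[OF fg h] mu_inner_commute[OF f h] mu_inner_commute[OF g h]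
    by (simp add: mu_inner_add_left[OF f cg h] mu_inner_scale_left[OF g h])
  have "complex_of_real (energy (\<lambda>w. f w + c * g w)) =
      (mu_inner \<mu> f f + cnj c * mu_inner \<mu> f g) + c * (mu_inner \<mu> g f + cnj c * mu_inner \<mu> g g)"
    unfolding mu_inner_self[OF fg, symmetric] mu_inner_add_left[OF f cg fg] mu_inner_scale_left[OF g fg]
    by (simp add: r f g)
  also have "\<dots> = of_real (energy f) + c * cnj c * of_real (energy g) + (c * mu_inner \<mu> g f + cnj (c * mu_inner \<mu> g f))"
    using mu_inner_commute[OF g f] by (simp add: mu_inner_self f g algebra_simps)
  also have "\<dots> = of_real (energy f + (norm c)\<^sup>2 * energy g + 2 * Re (c * mu_inner \<mu> g f))"
    unfolding complex_add_cnj by (simp only: complex_norm_square of_real_add of_real_mult)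
  finally show ?thesis by (simp only: of_real_eq_iff)
qed

lemma energy_scale:
  assumes f: "f \<in> harmonic_dirichlet_space \<mu>"
  shows "energy (\<lambda>w. c * f w) = (norm c)\<^sup>2 * energy f"
proof -
  have "complex_of_real (energy (\<lambda>w. c * f w)) = c * cnj (c * mu_inner \<mu> f f)"
    using mu_inner_commute[OF harmonic_scale[OF f] f, of c] harmonic_scale[OF f, of c]
    by (simp add: mu_inner_self[symmetric] mu_inner_scale_left f)
  also have "\<dots> = of_real ((norm c)\<^sup>2 * energy f)"
    by (simp add: mu_inner_self f complex_norm_square del: of_real_power)
  finally show ?thesis by (simp only: of_real_eq_iff)
qed

lemma circle_norm_sq_le_energy:
  assumes "f \<in> harmonic_dirichlet_space \<mu>"
  shows "circle_norm_sq f \<le> ennreal (energy f)"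
  unfolding mu_norm_sq_energy[OF assms, symmetric] mu_norm_sq_def by simp

text \<open>Fatou's lemma in \<xi>, on top of semicontinuity at each \<xi>. The uniform L2 bound is
  what keeps the boundary values bounded there.\<close>

lemma mu_norm_sq_liminf:
  assumes f: "\<And>n. f n \<in> L2_circle" and g: "g \<in> L2_circle"
    and lim: "AE w in circle_measure. (\<lambda>n. f n w) \<longlonglongrightarrow> g w"
    and B: "\<And>n. circle_norm_sq (f n) \<le> ennreal B"
  shows "mu_norm_sq \<mu> g \<le> liminf (\<lambda>n. mu_norm_sq \<mu> (f n))"
proof -
  note [measurable] = measurable_local_dirichlet_integral[OF f]
  have "dirichlet_integral \<mu> g \<le> (\<integral>\<^sup>+ \<xi>. liminf (\<lambda>n. local_dirichlet_integral (f n) \<xi>) \<partial>\<mu>)"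
    unfolding dirichlet_integral_def
    by (intro nn_integral_mono local_dirichlet_integral_liminf[OF f g lim B]) simp
  also have "\<dots> \<le> liminf (\<lambda>n. dirichlet_integral \<mu> (f n))"
    unfolding dirichlet_integral_def by (rule nn_integral_liminf) measurable
  finally have "mu_norm_sq \<mu> g \<le> liminf (\<lambda>n. circle_norm_sq (f n)) + liminf (\<lambda>n. dirichlet_integral \<mu> (f n))"
    unfolding mu_norm_sq_def
    by (intro add_mono circle_norm_sq_liminf lim L2_circle_measurable f g)
  also have "\<dots> \<le> liminf (\<lambda>n. mu_norm_sq \<mu> (f n))"
    unfolding mu_norm_sq_def by (rule liminf_add_le_ennreal)
  finally show ?thesis .
qed

text \<open>The closest point theorem for the affine subspace \<open>f(z) = 1\<close>, by the parallelogram law.\<close>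

lemma exists_energy_minimizer:
  assumes z: "norm z < 1"
  obtains g where "g \<in> dirichlet_space \<mu>" "disc_value g z = 1"
    "\<And>f. f \<in> dirichlet_space \<mu> \<Longrightarrow> disc_value f z = 1 \<Longrightarrow> energy g \<le> energy f"
proof -
  define S where "S = {f \<in> dirichlet_space \<mu>. disc_value f z = 1}"
  define d where "d = (INF f\<in>S. energy f)"
  have ne: "S \<noteq> {}" using const_in_dirichlet[of 1] disc_value_const[OF z, of 1] by (auto simp: S_def)
  have bdd: "bdd_below (energy ` S)" by (intro bdd_belowI[of _ 0]) auto
  have d_le: "d \<le> energy f" if "f \<in> S" for f
    unfolding d_def using that bdd by (intro cINF_lower)
  have "\<exists>f\<in>S. energy f < d + inverse (real (Suc n))" for n
    using cINF_less_iff[OF ne bdd, of "d + inverse (real (Suc n))"] by (simp add: d_def)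
  then obtain f where f: "\<And>n. f n \<in> S" "\<And>n. energy (f n) < d + inverse (real (Suc n))" by metis
  have fD: "f n \<in> dirichlet_space \<mu>" and fz: "disc_value (f n) z = 1" for n using f(1) by (auto simp: S_def)
  note fh = dirichletD(1)[OF fD] and fL = dirichletD(3)[OF fD]
  have par: "energy (\<lambda>w. f i w - f j w) \<le> 2 * inverse (real (Suc i)) + 2 * inverse (real (Suc j))" for i j
  proof -
    \<comment> \<open>The factor 1 is written out so that sum and difference are instances of
      \<open>energy_add_scale\<close> with c = 1 and c = -1, whose cross terms cancel. The midpoint
      obeys the constraint, so its energy is at least d.\<close>
    let ?h = "\<lambda>w. (1/2) * (f i w + 1 * f j w)"
    have "?h \<in> dirichlet_space \<mu>" using dirichlet_scale[OF dirichlet_add[OF fD[of i] fD[of j]], of "1/2"] by simp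
    moreover have "disc_value ?h z = 1"
      using fz by (simp only: disc_value_scale[OF z] mult_1_left disc_value_add[OF dirichletD(4)[OF fD] dirichletD(4)[OF fD] z]) simp
    ultimately have "d \<le> energy ?h" by (intro d_le) (simp add: S_def)
    also have "energy ?h = 1/4 * energy (\<lambda>w. f i w + 1 * f j w)"
      using energy_scale[OF harmonic_add[OF fh fh], of "1/2" i j] by (simp add: norm_divide power_divide)
    finally have "4 * d \<le> energy (\<lambda>w. f i w + 1 * f j w)" by simp
    moreover have "energy (\<lambda>w. f i w + 1 * f j w) + energy (\<lambda>w. f i w + (-1) * f j w) = 2 * energy (f i) + 2 * energy (f j)"
      unfolding energy_add_scale[OF fh fh] by simp
    ultimately show ?thesis using f(2)[of i] f(2)[of j] by simp
  qed
  have "\<exists>N. \<forall>i\<ge>N. \<forall>j\<ge>N. circle_norm_sq (\<lambda>w. f i w - f j w) < ennreal e" if e: "0 < e" for e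
  proof -
    obtain N where N: "inverse (real (Suc N)) < e / 4" using reals_Archimedean[of "e/4"] e by auto
    have "circle_norm_sq (\<lambda>w. f i w - f j w) < ennreal e" if ij: "N \<le> i" "N \<le> j" for i j
    proof -
      have "(\<lambda>w. f i w + (-1) * f j w) \<in> harmonic_dirichlet_space \<mu>"
        by (intro harmonic_add harmonic_scale fh)
      then have "circle_norm_sq (\<lambda>w. f i w - f j w) \<le> ennreal (energy (\<lambda>w. f i w - f j w))"
        using circle_norm_sq_le_energy by simp
      also have "\<dots> < ennreal e"
      proof (subst ennreal_less_iff)
        have "inverse (real (Suc i)) \<le> inverse (real (Suc N))" "inverse (real (Suc j)) \<le> inverse (real (Suc N))"
          using ij by auto
        then show "energy (\<lambda>w. f i w - f j w) < e" using par[of i j] N by linarith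
      qed simp
      finally show ?thesis .
    qed
    then show ?thesis by blast
  qed
  \<comment> \<open>The limit is taken in L2 only; lower semicontinuity then puts it into the space
    with energy at most d.\<close>
  from L2_circle_Cauchy_limit[OF fL this] obtain r g where r: "strict_mono r" and gL: "g \<in> L2_circle"
    and lim: "AE w in circle_measure. (\<lambda>n. f (r n) w) \<longlonglongrightarrow> g w"
    and lim2: "(\<lambda>n. circle_norm_sq (\<lambda>w. f (r n) w - g w)) \<longlonglongrightarrow> 0" by blast
  have gH: "g \<in> hardy_space"
    using hardy_space_closed(1)[OF dirichletD(2)[OF fD] gL lim2] .
  have gz: "disc_value g z = 1"
    using hardy_space_closed(2)[OF dirichletD(2)[OF fD] gL lim2 z] by (simp add: fz LIMSEQ_const_iff)
  have le: "mu_norm_sq \<mu> g \<le> ennreal d"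
  proof -
    have "circle_norm_sq (f (r n)) \<le> ennreal (d + 1)" for n
    proof -
      have "inverse (real (Suc (r n))) \<le> 1" by (simp add: inverse_eq_divide)
      then have "energy (f (r n)) \<le> d + 1" using f(2)[of "r n"] by linarith
      then show ?thesis using circle_norm_sq_le_energy[OF fh[of "r n"]] by (meson ennreal_leI order_trans)
    qed
    then have "mu_norm_sq \<mu> g \<le> liminf (\<lambda>n. mu_norm_sq \<mu> (f (r n)))"
      by (rule mu_norm_sq_liminf[OF fL gL lim])
    also have "\<dots> \<le> liminf (\<lambda>n. ennreal (d + inverse (real (Suc (r n)))))"
      unfolding mu_norm_sq_energy[OF fh] by (intro Liminf_mono always_eventually allI ennreal_leI less_imp_le[OF f(2)])
    also have "\<dots> = ennreal d"
    proof (rule lim_imp_Liminf)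
      have "(\<lambda>n. d + inverse (real (Suc n))) \<longlonglongrightarrow> d + 0"
        by (intro tendsto_intros LIMSEQ_inverse_real_of_nat)
      from LIMSEQ_subseq_LIMSEQ[OF this r]
      show "(\<lambda>n. ennreal (d + inverse (real (Suc (r n))))) \<longlonglongrightarrow> ennreal d"
        by (intro tendsto_ennrealI) (simp add: o_def)
    qed simp
    finally show ?thesis .
  qed
  then have gh: "g \<in> harmonic_dirichlet_space \<mu>"
    using gL by (auto simp: harmonic_dirichlet_space_def intro: order.strict_trans1)
  have "0 \<le> d" unfolding d_def using ne by (intro cINF_greatest) auto
  with le have "energy g \<le> d" by (simp add: mu_norm_sq_energy[OF gh])
  then show ?thesis
    using that[of g] gh gH gz d_le by (auto simp: dirichlet_space_def S_def intro: order_trans)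
qed

text \<open>The minimiser g is orthogonal to every h vanishing at z, so the functional f \<mapsto>
  f(z) and the inner product with g have the same kernel and are proportional.\<close>

lemma exists_reproducing_element:
  assumes z: "norm z < 1"
  shows "\<exists>g. reproducing_element \<mu> z g"
proof -
  obtain g where g: "g \<in> dirichlet_space \<mu>" "disc_value g z = 1"
    and min: "\<And>f. f \<in> dirichlet_space \<mu> \<Longrightarrow> disc_value f z = 1 \<Longrightarrow> energy g \<le> energy f"
    using exists_energy_minimizer[OF z] by blast
  note gh = dirichletD(1)[OF g(1)]
  have orth: "mu_inner \<mu> h g = 0" if h: "h \<in> dirichlet_space \<mu>" "disc_value h z = 0" for h
  proof -
    define c where "c = mu_inner \<mu> h g"
    \<comment> \<open>Step length of the variation g - t cnj(c) h: with t * energy h < 1 the gain 2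
      t |c|^2 beats the cost t^2 |c|^2 * energy h. The summand 1 covers energy h = 0.\<close>
    define t where "t = 1 / (energy h + 1)"
    have "0 < energy h + 1" using energy_nonneg[of h] by linarith
    then have t: "0 < t" "t * energy h < 1" by (auto simp: t_def)
    let ?s = "- of_real t * cnj c"
    have "energy g \<le> energy (\<lambda>w. g w + ?s * h w)"
    proof (rule min)
      show "(\<lambda>w. g w + ?s * h w) \<in> dirichlet_space \<mu>"
        using g h by (intro dirichlet_add dirichlet_scale)
      show "disc_value (\<lambda>w. g w + ?s * h w) z = 1"
        using g(2) h(2)
        by (simp only: disc_value_add[OF dirichletD(4)[OF g(1)] dirichletD(4)[OF dirichlet_scale[OF h(1)]] z]
            disc_value_scale[OF z]) simp
    qed
    also have "\<dots> = energy g + (norm ?s)\<^sup>2 * energy h + 2 * Re (?s * c)"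
      unfolding c_def by (rule energy_add_scale[OF gh dirichletD(1)[OF h(1)]])
    also have "?s * c = of_real (- t * (norm c)\<^sup>2)"
      by (simp add: complex_norm_square mult.commute del: of_real_power)
    also have "(norm ?s)\<^sup>2 = t\<^sup>2 * (norm c)\<^sup>2"
      by (simp add: norm_mult power_mult_distrib)
    finally have "0 \<le> t * (norm c)\<^sup>2 * (t * energy h - 2)" by (simp add: algebra_simps power2_eq_square)
    moreover have "t * energy h - 2 < 0" using t by linarith
    ultimately have "t * (norm c)\<^sup>2 \<le> 0"
      by (metis linorder_not_less mult_pos_neg)
    then show ?thesis using t by (simp add: c_def mult_le_0_iff)
  qed
  have pos: "0 < energy g"
  proof (rule ccontr)
    assume "\<not> 0 < energy g"
    then have "circle_norm_sq g \<le> 0"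
      using circle_norm_sq_le_energy[OF gh] energy_nonneg[of g] by simp
    then show False
      using norm_disc_value_square_le[OF dirichletD(2)[OF g(1)] z] g(2) by simp
  qed
  \<comment> \<open>Since f - f(z) g vanishes at z, the inner product of f with g is f(z) * energy
    g; dividing g by its energy normalises this to f(z).\<close>
  let ?k = "\<lambda>w. of_real (1 / energy g) * g w"
  have "disc_value f z = mu_inner \<mu> f ?k" if f: "f \<in> dirichlet_space \<mu>" for f
  proof -
    note fh = dirichletD(1)[OF f]
    let ?h = "\<lambda>w. f w + (- disc_value f z) * g w"
    have "?h \<in> dirichlet_space \<mu>" using f g by (intro dirichlet_add dirichlet_scale)
    moreover have "disc_value ?h z = 0"
      using g(2)
      by (simp only: disc_value_add[OF dirichletD(4)[OF f] dirichletD(4)[OF dirichlet_scale[OF g(1)]] z]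
          disc_value_scale[OF z]) simp
    ultimately have "0 = mu_inner \<mu> ?h g" using orth by simp
    also have "\<dots> = mu_inner \<mu> f g - disc_value f z * of_real (energy g)"
      by (simp only: mu_inner_add_left[OF fh harmonic_scale[OF gh] gh] mu_inner_scale_left[OF gh gh] mu_inner_self[OF gh]) simp
    finally have "mu_inner \<mu> f g = disc_value f z * of_real (energy g)" by simp
    moreover have "mu_inner \<mu> f ?k = of_real (1 / energy g) * mu_inner \<mu> f g"
      using mu_inner_commute[OF harmonic_scale[OF gh] fh] mu_inner_commute[OF gh fh]
      by (simp only: mu_inner_scale_left[OF gh fh]) simp
    ultimately show ?thesis using pos by simp
  qed
  then show ?thesis
    using dirichlet_scale[OF g(1)] unfolding reproducing_element_def by blast
qed

text \<open>From here on the kernel enters only through these three facts, which hold for any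
  reproducing element that \<open>SOME\<close> may select: \<open>mu_kernel\<close> at (z, z) is the
  energy of that element k, and k / k(z) is extremal.\<close>

lemma mu_kernel_extremal:
  assumes z: "norm z < 1"
  shows mu_kernel_pos: "0 < Re (mu_kernel \<mu> z z)"
    and mu_kernel_bound: "\<And>f. f \<in> dirichlet_space \<mu> \<Longrightarrow> (norm (disc_value f z))\<^sup>2 \<le> Re (mu_kernel \<mu> z z) * energy f"
    and mu_kernel_attained: "\<exists>g\<in>dirichlet_space \<mu>. disc_value g z = 1 \<and> energy g = 1 / Re (mu_kernel \<mu> z z)"
proof -
  define k where "k = (SOME g. reproducing_element \<mu> z g)"
  have "reproducing_element \<mu> z k"
    unfolding k_def using exists_reproducing_element[OF z] by (rule someI_ex)
  then have kD: "k \<in> dirichlet_space \<mu>" and rep: "\<And>f. f \<in> dirichlet_space \<mu> \<Longrightarrow> disc_value f z = mu_inner \<mu> f k"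
    by (auto simp: reproducing_element_def)
  note kh = dirichletD(1)[OF kD]
  have K: "mu_kernel \<mu> z z = of_real (energy k)" "disc_value k z = of_real (energy k)"
    using rep[OF kD] by (simp_all add: mu_kernel_def k_def[symmetric] mu_inner_self[OF kh])
  have ineq: "0 \<le> energy f + (norm s)\<^sup>2 * energy k + 2 * Re (s * cnj (disc_value f z))"
    if f: "f \<in> dirichlet_space \<mu>" for f s
    using energy_nonneg[of "\<lambda>w. f w + s * k w"] energy_add_scale[OF dirichletD(1)[OF f] kh, of s]
      rep[OF f] mu_inner_commute[OF dirichletD(1)[OF f] kh] by simp
  have pos: "0 < energy k"
  proof (rule ccontr)
    assume "\<not> 0 < energy k"
    then have 0: "energy k = 0" using energy_nonneg[of k] by linarith
    \<comment> \<open>If k had energy 0, the nonnegative energy of 1 + s k would be affine in s;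
      this value of s makes it negative.\<close>
    show False
      using ineq[OF const_in_dirichlet[of 1], of "- of_real (energy (\<lambda>_. 1) + 1)"] energy_nonneg[of "\<lambda>_. 1"]
      by (simp add: 0 disc_value_const[OF z])
  qed
  then show "0 < Re (mu_kernel \<mu> z z)" by (simp add: K)
  show "(norm (disc_value f z))\<^sup>2 \<le> Re (mu_kernel \<mu> z z) * energy f" if f: "f \<in> dirichlet_space \<mu>" for f
  proof -
    \<comment> \<open>This s minimises the energy of f + s k, which gives Cauchy-Schwarz in its
      sharp form.\<close>
    let ?v = "disc_value f z" and ?s = "- (disc_value f z / of_real (energy k))"
    have "?s * cnj ?v = of_real (- (norm ?v)\<^sup>2 / energy k)"
      by (simp add: complex_norm_square del: of_real_power)
    then have e1: "Re (?s * cnj ?v) = - (norm ?v)\<^sup>2 / energy k"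
      by (simp only: Re_complex_of_real)
    have e2: "(norm ?s)\<^sup>2 * energy k = (norm ?v)\<^sup>2 / energy k"
      using pos by (simp add: norm_divide power_divide power2_eq_square)
    have "0 \<le> energy f - (norm ?v)\<^sup>2 / energy k"
      using ineq[OF f, of ?s] unfolding e1 e2 by simp
    then show ?thesis using pos by (simp add: K field_simps)
  qed
  show "\<exists>g\<in>dirichlet_space \<mu>. disc_value g z = 1 \<and> energy g = 1 / Re (mu_kernel \<mu> z z)"
  proof (rule bexI[OF _ dirichlet_scale[OF kD]])
    let ?g = "\<lambda>w. of_real (1 / energy k) * k w"
    show "disc_value ?g z = 1 \<and> energy ?g = 1 / Re (mu_kernel \<mu> z z)"
      using pos unfolding disc_value_scale[OF z] energy_scale[OF kh]
      by (simp add: K norm_divide power_divide) (simp add: power2_eq_square)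
  qed
qed

end

section \<open>Analytic functions and their real parts\<close>

lemma fourier_coeff_power: "fourier_coeff (\<lambda>w. w ^ n) k = (if k = int n then 1 else 0)"
proof -
  have "fourier_coeff (\<lambda>w. w ^ n) k = (LINT w|circle_measure. w powi (int n - k))"
    unfolding fourier_coeff_def
  proof (intro Bochner_Integration.integral_cong refl)
    fix w assume "w \<in> space circle_measure"
    then have "w \<noteq> 0" by auto
    then show "w ^ n * w powi (- k) = w powi (int n - k)"
      by (simp add: power_int_diff power_int_minus divide_inverse)
  qed
  then show ?thesis by (auto simp: integral_circle_powi)
qed

lemma integral_circle_power: "0 < n \<Longrightarrow> (LINT w|circle_measure. w ^ n) = 0"
  using integral_circle_powi[of "int n"] by simp

text \<open>The weight n is what the difference quotients require: the n-th term of
  \<open>quot\<close> is bounded on the circle by n |d n|. Coefficients damped by \<rho>^n with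
  \<rho> < 1 satisfy this.\<close>

locale analytic_series =
  fixes d :: "nat \<Rightarrow> complex"
  assumes summable_deriv: "summable (\<lambda>n. real n * norm (d n))"
begin

definition val :: "complex \<Rightarrow> complex" where
  "val w = (\<Sum>n. d n * w ^ n)"

lemma summable_norm_d: "summable (\<lambda>n. norm (d n))"
proof (rule summable_comparison_test'[OF summable_deriv, of 1])
  fix n :: nat assume "1 \<le> n"
  then show "norm (norm (d n)) \<le> real n * norm (d n)"
    using mult_right_mono[of 1 "real n" "norm (d n)"] by simp
qed

lemma norm_term_le: "norm w \<le> 1 \<Longrightarrow> norm (d n * w ^ n) \<le> norm (d n)"
  using mult_left_mono[of "norm w ^ n" 1 "norm (d n)"] by (simp add: norm_mult norm_power power_le_one)

lemma summable_val: "norm w \<le> 1 \<Longrightarrow> summable (\<lambda>n. d n * w ^ n)"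
  by (rule summable_comparison_test'[OF summable_norm_d]) (rule norm_term_le)

lemma measurable_val [measurable]: "val \<in> borel_measurable circle_borel"
  unfolding val_def by measurable

lemma norm_val_le: "norm w \<le> 1 \<Longrightarrow> norm (val w) \<le> (\<Sum>n. norm (d n))"
  unfolding val_def using norm_term_le
  by (intro order_trans[OF summable_norm suminf_le] summable_norm_d summable_comparison_test'[OF summable_norm_d]) auto

lemma integral_val_times:
  assumes f: "integrable circle_measure f"
  shows "(LINT w|circle_measure. val w * f w) = (\<Sum>n. d n * (LINT w|circle_measure. w ^ n * f w))"
proof -
  have "(LINT w|circle_measure. val w * f w) = (\<Sum>n. LINT w|circle_measure. (d n * w ^ n) * f w)"
    unfolding val_def
    by (rule integral_circle_suminf(1)[OF f _ _ summable_norm_d]) (measurable, simp add: norm_term_le)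
  then show ?thesis by (simp add: mult.assoc)
qed

lemma fourier_coeff_val: "fourier_coeff val k = (if k < 0 then 0 else d (nat k))"
proof -
  have "integrable circle_measure (\<lambda>w. w powi (- k))"
    by (rule integrable_circle_bounded[where B=1]) (simp_all add: norm_power_int)
  then have "fourier_coeff val k = (\<Sum>n. d n * fourier_coeff (\<lambda>w. w ^ n) k)"
    unfolding fourier_coeff_def by (rule integral_val_times)
  also have "\<dots> = (\<Sum>n. if n = nat k \<and> 0 \<le> k then d n else 0)"
    by (intro suminf_cong) (auto simp: fourier_coeff_power)
  also have "\<dots> = (if k < 0 then 0 else d (nat k))"
    using suminf_finite[of "{nat k}" "\<lambda>n. if n = nat k \<and> 0 \<le> k then d n else 0"] by auto
  finally show ?thesis .
qed

lemma integrable_val_times: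
  assumes "\<And>w. norm w = 1 \<Longrightarrow> norm (f w) \<le> B" and [measurable]: "f \<in> borel_measurable circle_borel"
  shows "integrable circle_measure (\<lambda>w. val w * f w)"
proof (rule integrable_circle_bounded[where B="(\<Sum>n. norm (d n)) * B"])
  have s: "0 \<le> (\<Sum>n. norm (d n))" by (intro suminf_nonneg summable_norm_d) simp
  fix w :: complex assume w: "norm w = 1"
  show "norm (val w * f w) \<le> (\<Sum>n. norm (d n)) * B"
    unfolding norm_mult using w norm_val_le[of w] assms(1)[OF w] s by (intro mult_mono) auto
qed measurable

lemma integrable_val: "integrable circle_measure val"
  using integrable_val_times[of "\<lambda>_. 1" 1] by simp

lemma val_L2: "val \<in> L2_circle"
proof -
  have "integrable circle_measure (\<lambda>w. (norm (val w))\<^sup>2)"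
    using norm_val_le
    by (intro integrable_circle_bounded[where B="(\<Sum>n. norm (d n))\<^sup>2"]) (auto intro!: power_mono)
  then show ?thesis
    unfolding L2_circle_def by (simp add: integrable_iff_bounded)
qed

lemma val_hardy: "val \<in> hardy_space"
  by (simp add: hardy_space_def val_L2 fourier_coeff_val)

lemma disc_value_val: "disc_value val z = val z"
  by (simp add: disc_value_def val_def fourier_coeff_val)

text \<open>A function with no negative frequencies: only the constant terms pair up, so the mean of
  the square is the square of the mean.\<close>

lemma integral_val_square: "(LINT w|circle_measure. val w * val w) = (d 0)\<^sup>2"
proof -
  have "(LINT w|circle_measure. w ^ n * val w) = fourier_coeff val (- int n)" for n
    by (simp add: fourier_coeff_def mult.commute)
  then have "(LINT w|circle_measure. val w * val w) = (\<Sum>n. if n = 0 then (d 0)\<^sup>2 else 0)"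
    unfolding integral_val_times[OF integrable_val]
    by (intro suminf_cong) (auto simp: fourier_coeff_val power2_eq_square)
  also have "\<dots> = (d 0)\<^sup>2" using suminf_finite[of "{0::nat}" "\<lambda>n. if n = 0 then (d 0)\<^sup>2 else 0"] by simp
  finally show ?thesis .
qed

text \<open>The quotient (w^n - \<xi>^n) / (w - \<xi>) as a polynomial in w; summed against d it
  makes \<open>quot\<close> the analytic difference quotient of \<open>val\<close> at \<xi>.\<close>

definition quot_term :: "complex \<Rightarrow> nat \<Rightarrow> complex \<Rightarrow> complex" where
  "quot_term \<xi> n w = (\<Sum>k<n. \<xi> ^ (n - Suc k) * w ^ k)"

definition quot :: "complex \<Rightarrow> complex \<Rightarrow> complex" where
  "quot \<xi> w = (\<Sum>n. d n * quot_term \<xi> n w)"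

lemma measurable_quot_term [measurable]: "quot_term \<xi> n \<in> borel_measurable circle_borel"
  unfolding quot_term_def by measurable

lemma measurable_quot [measurable]: "quot \<xi> \<in> borel_measurable circle_borel"
  unfolding quot_def by measurable

lemma norm_quot_term_le:
  assumes "norm \<xi> = 1" "norm w = 1"
  shows "norm (d n * quot_term \<xi> n w) \<le> real n * norm (d n)"
proof -
  have "norm (quot_term \<xi> n w) \<le> real n"
    unfolding quot_term_def using assms
    by (intro order_trans[OF sum_norm_le[where g="\<lambda>_. 1"]]) (auto simp: norm_mult norm_power)
  then show ?thesis
    using mult_left_mono[of "norm (quot_term \<xi> n w)" "real n" "norm (d n)"] by (simp add: norm_mult mult.commute)
qed

lemma norm_quot_le:
  assumes "norm \<xi> = 1" "norm w = 1"
  shows "norm (quot \<xi> w) \<le> (\<Sum>n. real n * norm (d n))"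
  unfolding quot_def using norm_quot_term_le[OF assms]
  by (intro order_trans[OF summable_norm suminf_le] summable_deriv summable_comparison_test'[OF summable_deriv]) auto

lemma val_diff_eq:
  assumes "norm \<xi> = 1" "norm w = 1"
  shows "val w - val \<xi> = (w - \<xi>) * quot \<xi> w"
proof -
  have s: "summable (\<lambda>n. d n * quot_term \<xi> n w)"
    by (rule summable_comparison_test'[OF summable_deriv]) (rule norm_quot_term_le[OF assms])
  have "val w - val \<xi> = (\<Sum>n. d n * w ^ n - d n * \<xi> ^ n)"
    unfolding val_def using assms by (intro suminf_diff summable_val) auto
  also have "\<dots> = (\<Sum>n. (w - \<xi>) * (d n * quot_term \<xi> n w))"
    unfolding quot_term_def right_diff_distrib[symmetric] power_diff_sumr2 by (simp add: mult_ac)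
  also have "\<dots> = (w - \<xi>) * quot \<xi> w"
    unfolding quot_def using s by (rule suminf_mult)
  finally show ?thesis .
qed

lemma integral_quot_times:
  assumes "norm \<xi> = 1" and f: "integrable circle_measure f"
  shows "(LINT w|circle_measure. quot \<xi> w * f w) = (\<Sum>n. d n * (LINT w|circle_measure. quot_term \<xi> n w * f w))"
proof -
  have "(LINT w|circle_measure. quot \<xi> w * f w) = (\<Sum>n. LINT w|circle_measure. (d n * quot_term \<xi> n w) * f w)"
    unfolding quot_def
    by (rule integral_circle_suminf(1)[OF f _ _ summable_deriv]) (measurable, simp add: norm_quot_term_le assms)
  then show ?thesis by (simp add: mult.assoc)
qed

lemma integral_quot_term_times:
  assumes "\<And>k. integrable circle_measure (\<lambda>w. w ^ k * f w)"
  shows "(LINT w|circle_measure. quot_term \<xi> n w * f w) =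
    (\<Sum>k<n. \<xi> ^ (n - Suc k) * (LINT w|circle_measure. w ^ k * f w))"
  unfolding quot_term_def sum_distrib_right mult.assoc using assms
  by (subst Bochner_Integration.integral_sum) auto

lemma integrable_power_bounded:
  assumes "\<And>w. norm w = 1 \<Longrightarrow> norm (f w) \<le> B" and [measurable]: "f \<in> borel_measurable circle_borel"
  shows "integrable circle_measure (\<lambda>w. w ^ k * f w)"
  by (rule integrable_circle_bounded[where B=B]) (use assms in \<open>auto simp: norm_mult norm_power\<close>)

text \<open>Every monomial of \<open>quot_term\<close> times w^(j + 1) has a positive exponent and
  hence mean zero.\<close>

lemma integral_power_quot:
  assumes \<xi>: "norm \<xi> = 1"
  shows "(LINT w|circle_measure. quot \<xi> w * w ^ Suc j) = 0"
proof -
  have i: "integrable circle_measure (\<lambda>w. w ^ k * w ^ Suc j)" for k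
    by (rule integrable_power_bounded[where B=1]) (auto simp: norm_mult norm_power)
  have "(LINT w|circle_measure. quot_term \<xi> n w * w ^ Suc j) = 0" for n
    unfolding integral_quot_term_times[OF i] by (simp add: integral_circle_power flip: power_add power_Suc)
  then show ?thesis
    using integral_quot_times[OF \<xi>, of "\<lambda>w. w ^ Suc j"] i[of 0] by simp
qed

text \<open>Only one of the two factors \<open>quot\<close> is expanded; each of its monomials w^k
  meets w times the other factor, which is the case of \<open>integral_power_quot\<close>.\<close>

lemma integral_quot_square:
  assumes \<xi>: "norm \<xi> = 1"
  shows "(LINT w|circle_measure. w * (quot \<xi> w)\<^sup>2) = 0"
proof -
  have b: "norm (w * quot \<xi> w) \<le> (\<Sum>n. real n * norm (d n))" if "norm w = 1" for w
    using norm_quot_le[OF \<xi> that] that by (simp add: norm_mult)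
  have i: "integrable circle_measure (\<lambda>w. w ^ k * (w * quot \<xi> w))" for k
    by (rule integrable_power_bounded[OF b]) auto
  have "(LINT w|circle_measure. w ^ k * (w * quot \<xi> w)) = 0" for k
    using integral_power_quot[OF \<xi>, of k] by (simp add: mult_ac)
  then have "(LINT w|circle_measure. quot_term \<xi> n w * (w * quot \<xi> w)) = 0" for n
    unfolding integral_quot_term_times[OF i] by simp
  then have "(LINT w|circle_measure. quot \<xi> w * (w * quot \<xi> w)) = 0"
    using integral_quot_times[OF \<xi>, of "\<lambda>w. w * quot \<xi> w"] i[of 0] by simp
  then show ?thesis by (simp add: power2_eq_square mult_ac)
qed

section \<open>Comparison of an analytic function with its real part\<close>

lemma two_Re_square: "(2 * Re x)\<^sup>2 = 2 * (norm x)\<^sup>2 + 2 * Re (x\<^sup>2)"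
  by (simp only: cmod_power2) (simp add: power2_eq_square algebra_simps)

text \<open>By \<open>two_Re_square\<close> the norm of 2 Re p contains the mean of Re (p^2), which
  is Re ((d 0)^2). It is nonnegative because d 0 is real; an imaginary constant would violate the
  claim.\<close>

lemma circle_norm_sq_val_le:
  assumes d0: "d 0 \<in> \<real>"
  shows "circle_norm_sq val \<le> circle_norm_sq (\<lambda>w. of_real (2 * Re (val w)))"
proof -
  have i1: "integrable circle_measure (\<lambda>w. val w * val w)"
    using norm_val_le by (intro integrable_val_times[where B="\<Sum>n. norm (d n)"]) auto
  have i2: "integrable circle_measure (\<lambda>w. (norm (val w))\<^sup>2)"
    using integrable_norm[OF i1] by (simp add: norm_mult power2_eq_square)
  have i3: "integrable circle_measure (\<lambda>w. Re ((val w)\<^sup>2))"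
    using integrable_Re[OF i1] by (simp only: power2_eq_square)
  have "(LINT w|circle_measure. Re ((val w)\<^sup>2)) = Re ((d 0)\<^sup>2)"
    using integral_Re[OF i1] integral_val_square by (simp only: power2_eq_square)
  then have nn: "0 \<le> (LINT w|circle_measure. Re ((val w)\<^sup>2))"
    using d0 by (auto elim!: Reals_cases)
  have e: "(norm (complex_of_real (2 * Re (val w))))\<^sup>2 = 2 * (norm (val w))\<^sup>2 + 2 * Re ((val w)\<^sup>2)" for w
    using two_Re_square[of "val w"] by (simp only: norm_of_real power2_abs)
  have "circle_norm_sq (\<lambda>w. of_real (2 * Re (val w))) = ennreal (LINT w|circle_measure. (norm (complex_of_real (2 * Re (val w))))\<^sup>2)"
    by (rule nn_integral_eq_integral) (unfold e, use i2 i3 in simp, unfold e[symmetric], simp)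
  also have "(LINT w|circle_measure. (norm (complex_of_real (2 * Re (val w))))\<^sup>2) =
      2 * (LINT w|circle_measure. (norm (val w))\<^sup>2) + 2 * (LINT w|circle_measure. Re ((val w)\<^sup>2))"
    unfolding e using i2 i3 by simp
  also have "ennreal \<dots> \<ge> ennreal (LINT w|circle_measure. (norm (val w))\<^sup>2)"
    using nn integral_nonneg_AE[where M=circle_measure and f="\<lambda>w. (norm (val w))\<^sup>2"] by (intro ennreal_leI) simp
  moreover have "circle_norm_sq val = ennreal (LINT w|circle_measure. (norm (val w))\<^sup>2)"
    by (rule nn_integral_eq_integral[OF i2]) simp
  ultimately show ?thesis by (simp only:)
qed

text \<open>
  On the circle \<open>|w - \<xi>|\<^sup>2 = - (w - \<xi>)\<^sup>2 / (w \<xi>)\<close>, so \<open>(p(w) - p(\<xi>))\<^sup>2 / |w - \<xi>|\<^sup>2 = - \<xi> w q(w)\<^sup>2\<close> with \<open>q\<close> analytic,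
  which has mean zero; hence the local energy of \<open>2 Re p\<close> is twice that of \<open>p\<close>.
\<close>

lemma local_energy_val_le:
  assumes \<xi>: "norm \<xi> = 1"
  shows "local_energy val (val \<xi>) \<xi> \<le> local_energy (\<lambda>w. of_real (2 * Re (val w))) (of_real (2 * Re (val \<xi>))) \<xi>"
proof -
  let ?q = "quot \<xi>" and ?B = "\<Sum>n. real n * norm (d n)"
  let ?N = "\<lambda>w. (norm (complex_of_real (2 * Re (val w)) - of_real (2 * Re (val \<xi>))))\<^sup>2" and ?R = "\<lambda>w. 2 * (norm (?q w))\<^sup>2 + 2 * Re (- \<xi> * (w * (?q w)\<^sup>2))"
  have i1: "integrable circle_measure (\<lambda>w. - \<xi> * (w * (?q w)\<^sup>2))"
    using norm_quot_le[OF \<xi>] \<xi>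
    by (intro integrable_circle_bounded[where B="?B\<^sup>2"]) (auto simp: norm_mult norm_power intro!: power_mono)
  have i2: "integrable circle_measure (\<lambda>w. (norm (?q w))\<^sup>2)"
    using norm_quot_le[OF \<xi>]
    by (intro integrable_circle_bounded[where B="?B\<^sup>2"]) (auto intro!: power_mono)
  have z: "(LINT w|circle_measure. Re (- \<xi> * (w * (?q w)\<^sup>2))) = 0"
    using i1 integral_quot_square[OF \<xi>] by (subst integral_Re[OF i1]) simp
  have e: "?N w / (norm (w - \<xi>))\<^sup>2 =
      ?R w" if w: "norm w = 1" "w \<noteq> \<xi>" for w
  proof -
    have ne: "w \<noteq> 0" "\<xi> \<noteq> 0" "w - \<xi> \<noteq> 0" using w \<xi> by auto
    have "complex_of_real (2 * Re (val w)) - of_real (2 * Re (val \<xi>)) = of_real (2 * Re ((w - \<xi>) * ?q w))"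
      unfolding val_diff_eq[OF \<xi> w(1), symmetric] by simp
    then have "?N w = (2 * Re ((w - \<xi>) * ?q w))\<^sup>2"
      by (simp only: norm_of_real power2_abs)
    also have "\<dots> = 2 * (norm (w - \<xi>))\<^sup>2 * (norm (?q w))\<^sup>2 + 2 * Re (((w - \<xi>) * ?q w)\<^sup>2)"
      unfolding two_Re_square by (simp add: norm_mult power_mult_distrib)
    also have "((w - \<xi>) * ?q w)\<^sup>2 = of_real ((norm (w - \<xi>))\<^sup>2) * (- \<xi> * (w * (?q w)\<^sup>2))"
    proof -
      have "of_real ((norm (w - \<xi>))\<^sup>2) = (w - \<xi>) * (inverse w - inverse \<xi>)"
        unfolding complex_norm_square using w \<xi> by (simp add: cnj_circle)
      then have "of_real ((norm (w - \<xi>))\<^sup>2) * (- \<xi> * w) = (w - \<xi>)\<^sup>2"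
        using ne by (simp add: field_simps power2_eq_square)
      then show ?thesis by (simp only: power_mult_distrib mult.assoc[symmetric])
    qed
    also have "Re \<dots> = (norm (w - \<xi>))\<^sup>2 * Re (- \<xi> * (w * (?q w)\<^sup>2))"
      by (simp only: Re_complex_of_real Im_complex_of_real times_complex.sel)
    finally show ?thesis using ne by (simp add: field_simps)
  qed
  have "local_energy (\<lambda>w. of_real (2 * Re (val w))) (of_real (2 * Re (val \<xi>))) \<xi> =
      (\<integral>\<^sup>+ w. ennreal (?R w) \<partial>circle_measure)"
    unfolding local_energy_def
  proof (rule nn_integral_cong_AE)
    show "AE w in circle_measure. ennreal (?N w / (norm (w - \<xi>))\<^sup>2) =
        ennreal (?R w)"
      using AE_circle_neq[OF \<xi>] AE_space
    proof eventually_elim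
      fix w assume "w \<noteq> \<xi>" "w \<in> space circle_measure"
      then show "ennreal (?N w / (norm (w - \<xi>))\<^sup>2) =
          ennreal (?R w)"
        by (subst e) auto
    qed
  qed
  also have "\<dots> = ennreal (LINT w|circle_measure. ?R w)"
  proof (rule nn_integral_eq_integral)
    show "integrable circle_measure (\<lambda>w. ?R w)"
      using i2 integrable_Re[OF i1] by (intro Bochner_Integration.integrable_add integrable_mult_right)
    show "AE w in circle_measure. 0 \<le> ?R w"
      using AE_circle_neq[OF \<xi>] AE_space
    proof eventually_elim
      fix w assume "w \<noteq> \<xi>" "w \<in> space circle_measure"
      then show "0 \<le> ?R w"
        by (subst e[symmetric]) auto
    qed
  qed
  also have "(LINT w|circle_measure. ?R w) =
      2 * (LINT w|circle_measure. (norm (?q w))\<^sup>2) + 2 * (LINT w|circle_measure. Re (- \<xi> * (w * (?q w)\<^sup>2)))"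
    using i2 integrable_Re[OF i1]
    by (subst Bochner_Integration.integral_add) (auto simp del: minus_mult_left[symmetric] uminus_complex.sel times_complex.sel)
  also have "\<dots> = 2 * (LINT w|circle_measure. (norm (?q w))\<^sup>2)" unfolding z by simp
  finally have 1: "local_energy (\<lambda>w. of_real (2 * Re (val w))) (of_real (2 * Re (val \<xi>))) \<xi> =
      ennreal (2 * (LINT w|circle_measure. (norm (?q w))\<^sup>2))" .
  have "local_energy val (val \<xi>) \<xi> = (\<integral>\<^sup>+ w. ennreal ((norm (?q w))\<^sup>2) \<partial>circle_measure)"
    unfolding local_energy_def
  proof (rule nn_integral_cong_AE)
    show "AE w in circle_measure. ennreal ((norm (val w - val \<xi>))\<^sup>2 / (norm (w - \<xi>))\<^sup>2) = ennreal ((norm (?q w))\<^sup>2)"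
      using AE_circle_neq[OF \<xi>] AE_space
      by eventually_elim (simp add: val_diff_eq[OF \<xi>] norm_mult power_mult_distrib)
  qed
  also have "\<dots> = ennreal (LINT w|circle_measure. (norm (?q w))\<^sup>2)"
    by (rule nn_integral_eq_integral[OF i2]) simp
  finally show ?thesis
    unfolding 1 using integral_nonneg_AE[where M=circle_measure and f="\<lambda>w. (norm (?q w))\<^sup>2"] by (auto intro!: ennreal_leI)
qed

end

section \<open>Capacity of arcs\<close>

lemma local_dirichlet_integral_scale_le:
  assumes f: "f \<in> L2_circle" and \<xi>: "norm \<xi> = 1"
  shows "local_dirichlet_integral (\<lambda>w. c * f w) \<xi> \<le> ennreal ((norm c)\<^sup>2) * local_dirichlet_integral f \<xi>"
  unfolding local_dirichlet_integral_eq[OF f \<xi>] local_energy_scale[OF L2_circle_measurable[OF f], symmetric]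
  by (rule local_dirichlet_integral_le[OF L2_circle_scale[OF f] \<xi>])

lemma norm_L2:
  assumes f: "f \<in> L2_circle"
  shows "(\<lambda>w. complex_of_real (norm (f w))) \<in> L2_circle"
proof -
  note [measurable] = L2_circle_measurable[OF f]
  show ?thesis using L2_circle_finite[OF f] by (simp add: L2_circle_def)
qed

text \<open>Taking the modulus is a contraction: test |f| with the constant |a|, where a is the
  value of f at \<xi>, and use the reverse triangle inequality.\<close>

lemma local_dirichlet_integral_norm_le:
  assumes f: "f \<in> L2_circle" and \<xi>: "norm \<xi> = 1"
  shows "local_dirichlet_integral (\<lambda>w. complex_of_real (norm (f w))) \<xi> \<le> local_dirichlet_integral f \<xi>"
proof -
  let ?a = "radial_value f \<xi>"
  have "local_dirichlet_integral (\<lambda>w. complex_of_real (norm (f w))) \<xi> \<le>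
      local_energy (\<lambda>w. complex_of_real (norm (f w))) (of_real (norm ?a)) \<xi>"
    by (rule local_dirichlet_integral_le[OF norm_L2[OF f] \<xi>])
  also have "\<dots> \<le> local_energy f ?a \<xi>"
    unfolding local_energy_def
  proof (intro nn_integral_mono ennreal_leI divide_right_mono)
    fix w
    have "norm (complex_of_real (norm (f w)) - of_real (norm ?a)) \<le> norm (f w - ?a)"
      using norm_triangle_ineq3[of "f w" ?a] by (simp flip: of_real_diff)
    then show "(norm (complex_of_real (norm (f w)) - of_real (norm ?a)))\<^sup>2 \<le> (norm (f w - ?a))\<^sup>2"
      by (rule power_mono) simp
  qed simp
  finally show ?thesis unfolding local_dirichlet_integral_eq[OF f \<xi>] .
qed

lemma poisson_integral_of_real:
  "poisson_integral (\<lambda>w. complex_of_real (h w)) z = of_real (LINT w|circle_measure. poisson_kernel z w * h w)"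
  unfolding poisson_integral_eq by (simp add: scaleR_conv_of_real flip: of_real_mult)

text \<open>The two interior points are at distance at most (1 - \<rho>) / 2, which is at most half
  the distance of v to either of them. So the distances to v differ by a factor at most 3/2, and the
  kernels by at most 9/4.\<close>

lemma poisson_kernel_harnack:
  assumes \<rho>: "0 \<le> \<rho>" "\<rho> < 1" and \<zeta>: "norm \<zeta> = 1" and w: "norm w = 1" "norm (w - \<zeta>) \<le> (1 - \<rho>) / 2"
    and v: "norm v = 1"
  shows "(4/9) * poisson_kernel (of_real \<rho> * \<zeta>) v \<le> poisson_kernel (of_real \<rho> * w) v"
proof -
  let ?A = "norm (v - of_real \<rho> * w)" and ?B = "norm (v - of_real \<rho> * \<zeta>)"
  have A: "1 - \<rho> \<le> ?A" and B: "1 - \<rho> \<le> ?B"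
    using norm_circle_diff_ge[OF v] \<rho> \<zeta> w by (metis abs_of_nonneg mult_cancel_left2 norm_mult norm_of_real mult.right_neutral)+
  have "?A \<le> ?B + norm (of_real \<rho> * \<zeta> - of_real \<rho> * w)"
    using norm_triangle_ineq[of "v - of_real \<rho> * \<zeta>" "of_real \<rho> * \<zeta> - of_real \<rho> * w"] by simp
  moreover have "norm (of_real \<rho> * \<zeta> - of_real \<rho> * w) \<le> (1 - \<rho>) / 2"
  proof -
    have "norm (of_real \<rho> * \<zeta> - of_real \<rho> * w) = \<rho> * norm (w - \<zeta>)"
      using \<rho> by (simp add: norm_mult norm_minus_commute flip: right_diff_distrib)
    also have "\<dots> \<le> 1 * ((1 - \<rho>) / 2)" using \<rho> w by (intro mult_mono) auto
    finally show ?thesis by simp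
  qed
  moreover have "a \<le> (3/2) * b" if "a \<le> b + x" "x \<le> (1 - \<rho>) / 2" "1 - \<rho> \<le> b" for a b x :: real
    using that by argo
  ultimately have "?A \<le> (3/2) * ?B" using B by blast
  then have "?A\<^sup>2 \<le> (9/4) * ?B\<^sup>2"
    using power_mono[of ?A "(3/2) * ?B" 2] by (simp add: power_mult_distrib power_divide)
  moreover have "0 < ?A" "0 < ?B" using A B \<rho> by linarith+
  ultimately have "(4/9) * (1 / ?B\<^sup>2) \<le> 1 / ?A\<^sup>2" by (simp add: field_simps)
  then have "(1 - \<rho>\<^sup>2) * ((4/9) * (1 / ?B\<^sup>2)) \<le> (1 - \<rho>\<^sup>2) * (1 / ?A\<^sup>2)"
    using \<rho> by (intro mult_left_mono) (auto simp: power_le_one)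
  then show ?thesis using \<rho> \<zeta> w by (simp add: poisson_kernel_def norm_mult mult.commute)
qed

text \<open>The radius \<rho>^2 is that of a dilation by \<rho> evaluated at \<rho> \<zeta>. Points
  of the arc are within (5/2) (1 - \<rho>) of it and the numerator 1 - \<rho>^4 is at least 1 -
  \<rho>, so the kernel is at least 4 / (25 (1 - \<rho>)) there; the arc has measure at least (1 -
  \<rho>) / (4 pi).\<close>

lemma poisson_integral_open_arc_ge:
  fixes u :: "complex \<Rightarrow> real"
  assumes u: "integrable circle_measure u" "AE w in circle_measure. 0 \<le> u w"
    "AE w in circle_measure. w \<in> open_arc \<zeta> (1 - \<rho>) \<longrightarrow> 1 \<le> u w"
    and \<rho>: "0 \<le> \<rho>" "\<rho> < 1" and \<zeta>: "norm \<zeta> = 1"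
  shows "1 / (25 * pi) \<le> (LINT w|circle_measure. poisson_kernel (of_real (\<rho>\<^sup>2) * \<zeta>) w * u w)"
proof -
  let ?z = "of_real (\<rho>\<^sup>2) * \<zeta>" and ?I = "open_arc \<zeta> (1 - \<rho>)"
  have z: "norm ?z < 1" "norm ?z = \<rho>\<^sup>2" using \<rho> \<zeta> by (auto simp: norm_mult norm_power abs_square_less_1)
  have I[measurable]: "?I \<in> sets circle_borel" using \<rho> \<zeta> by (intro open_arc_sets) auto
  have P: "4 / (25 * (1 - \<rho>)) \<le> poisson_kernel ?z w" if w: "w \<in> ?I" for w
  proof -
    have w1: "norm w = 1" using w \<zeta> by (auto simp: open_arc_def norm_mult)
    have "norm (w - ?z) \<le> norm (w - \<zeta>) + norm (\<zeta> - ?z)"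
      using norm_triangle_ineq[of "w - \<zeta>" "\<zeta> - ?z"] by simp
    moreover have "norm (w - \<zeta>) \<le> (1 - \<rho>) / 2" by (rule norm_open_arc_diff[OF \<zeta> w])
    moreover have "norm (\<zeta> - ?z) = 1 - \<rho>\<^sup>2"
    proof -
      have "\<zeta> - ?z = of_real (1 - \<rho>\<^sup>2) * \<zeta>" by (simp add: algebra_simps)
      then show ?thesis using \<zeta> \<rho> by (simp add: norm_mult power_le_one del: of_real_diff of_real_power)
    qed
    moreover have "1 - \<rho>\<^sup>2 \<le> 2 * (1 - \<rho>)" by (rule one_minus_square_le[OF \<rho>])
    ultimately have "norm (w - ?z) \<le> 5/2 * (1 - \<rho>)" by linarith
    then have "(norm (w - ?z))\<^sup>2 \<le> 25/4 * (1 - \<rho>)\<^sup>2"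
      using power_mono[of "norm (w - ?z)" "5/2 * (1 - \<rho>)" 2]
      by (simp only: power_mult_distrib power_divide norm_ge_zero) simp
    moreover have "0 < norm (w - ?z)"
      using norm_circle_diff_ge[OF w1, of ?z] z by linarith
    moreover have r4: "1 - \<rho> \<le> 1 - (\<rho>\<^sup>2)\<^sup>2"
    proof -
      have "(\<rho>\<^sup>2)\<^sup>2 = \<rho> * \<rho> ^ 3" by (simp add: eval_nat_numeral)
      also have "\<dots> \<le> \<rho> * 1" using \<rho> by (intro mult_left_mono power_le_one) auto
      finally show ?thesis by simp
    qed
    ultimately have "(1 - \<rho>) / (25/4 * (1 - \<rho>)\<^sup>2) \<le> (1 - (\<rho>\<^sup>2)\<^sup>2) / (norm (w - ?z))\<^sup>2"
      using \<rho> by (intro frac_le) auto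
    moreover have "(1 - \<rho>) / (25/4 * (1 - \<rho>)\<^sup>2) = 4 / (25 * (1 - \<rho>))"
    proof -
      have "(1 - \<rho>) / (25/4 * (1 - \<rho>)\<^sup>2) = (1 - \<rho>) / ((1 - \<rho>) * (25/4 * (1 - \<rho>)))"
        by (simp add: power2_eq_square)
      also have "\<dots> = 1 / (25/4 * (1 - \<rho>))" using \<rho> by (subst nonzero_divide_mult_cancel_left) auto
      finally show ?thesis by simp
    qed
    ultimately show ?thesis unfolding poisson_kernel_def z(2) by simp
  qed
  have m: "(1 - \<rho>) / (4 * pi) \<le> measure circle_measure ?I"
    using emeasure_open_arc_ge[OF \<zeta>, of "1 - \<rho>"] \<rho> by (simp add: circle.emeasure_eq_measure)
  have "1 / (25 * pi) = 4 / (25 * (1 - \<rho>)) * ((1 - \<rho>) / (4 * pi))" using \<rho> by (simp add: field_simps)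
  also have "\<dots> \<le> 4 / (25 * (1 - \<rho>)) * measure circle_measure ?I"
    using m \<rho> by (intro mult_left_mono) auto
  also have "\<dots> = (LINT w|circle_measure. 4 / (25 * (1 - \<rho>)) * indicator ?I w)"
    using sets.sets_into_space[OF I] by (simp add: Int_absorb2)
  also have "\<dots> \<le> (LINT w|circle_measure. poisson_kernel ?z w * u w)"
  proof (rule integral_mono_AE)
    show "integrable circle_measure (\<lambda>w. 4 / (25 * (1 - \<rho>)) * indicator ?I w)"
      by (intro integrable_mult_right) (simp add: circle.emeasure_eq_measure)
    show "integrable circle_measure (\<lambda>w. poisson_kernel ?z w * u w)"
      using integrable_poisson_kernel_times[OF u(1) z(1)] by simp
    show "AE w in circle_measure. 4 / (25 * (1 - \<rho>)) * indicator ?I w \<le> poisson_kernel ?z w * u w"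
      using u(2,3)
    proof eventually_elim
      fix w assume w: "0 \<le> u w" "w \<in> ?I \<longrightarrow> 1 \<le> u w"
      show "4 / (25 * (1 - \<rho>)) * indicator ?I w \<le> poisson_kernel ?z w * u w"
      proof (cases "w \<in> ?I")
        case True
        then show ?thesis
          using mult_mono[OF P[OF True], of 1 "u w"] w poisson_kernel_nonneg[of ?z w] z \<rho> by simp
      next
        case False
        then show ?thesis
          using w(1) poisson_kernel_nonneg[of ?z w] z(1) by simp
      qed
    qed
  qed
  finally show ?thesis .
qed

section \<open>The two bounds for the capacity of an arc\<close>

context finite_circle_measure
begin

text \<open>Turns bounds at each \<xi> into a bound of norms with the same constant for every
  \<mu>.\<close>

lemma mu_norm_sq_le:
  assumes f: "f \<in> L2_circle" and c: "circle_norm_sq g \<le> C * circle_norm_sq f"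
    and l: "\<And>\<xi>. norm \<xi> = 1 \<Longrightarrow> local_dirichlet_integral g \<xi> \<le> C * local_dirichlet_integral f \<xi>"
  shows "mu_norm_sq \<mu> g \<le> C * mu_norm_sq \<mu> f"
proof -
  note [measurable] = measurable_local_dirichlet_integral[OF f]
  have "dirichlet_integral \<mu> g \<le> (\<integral>\<^sup>+ \<xi>. C * local_dirichlet_integral f \<xi> \<partial>\<mu>)"
    unfolding dirichlet_integral_def using l by (intro nn_integral_mono) auto
  also have "\<dots> = C * dirichlet_integral \<mu> f"
    unfolding dirichlet_integral_def by (rule nn_integral_cmult) measurable
  finally show ?thesis
    unfolding mu_norm_sq_def distrib_left using c by (intro add_mono)
qed

text \<open>3119 is (9/4)^2 * 616 = 3118.5 rounded up: 616 from the dilation, 9/4 from Harnack's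
  inequality.\<close>

lemma mu_capacity_le:
  assumes \<rho>: "0 \<le> \<rho>" "\<rho> < 1" and \<zeta>: "norm \<zeta> = 1"
  shows "mu_capacity \<mu> (open_arc \<zeta> (1 - \<rho>)) \<le>
    ennreal (3119 / Re (mu_kernel \<mu> (of_real \<rho> * \<zeta>) (of_real \<rho> * \<zeta>)))"
proof -
  let ?z = "of_real \<rho> * \<zeta>"
  have z: "norm ?z < 1" using \<rho> \<zeta> by (simp add: norm_mult)
  obtain f where f: "f \<in> dirichlet_space \<mu>" "disc_value f ?z = 1" "energy f = 1 / Re (mu_kernel \<mu> ?z ?z)"
    using mu_kernel_attained[OF z] by blast
  note fL = dirichletD(3)[OF f(1)]
  let ?v = "\<lambda>w. complex_of_real (norm (f w))"
  have vL: "?v \<in> L2_circle" by (rule norm_L2[OF fL])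
  \<comment> \<open>The modulus makes the competitor nonnegative, and 9/4 undoes the loss 4/9 in
    \<open>poisson_kernel_harnack\<close>.\<close>
  define u where "u w = (9/4) * (LINT v|circle_measure. poisson_kernel (of_real \<rho> * w) v * norm (f v))" for w
  have ue: "(\<lambda>w. complex_of_real (u w)) = (\<lambda>w. of_real (9/4) * dilation \<rho> ?v w)"
    unfolding u_def dilation_def poisson_integral_of_real by (simp only: of_real_mult)
  have dL: "dilation \<rho> ?v \<in> L2_circle" by (rule dilation_L2[OF vL \<rho>])
  have le: "mu_norm_sq \<mu> (\<lambda>w. complex_of_real (u w)) \<le> ennreal 3119 * mu_norm_sq \<mu> f"
  proof (rule mu_norm_sq_le[OF fL])
    have "dilation \<rho> ?v \<in> borel_measurable circle_measure"
      using L2_circle_measurable[OF dL] by simp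
    from nn_integral_norm_square_scale[OF this, of "of_real (9/4)"]
    have "circle_norm_sq (\<lambda>w. complex_of_real (u w)) = ennreal ((norm (complex_of_real (9/4)))\<^sup>2) * circle_norm_sq (dilation \<rho> ?v)"
      unfolding fun_cong[OF ue] .
    also have "(norm (complex_of_real (9/4)))\<^sup>2 = 81/16"
      by (simp only: norm_of_real) (simp add: power2_eq_square)
    also have "ennreal (81/16) * circle_norm_sq (dilation \<rho> ?v) \<le> ennreal 3119 * circle_norm_sq ?v"
      by (intro mult_mono circle_norm_sq_dilation_le vL \<rho> ennreal_leI) auto
    finally show "circle_norm_sq (\<lambda>w. complex_of_real (u w)) \<le> ennreal 3119 * circle_norm_sq f" by simp
  next
    fix \<xi> :: complex assume \<xi>: "norm \<xi> = 1"
    have "local_dirichlet_integral (\<lambda>w. complex_of_real (u w)) \<xi> \<le> ennreal (81/16) * local_dirichlet_integral (dilation \<rho> ?v) \<xi>"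
      unfolding ue using local_dirichlet_integral_scale_le[OF dL \<xi>, of "of_real (9/4)"] by (simp add: power2_eq_square)
    also have "\<dots> \<le> ennreal (81/16) * (616 * local_dirichlet_integral f \<xi>)"
      by (intro mult_left_mono order_trans[OF local_dirichlet_integral_dilation_le[OF vL \<rho> \<xi>]]
          local_dirichlet_integral_norm_le fL \<xi>) auto
    also have "\<dots> = ennreal (81/16 * 616) * local_dirichlet_integral f \<xi>"
      by (subst ennreal_mult') (auto simp: mult.assoc)
    also have "\<dots> \<le> ennreal 3119 * local_dirichlet_integral f \<xi>"
      by (intro mult_right_mono ennreal_leI) auto
    finally show "local_dirichlet_integral (\<lambda>w. complex_of_real (u w)) \<xi> \<le> ennreal 3119 * local_dirichlet_integral f \<xi>" .
  qed
  have fin: "ennreal 3119 * mu_norm_sq \<mu> f < \<infinity>"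
    using harmonicD(4)[OF dirichletD(1)[OF f(1)]] by (simp add: ennreal_mult_less_top)
  have uL: "(\<lambda>w. complex_of_real (u w)) \<in> L2_circle"
    unfolding ue by (rule L2_circle_scale[OF dL])
  have uh: "(\<lambda>w. complex_of_real (u w)) \<in> harmonic_dirichlet_space \<mu>"
    using uL order.strict_trans1[OF le fin] by (simp add: harmonic_dirichlet_space_def)
  have wr: "norm (of_real \<rho> * w) \<le> 1" if "norm w = 1" for w :: complex
    using \<rho> that by (simp add: norm_mult)
  have u0: "0 \<le> u w" if "norm w = 1" for w
    unfolding u_def using poisson_kernel_nonneg[OF wr[OF that]] by (intro mult_nonneg_nonneg integral_nonneg_AE) auto
  have in_f: "integrable circle_measure (\<lambda>v. norm (f v))" using L2_circle_integrable[OF fL] by simp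
  have u1: "1 \<le> u w" if w: "w \<in> open_arc \<zeta> (1 - \<rho>)" for w
  proof -
    have w1: "norm w = 1" using w \<zeta> by (auto simp: open_arc_def norm_mult)
    have wz: "norm (of_real \<rho> * w) < 1" using \<rho> w1 by (simp add: norm_mult)
    have "1 = norm (poisson_integral f ?z)"
      using poisson_integral_hardy[OF dirichletD(2)[OF f(1)] L2_circle_integrable[OF fL] z] f(2) by simp
    also have "\<dots> \<le> (LINT v|circle_measure. norm (poisson_kernel ?z v *\<^sub>R f v))"
      unfolding poisson_integral_eq by (rule integral_norm_bound)
    also have "\<dots> = (LINT v|circle_measure. poisson_kernel ?z v * norm (f v))"
      using poisson_kernel_nonneg[of ?z] z by simp
    also have "\<dots> \<le> (LINT v|circle_measure. (9/4) * (poisson_kernel (of_real \<rho> * w) v * norm (f v)))"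
    proof (rule integral_mono)
      show "integrable circle_measure (\<lambda>v. poisson_kernel ?z v * norm (f v))"
        using integrable_poisson_kernel_times[OF in_f z] by simp
      show "integrable circle_measure (\<lambda>v. (9/4) * (poisson_kernel (of_real \<rho> * w) v * norm (f v)))"
        using integrable_poisson_kernel_times[OF in_f wz] by simp
      fix v assume "v \<in> space circle_measure"
      then have v: "norm v = 1" by simp
      have "(4/9) * poisson_kernel ?z v \<le> poisson_kernel (of_real \<rho> * w) v"
        by (rule poisson_kernel_harnack[OF \<rho> \<zeta> w1 norm_open_arc_diff[OF \<zeta> w] v])
      then have "poisson_kernel ?z v * norm (f v) \<le> ((9/4) * poisson_kernel (of_real \<rho> * w) v) * norm (f v)"
        by (intro mult_right_mono) auto
      then show "poisson_kernel ?z v * norm (f v) \<le> (9/4) * (poisson_kernel (of_real \<rho> * w) v * norm (f v))"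
        by (simp only: mult.assoc)
    qed
    also have "\<dots> = u w" unfolding u_def by (rule integral_mult_right_zero)
    finally show ?thesis .
  qed
  \<comment> \<open>The arc is itself open, so it is one of the sets over which the outer infimum is
    taken.\<close>
  have "mu_capacity \<mu> (open_arc \<zeta> (1 - \<rho>)) \<le> mu_capacity_open \<mu> (open_arc \<zeta> (1 - \<rho>))"
    unfolding mu_capacity_def using openin_open_arc[of \<zeta> "1 - \<rho>"] \<rho> \<zeta> by (intro INF_lower) auto
  also have "\<dots> \<le> mu_norm_sq \<mu> (\<lambda>w. complex_of_real (u w))"
    unfolding mu_capacity_open_def using uh u0 u1 by (intro INF_lower) auto
  also have "\<dots> \<le> ennreal 3119 * mu_norm_sq \<mu> f" by (rule le)
  also have "\<dots> = ennreal (3119 / Re (mu_kernel \<mu> ?z ?z))"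
    unfolding mu_norm_sq_energy[OF dirichletD(1)[OF f(1)]] f(3)
    by (subst ennreal_mult'[symmetric]) auto
  finally show ?thesis .
qed

text \<open>Every competitor u yields an element of the Dirichlet space with energy at most 616
  times that of u and modulus at least 1 / (50 pi) at \<rho> \<zeta>; the kernel inequality then
  bounds the energy of u from below. 1540000 is 50^2 * 616.\<close>

lemma mu_capacity_ge:
  assumes \<rho>: "0 \<le> \<rho>" "\<rho> < 1" and \<zeta>: "norm \<zeta> = 1"
  shows "ennreal (1 / (1540000 * pi\<^sup>2) / Re (mu_kernel \<mu> (of_real \<rho> * \<zeta>) (of_real \<rho> * \<zeta>))) \<le>
    mu_capacity \<mu> (open_arc \<zeta> (1 - \<rho>))"
  unfolding mu_capacity_def mu_capacity_open_def
proof (intro INF_greatest)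
  let ?z = "of_real \<rho> * \<zeta>" and ?K = "Re (mu_kernel \<mu> (of_real \<rho> * \<zeta>) (of_real \<rho> * \<zeta>))"
  fix U and u :: "complex \<Rightarrow> real"
  assume "U \<in> {U. openin (top_of_set unit_circle) U \<and> open_arc \<zeta> (1 - \<rho>) \<subseteq> U}"
    and "u \<in> {u. (\<lambda>z. complex_of_real (u z)) \<in> harmonic_dirichlet_space \<mu> \<and>
      (AE z in circle_measure. 0 \<le> u z) \<and> (AE z in circle_measure. z \<in> U \<longrightarrow> 1 \<le> u z)}"
  then have U: "open_arc \<zeta> (1 - \<rho>) \<subseteq> U"
    and uh: "(\<lambda>z. complex_of_real (u z)) \<in> harmonic_dirichlet_space \<mu>"
    and u0: "AE z in circle_measure. 0 \<le> u z" and u1: "AE z in circle_measure. z \<in> U \<longrightarrow> 1 \<le> u z"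
    by auto
  define F where "F = (\<lambda>z. complex_of_real (u z))"
  have FL: "F \<in> L2_circle" using harmonicD(1)[OF uh] by (simp add: F_def)
  note Fi = L2_circle_integrable[OF FL]
  have Fr: "cnj (F w) = F w" for w by (simp add: F_def)
  have F0: "fourier_coeff F 0 \<in> \<real>"
    using fourier_coeff_cnj[of F 0] Fr by (simp add: Reals_cnj_iff)
  \<comment> \<open>Coefficients of the analytic half of the dilation: the constant term is halved
    so that twice the real part restores it exactly once.\<close>
  define d where "d n = (if n = 0 then fourier_coeff F 0 / 2 else fourier_coeff F (int n) * of_real (\<rho> ^ n))" for n :: nat
  define M where "M = (LINT w|circle_measure. norm (F w))"
  have "summable (\<lambda>n. real n * norm (d n))"
  proof (rule summable_comparison_test')
    have "summable (\<lambda>n. of_nat (Suc n) * \<rho> ^ n)"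
      using geometric_deriv_sums[of \<rho>] \<rho> by (intro sums_summable) auto
    then show "summable (\<lambda>n. M * (of_nat (Suc n) * \<rho> ^ n))" by (rule summable_mult)
    fix n :: nat
    have "0 \<le> M" unfolding M_def by (intro integral_nonneg_AE) simp
    moreover have "norm (d n) \<le> M * \<rho> ^ n" if "n \<noteq> 0"
      using that norm_fourier_coeff_le[of F "int n"] \<rho>
      by (simp add: d_def norm_mult norm_power M_def mult_right_mono)
    ultimately have "real n * norm (d n) \<le> real (Suc n) * (M * \<rho> ^ n)"
      using \<rho> by (cases "n = 0") (auto intro!: mult_mono)
    then show "norm (real n * norm (d n)) \<le> M * (of_nat (Suc n) * \<rho> ^ n)" by (simp add: mult_ac)
  qed
  then interpret A: analytic_series d by unfold_locales
  have val: "A.val w = disc_value F (of_real \<rho> * w) - fourier_coeff F 0 / 2" if w: "norm w \<le> 1" for w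
  proof -
    have rw: "norm (of_real \<rho> * w) < 1"
      using \<rho> w mult_left_mono[of "norm w" 1 \<rho>] by (simp add: norm_mult)
    have s: "summable (\<lambda>n. if n = 0 then fourier_coeff F 0 / 2 else 0 :: complex)"
      by (rule summable_finite[of "{0}"]) auto
    have "A.val w + (\<Sum>n::nat. if n = 0 then fourier_coeff F 0 / 2 else 0) =
        (\<Sum>n. d n * w ^ n + (if n = 0 then fourier_coeff F 0 / 2 else 0))"
      unfolding A.val_def by (rule suminf_add[OF A.summable_val[OF w] s])
    also have "\<dots> = disc_value F (of_real \<rho> * w)"
      unfolding disc_value_def by (intro suminf_cong) (auto simp: d_def power_mult_distrib)
    also have "(\<Sum>n::nat. if n = 0 then fourier_coeff F 0 / 2 else 0) = fourier_coeff F 0 / 2"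
      using suminf_finite[of "{0::nat}" "\<lambda>n. if n = 0 then fourier_coeff F 0 / 2 else 0"] by simp
    finally show ?thesis by (simp add: algebra_simps)
  qed
  have pF: "poisson_integral F (of_real \<rho> * w) = of_real (2 * Re (A.val w))" if w: "norm w \<le> 1" for w
  proof -
    have rw: "norm (of_real \<rho> * w) < 1"
      using \<rho> w mult_left_mono[of "norm w" 1 \<rho>] by (simp add: norm_mult)
    show ?thesis
      unfolding poisson_integral_real[OF Fi Fr rw] val[OF w] using F0
      by (auto elim!: Reals_cases simp: of_real_diff)
  qed
  \<comment> \<open>On the circle the dilation of F is 2 Re p, at w and at \<xi> alike. So the
    dilation bound, stated for the energy at the actual value at \<xi>, feeds directly into
    \<open>local_energy_val_le\<close>.\<close>
  have local: "local_energy (dilation \<rho> F) (dilation \<rho> F \<xi>) \<xi> = local_energy (\<lambda>w. of_real (2 * Re (A.val w))) (of_real (2 * Re (A.val \<xi>))) \<xi>"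
    if "norm \<xi> = 1" for \<xi>
    unfolding local_energy_def dilation_def using that pF by (intro nn_integral_cong) simp
  have le: "mu_norm_sq \<mu> A.val \<le> 616 * mu_norm_sq \<mu> F"
  proof (rule mu_norm_sq_le[OF FL])
    have "circle_norm_sq A.val \<le> circle_norm_sq (\<lambda>w. of_real (2 * Re (A.val w)))"
      using F0 by (intro A.circle_norm_sq_val_le) (auto simp: d_def intro!: Reals_divide)
    also have "\<dots> = circle_norm_sq (dilation \<rho> F)"
      unfolding dilation_def using pF by (intro nn_integral_cong) simp
    also have "\<dots> \<le> circle_norm_sq F" by (rule circle_norm_sq_dilation_le[OF FL \<rho>])
    also have "\<dots> \<le> 616 * circle_norm_sq F"
      using mult_right_mono[of 1 "616::ennreal" "circle_norm_sq F"] by simp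
    finally show "circle_norm_sq A.val \<le> 616 * circle_norm_sq F" .
    fix \<xi> :: complex assume \<xi>: "norm \<xi> = 1"
    have "local_dirichlet_integral A.val \<xi> \<le> local_energy A.val (A.val \<xi>) \<xi>"
      by (rule local_dirichlet_integral_le[OF A.val_L2 \<xi>])
    also have "\<dots> \<le> local_energy (dilation \<rho> F) (dilation \<rho> F \<xi>) \<xi>"
      unfolding local[OF \<xi>] by (rule A.local_energy_val_le[OF \<xi>])
    also have "\<dots> \<le> 616 * local_dirichlet_integral F \<xi>"
      unfolding local_dirichlet_integral_eq[OF FL \<xi>] by (rule local_energy_dilation_le[OF FL \<rho> \<xi>])
    finally show "local_dirichlet_integral A.val \<xi> \<le> 616 * local_dirichlet_integral F \<xi>" .
  qed
  have FN: "mu_norm_sq \<mu> F = ennreal (energy F)"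
    using mu_norm_sq_energy[OF uh] by (simp add: F_def)
  have le': "mu_norm_sq \<mu> A.val \<le> ennreal (616 * energy F)"
    using le unfolding FN by (simp add: ennreal_mult)
  have vh: "A.val \<in> harmonic_dirichlet_space \<mu>"
    using A.val_L2 le' by (auto simp: harmonic_dirichlet_space_def intro: order.strict_trans1)
  then have vD: "A.val \<in> dirichlet_space \<mu>" by (simp add: dirichlet_space_def A.val_hardy)
  have en: "energy A.val \<le> 616 * energy F"
    using le' unfolding mu_norm_sq_energy[OF vh] by simp
  have z: "norm ?z < 1" "norm ?z \<le> 1" using \<rho> \<zeta> by (auto simp: norm_mult)
  have "integrable circle_measure u" using integrable_Re[OF Fi] by (simp add: F_def)
  then have "1 / (25 * pi) \<le> (LINT w|circle_measure. poisson_kernel (of_real (\<rho>\<^sup>2) * \<zeta>) w * u w)"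
    using u0 u1 U by (intro poisson_integral_open_arc_ge \<rho> \<zeta>) (auto elim: eventually_mono)
  \<comment> \<open>The value of 2 Re p at \<rho> \<zeta> is the Poisson integral of F at \<rho> *
    \<rho> \<zeta>, one further factor \<rho> inside the disc.\<close>
  moreover have "of_real (LINT w|circle_measure. poisson_kernel (of_real (\<rho>\<^sup>2) * \<zeta>) w * u w) = complex_of_real (2 * Re (A.val ?z))"
    using pF[OF z(2)] unfolding F_def poisson_integral_of_real by (simp add: power2_eq_square mult.assoc)
  ultimately have "1 / (25 * pi) \<le> 2 * Re (A.val ?z)" by (simp only: of_real_eq_iff)
  then have "1 / (50 * pi) \<le> norm (A.val ?z)"
    using complex_Re_le_cmod[of "A.val ?z"] by simp
  then have "(1 / (50 * pi))\<^sup>2 \<le> (norm (disc_value A.val ?z))\<^sup>2"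
    unfolding A.disc_value_val by (rule power_mono) simp
  also have "\<dots> \<le> ?K * energy A.val" by (rule mu_kernel_bound[OF z(1) vD])
  also have "\<dots> \<le> ?K * (616 * energy F)"
    using en mu_kernel_pos[OF z(1)] by (intro mult_left_mono) auto
  finally have "1 / (1540000 * pi\<^sup>2) / ?K \<le> energy F"
    using mu_kernel_pos[OF z(1)] by (simp add: field_simps power2_eq_square)
  then show "ennreal (1 / (1540000 * pi\<^sup>2) / ?K) \<le> mu_norm_sq \<mu> (\<lambda>z. complex_of_real (u z))"
    using FN by (simp add: F_def ennreal_leI)
qed

end

theorem theorem2:
  shows "\<exists>c C :: real. 0 < c \<and> c \<le> C \<and>
    (\<forall>(\<mu> :: complex measure) (\<zeta> :: complex) (\<rho> :: real).
       finite_borel_measure_on_circle \<mu> \<longrightarrow> \<zeta> \<in> unit_circle \<longrightarrow> 0 \<le> \<rho> \<longrightarrow> \<rho> < 1 \<longrightarrow>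
       ennreal (c / Re (mu_kernel \<mu> (of_real \<rho> * \<zeta>) (of_real \<rho> * \<zeta>)))
         \<le> mu_capacity \<mu> (open_arc \<zeta> (1 - \<rho>)) \<and>
       mu_capacity \<mu> (open_arc \<zeta> (1 - \<rho>))
         \<le> ennreal (C / Re (mu_kernel \<mu> (of_real \<rho> * \<zeta>) (of_real \<rho> * \<zeta>))))"
proof -
  let ?c = "1 / (1540000 * pi\<^sup>2)"
  have "1 \<le> 1540000 * pi\<^sup>2" using pi_ge_two power_mono[of 2 pi 2] by simp
  then have c1: "?c \<le> 1" by (simp add: divide_le_eq)
  have "0 < ?c" by simp
  moreover have "?c \<le> 3119" using c1 by (rule order_trans) simp
  moreover have "ennreal (?c / Re (mu_kernel \<mu> (of_real \<rho> * \<zeta>) (of_real \<rho> * \<zeta>))) \<le> mu_capacity \<mu> (open_arc \<zeta> (1 - \<rho>)) \<and>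
      mu_capacity \<mu> (open_arc \<zeta> (1 - \<rho>)) \<le> ennreal (3119 / Re (mu_kernel \<mu> (of_real \<rho> * \<zeta>) (of_real \<rho> * \<zeta>)))"
    if "finite_borel_measure_on_circle \<mu>" "\<zeta> \<in> unit_circle" "0 \<le> \<rho>" "\<rho> < 1" for \<mu> \<zeta> \<rho>
  proof -
    interpret finite_circle_measure \<mu>
      using that(1) by (intro finite_circle_measure.intro finite_circle_measure_axioms.intro)
        (auto simp: finite_borel_measure_on_circle_def)
    show ?thesis using mu_capacity_ge mu_capacity_le that by simp
  qed
  ultimately show ?thesis by blast
qed

end
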